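(* Let $\bar G$ be a finite group and let $A=\bigoplus_{\bar g\in\bar G}A_{\bar g}$ and $A'=\bigoplus_{\bar g\in\bar G}A'_{\bar g}$ be $\bar G$-graded crossed products over $\mathcal{O}$ with identity components $B$ and $B'$. Let $M$ be a $(B,B')$-bimodule with $B$-dual $M^*=\mathrm{Hom}_B(M,B)$, and assume that $\tilde M=A\otimes_B M$ and $\tilde M^*=A'\otimes_{B'}M^*$ give a $\bar G$-graded Morita equivalence between $A$ and $A'$. Let $U$ be a $B$-module, let $U'=M^*\otimes_B U$, and let $E(U)=\mathrm{End}_A(A\otimes_B U)^{\mathrm{op}}$, $E(U')=\mathrm{End}_{A'}(A'\otimes_{B'}U')^{\mathrm{op}}$. Then the diagram $$\begin{array}{ccc} E(U) & \xrightarrow{\ \varphi_1\ } & E(U')\\ {\scriptstyle\theta}\uparrow & & \uparrow{\scriptstyle\theta'}\\ C_A(B) & \xrightarrow{\ \varphi_2\ } & C_{A'}(B')\end{array}$$ is commutative, that is, $\varphi_1\circ\theta=\theta'\circ\varphi_2$, and its horizontal maps $\varphi_1,\varphi_2$ are algebra isomorphisms, where the maps are defined as follows, for all $a\in A$, $a'\in A'$, $c\in C_A(B)$, $c'\in C_{A'}(B')$, $u\in U$, $u'\in U'$ and $f\in E(U)$: $$\theta(c)(a\otimes u)=ac\otimes u,\qquad \theta'(c')(a'\otimes u')=a'c'\otimes u',$$ $$\varphi_1(f)=(\beta\otimes_B \mathrm{id}_U)^{-1}\circ(\mathrm{id}_{\tilde M^*}\otimes f)\circ(\beta\otimes_B\mathrm{id}_U),\qquad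 \varphi_2(c)=\tilde\varphi\Big(\sum_{j\in J}m_j^*c\otimes m_j\Big).$$ Here $\beta$, $\tilde\varphi$, $m_j$, $m_j^*$ are as specified in the context.
   Context: $(\mathcal{K},\mathcal{O},k)$ is a $p$-modular system; algebras are $\mathcal{O}$-algebras. A $\bar G$-graded crossed product is a $\bar G$-graded algebra $A$ such that each component $A_{\bar g}$ contains an invertible element of $A$; fix invertible elements $u_{\bar g}\in A_{\bar g}$. $C_A(B)$ is the centralizer of $B$ in $A$. $\bar G$-graded Morita equivalence: the $\bar G$-graded $(A,A')$-bimodule $\tilde M$ satisfies $\tilde M\otimes_{A'}\tilde M^*\cong A$ as $\bar G$-graded $(A,A)$-bimodules and $\tilde M^*\otimes_A\tilde M\cong A'$ as $\bar G$-graded $(A',A')$-bimodules, where $\tilde M^*=\mathrm{Hom}_A(\tilde M,A)$ is a $\bar G$-graded $(A',A)$-bimodule, identified with $A'\otimes_{B'}M^*$. $M$ and $M^*$ are identified with the identity components of $\tilde M$ and $\tilde M^*$. Products such as $m^*c$ and $a'_{\bar g}m^*u_{\bar g}^{-1}$ (with $m^*\in M^*$, $c\in A$, $a'_{\bar g}\in A'_{\bar g}$) are computed in the bimodule $\tilde M^*$; note that $a'_{\bar g}m^*u_{\bar g}^{-1}\in M^*$. Isomorphisms of $\bar G$-graded bimodules $\tilde\varphi:\tilde M^*\otimes_A\tilde M\to A'$ and $\tilde\psi:\tilde M\otimes_{A'}\tilde M^*\to A$ are chosen such that $\tilde\psi(\tilde m\otimes\tilde m^* )\tilde n=\tilde m\,\tilde\varphi(\tilde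 m^*\otimes\tilde n)$ and $\tilde\varphi(\tilde m^*\otimes\tilde m)\tilde n^*=\tilde m^*\,\tilde\psi(\tilde m\otimes\tilde n^* )$ for all $\tilde m,\tilde n\in\tilde M$ and $\tilde m^*,\tilde n^*\in\tilde M^*$. A finite set $J$ and elements $m_j^*\in M^*$, $m_j\in M$ ($j\in J$) are chosen such that $\tilde\varphi(\sum_{j\in J}m_j^*\otimes m_j)=1_{A'}=1_{B'}$. $\beta:A'\otimes_{B'}M^*\to M^*\otimes_B A$ is the isomorphism of $\bar G$-graded bimodules given by $a'_{\bar g}\otimes m^*\mapsto a'_{\bar g}m^*u_{\bar g}^{-1}\otimes u_{\bar g}$ for $a'_{\bar g}\in A'_{\bar g}$, $m^*\in M^*$. It induces the isomorphism $\beta\otimes_B\mathrm{id}_U:A'\otimes_{B'}U'=A'\otimes_{B'}M^*\otimes_BU\to M^*\otimes_BA\otimes_BU$. The map $\mathrm{id}_{\tilde M^*}\otimes f$ is the endomorphism of $\tilde M^*\otimes_A(A\otimes_BU)$, which via $\tilde M^*\cong M^*\otimes_BA$ becomes the endomorphism $m^*\otimes x\mapsto m^*\otimes f(x)$ ($m^*\in M^*$, $x\in A\otimes_BU$) of $M^*\otimes_BA\otimes_BU$. *)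

theory Defs
  imports "HOL-Algebra.Algebra"
begin

section \<open>\<open>p\<close>-modular systems\<close>

text \<open>
  The maximal ideal of a discrete valuation ring is \<open>(\<pi>)\<close>, so its \<open>n\<close>-th power is
  \<open>(\<pi>^n)\<close>; \<open>complete\<close> is convergence of \<open>(\<pi>)\<close>-adic Cauchy sequences, stated for
  sequences that represent an element of the inverse limit of the quotients by these powers.
\<close>

locale complete_dvr = principal_domain R for R (structure) +
  assumes not_field: "\<not> field R"
    and local_ring: "\<exists>!I. maximalideal I R"
    and complete:
      "\<lbrakk>\<pi> \<in> carrier R; maximalideal (PIdl \<pi>) R;
        \<And>n::nat. x n \<in> carrier R; \<And>n. x (Suc n) \<ominus> x n \<in> PIdl (\<pi> [^] n)\<rbrakk>
       \<Longrightarrow> \<exists>y \<in> carrier R. \<forall>n. y \<ominus> x n \<in> PIdl (\<pi> [^] n)"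

definition has_char :: "('a, 'x) ring_scheme \<Rightarrow> nat \<Rightarrow> bool" where
  "has_char R p \<longleftrightarrow> (\<forall>n::nat. [n] \<cdot>\<^bsub>R\<^esub> \<one>\<^bsub>R\<^esub> = \<zero>\<^bsub>R\<^esub> \<longleftrightarrow> p dvd n)"

text \<open>
  The kernel of the surjection onto the field \<open>k\<close> is a maximal ideal, hence the unique one,
  so \<open>k\<close> is the residue field.
\<close>

definition p_modular_system ::
  "nat \<Rightarrow> ('q, 'x) ring_scheme \<Rightarrow> ('o, 'y) ring_scheme \<Rightarrow> ('k, 'z) ring_scheme \<Rightarrow> bool" where
  "p_modular_system p \<K> \<O> k \<longleftrightarrow>
     normalization_semidom_class.prime p \<and> complete_dvr \<O> \<and> field \<K> \<and> has_char \<K> 0 \<and> field k \<and> has_char k p \<and>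
     (\<exists>\<iota> \<in> ring_hom \<O> \<K>. inj_on \<iota> (carrier \<O>) \<and>
        (\<forall>x \<in> carrier \<K>. \<exists>a \<in> carrier \<O>. \<exists>b \<in> carrier \<O> - {\<zero>\<^bsub>\<O>\<^esub>}.
           x = \<iota> a \<otimes>\<^bsub>\<K>\<^esub> inv\<^bsub>\<K>\<^esub> \<iota> b)) \<and>
     (\<exists>\<rho> \<in> ring_hom \<O> k. \<rho> ` carrier \<O> = carrier k)"


section \<open>Algebras, modules and bimodules over non-commutative rings\<close>

locale assoc_algebra = module + ring M +
  assumes smult_mult_left:
      "\<lbrakk>a \<in> carrier R; x \<in> carrier M; y \<in> carrier M\<rbrakk> \<Longrightarrow>
       (a \<odot>\<^bsub>M\<^esub> x) \<otimes>\<^bsub>M\<^esub> y = a \<odot>\<^bsub>M\<^esub> (x \<otimes>\<^bsub>M\<^esub> y)"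
    and smult_mult_right:
      "\<lbrakk>a \<in> carrier R; x \<in> carrier M; y \<in> carrier M\<rbrakk> \<Longrightarrow>
       x \<otimes>\<^bsub>M\<^esub> (a \<odot>\<^bsub>M\<^esub> y) = a \<odot>\<^bsub>M\<^esub> (x \<otimes>\<^bsub>M\<^esub> y)"

text \<open>
  One-sided modules and bimodules are represented by extensions of the library's record of
  modules; its fields \<open>mult\<close> and \<open>one\<close> are irrelevant for them.
\<close>

record ('r, 'm, 's) bimod = "('r, 'm) module" +
  rsmult :: "'m \<Rightarrow> 's \<Rightarrow> 'm" (infixl "\<triangleleft>\<index>" 70)

locale left_module = R?: ring R + M?: abelian_group M
  for R :: "('r, 'w) ring_scheme" (structure) and M :: "('r, 'm, 'x) module_scheme" (structure) +
  assumes lact_closed: "\<lbrakk>a \<in> carrier R; x \<in> carrier M\<rbrakk> \<Longrightarrow> a \<odot>\<^bsub>M\<^esub> x \<in> carrier M"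
    and lact_l_distr: "\<lbrakk>a \<in> carrier R; b \<in> carrier R; x \<in> carrier M\<rbrakk> \<Longrightarrow>
      (a \<oplus>\<^bsub>R\<^esub> b) \<odot>\<^bsub>M\<^esub> x = a \<odot>\<^bsub>M\<^esub> x \<oplus>\<^bsub>M\<^esub> b \<odot>\<^bsub>M\<^esub> x"
    and lact_r_distr: "\<lbrakk>a \<in> carrier R; x \<in> carrier M; y \<in> carrier M\<rbrakk> \<Longrightarrow>
      a \<odot>\<^bsub>M\<^esub> (x \<oplus>\<^bsub>M\<^esub> y) = a \<odot>\<^bsub>M\<^esub> x \<oplus>\<^bsub>M\<^esub> a \<odot>\<^bsub>M\<^esub> y"
    and lact_assoc: "\<lbrakk>a \<in> carrier R; b \<in> carrier R; x \<in> carrier M\<rbrakk> \<Longrightarrow>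
      (a \<otimes>\<^bsub>R\<^esub> b) \<odot>\<^bsub>M\<^esub> x = a \<odot>\<^bsub>M\<^esub> (b \<odot>\<^bsub>M\<^esub> x)"
    and lact_one: "x \<in> carrier M \<Longrightarrow> \<one>\<^bsub>R\<^esub> \<odot>\<^bsub>M\<^esub> x = x"

locale bimodule = left_module R M + S?: ring S
  for R :: "('r, 'w) ring_scheme" (structure) and S :: "('s, 'v) ring_scheme" (structure)
    and M :: "('r, 'm, 's, 'x) bimod_scheme" (structure) +
  assumes ract_closed: "\<lbrakk>x \<in> carrier M; s \<in> carrier S\<rbrakk> \<Longrightarrow> x \<triangleleft>\<^bsub>M\<^esub> s \<in> carrier M"
    and ract_r_distr: "\<lbrakk>x \<in> carrier M; s \<in> carrier S; t \<in> carrier S\<rbrakk> \<Longrightarrow>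
      x \<triangleleft>\<^bsub>M\<^esub> (s \<oplus>\<^bsub>S\<^esub> t) = x \<triangleleft>\<^bsub>M\<^esub> s \<oplus>\<^bsub>M\<^esub> x \<triangleleft>\<^bsub>M\<^esub> t"
    and ract_l_distr: "\<lbrakk>x \<in> carrier M; y \<in> carrier M; s \<in> carrier S\<rbrakk> \<Longrightarrow>
      (x \<oplus>\<^bsub>M\<^esub> y) \<triangleleft>\<^bsub>M\<^esub> s = x \<triangleleft>\<^bsub>M\<^esub> s \<oplus>\<^bsub>M\<^esub> y \<triangleleft>\<^bsub>M\<^esub> s"
    and ract_assoc: "\<lbrakk>x \<in> carrier M; s \<in> carrier S; t \<in> carrier S\<rbrakk> \<Longrightarrow>
      x \<triangleleft>\<^bsub>M\<^esub> (s \<otimes>\<^bsub>S\<^esub> t) = (x \<triangleleft>\<^bsub>M\<^esub> s) \<triangleleft>\<^bsub>M\<^esub> t"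
    and ract_one: "x \<in> carrier M \<Longrightarrow> x \<triangleleft>\<^bsub>M\<^esub> \<one>\<^bsub>S\<^esub> = x"
    and lact_ract: "\<lbrakk>a \<in> carrier R; x \<in> carrier M; s \<in> carrier S\<rbrakk> \<Longrightarrow>
      (a \<odot>\<^bsub>M\<^esub> x) \<triangleleft>\<^bsub>M\<^esub> s = a \<odot>\<^bsub>M\<^esub> (x \<triangleleft>\<^bsub>M\<^esub> s)"

text \<open>
  As usual for bimodules over \<open>\<O>\<close>-algebras, the two induced actions of \<open>\<O>\<close> coincide.
\<close>

definition algebra_bimodule ::
  "('o, 'w) ring_scheme \<Rightarrow> ('o, 'a, 'x) module_scheme \<Rightarrow> ('o, 'b, 'y) module_scheme \<Rightarrow>
   ('a, 'm, 'b, 'z) bimod_scheme \<Rightarrow> bool" where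
  "algebra_bimodule \<O> A A' M \<longleftrightarrow>
     assoc_algebra \<O> A \<and> assoc_algebra \<O> A' \<and> bimodule A A' M \<and>
     (\<forall>r \<in> carrier \<O>. \<forall>x \<in> carrier M. (r \<odot>\<^bsub>A\<^esub> \<one>\<^bsub>A\<^esub>) \<odot>\<^bsub>M\<^esub> x = x \<triangleleft>\<^bsub>M\<^esub> (r \<odot>\<^bsub>A'\<^esub> \<one>\<^bsub>A'\<^esub>))"

definition regular :: "('o, 'a, 'x) module_scheme \<Rightarrow> ('a, 'a, 'a) bimod" where
  "regular A = \<lparr>carrier = carrier A, monoid.mult = monoid.mult A, one = \<one>\<^bsub>A\<^esub>,
     ring.zero = \<zero>\<^bsub>A\<^esub>, ring.add = ring.add A,
     module.smult = monoid.mult A, rsmult = monoid.mult A\<rparr>"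

definition centralizer :: "('a, 'x) monoid_scheme \<Rightarrow> 'a set \<Rightarrow> 'a set" where
  "centralizer A S = {a \<in> carrier A. \<forall>s \<in> S. a \<otimes>\<^bsub>A\<^esub> s = s \<otimes>\<^bsub>A\<^esub> a}"

definition algebra_iso ::
  "('o, 'w) ring_scheme \<Rightarrow> ('o, 'a, 'x) module_scheme \<Rightarrow> ('o, 'b, 'y) module_scheme \<Rightarrow>
   ('a \<Rightarrow> 'b) set" where
  "algebra_iso \<O> E E' = {\<phi> \<in> ring_hom E E'. bij_betw \<phi> (carrier E) (carrier E') \<and>
     (\<forall>r \<in> carrier \<O>. \<forall>x \<in> carrier E. \<phi> (r \<odot>\<^bsub>E\<^esub> x) = r \<odot>\<^bsub>E'\<^esub> \<phi> x)}"

text \<open>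
  Maps between structures are taken to be extensional, so that equal maps are equal as
  HOL functions.
\<close>

definition linear_maps ::
  "('r, 'w) ring_scheme \<Rightarrow> ('r, 'm, 'x) module_scheme \<Rightarrow> ('r, 'n, 'y) module_scheme \<Rightarrow> ('m \<Rightarrow> 'n) set"
  where "linear_maps R P Q =
    {f \<in> extensional (carrier P) \<inter> hom (add_monoid P) (add_monoid Q).
       \<forall>r \<in> carrier R. \<forall>x \<in> carrier P. f (r \<odot>\<^bsub>P\<^esub> x) = r \<odot>\<^bsub>Q\<^esub> f x}"

text \<open>
  \<open>End_A(N)\<^sup>o\<^sup>p\<close> as an \<open>\<O>\<close>-algebra, where \<open>\<O>\<close> acts on \<open>N\<close> through \<open>A\<close>.
  Note the order of the factors in the product.
\<close>

definition end_op ::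
  "('o, 'a, 'x) module_scheme \<Rightarrow> ('a, 'n, 'y) module_scheme \<Rightarrow> ('o, 'n \<Rightarrow> 'n) module" where
  "end_op A N = \<lparr>carrier = linear_maps A N N,
     monoid.mult = (\<lambda>f g. compose (carrier N) g f),
     one = (\<lambda>x \<in> carrier N. x),
     ring.zero = (\<lambda>x \<in> carrier N. \<zero>\<^bsub>N\<^esub>),
     ring.add = (\<lambda>f g. \<lambda>x \<in> carrier N. f x \<oplus>\<^bsub>N\<^esub> g x),
     module.smult = (\<lambda>r f. \<lambda>x \<in> carrier N. (r \<odot>\<^bsub>A\<^esub> \<one>\<^bsub>A\<^esub>) \<odot>\<^bsub>N\<^esub> f x)\<rparr>"

text \<open>
  The dual \<open>Hom_R(P, R)\<close> of an \<open>(R, S)\<close>-bimodule \<open>P\<close>, with the \<open>(S, R)\<close>-bimodule structure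
  \<open>(s f r)(x) = f(x s) r\<close>.
\<close>

definition dual ::
  "('o, 'r, 'w) module_scheme \<Rightarrow> ('r, 'm, 's, 'x) bimod_scheme \<Rightarrow> ('s, 'm \<Rightarrow> 'r, 'r) bimod" where
  "dual R P = \<lparr>carrier = linear_maps R P (regular R),
     monoid.mult = undefined, one = undefined,
     ring.zero = (\<lambda>x \<in> carrier P. \<zero>\<^bsub>R\<^esub>),
     ring.add = (\<lambda>f g. \<lambda>x \<in> carrier P. f x \<oplus>\<^bsub>R\<^esub> g x),
     module.smult = (\<lambda>s f. \<lambda>x \<in> carrier P. f (x \<triangleleft>\<^bsub>P\<^esub> s)),
     rsmult = (\<lambda>f r. \<lambda>x \<in> carrier P. f x \<otimes>\<^bsub>R\<^esub> r)\<rparr>"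


section \<open>Tensor products\<close>

text \<open>
  \<open>P \<otimes>_B Q\<close> for a right \<open>B\<close>-module \<open>P\<close> and a left \<open>B\<close>-module \<open>Q\<close>: the free abelian group
  on the pairs modulo the usual relations.
\<close>

definition tensor_rels ::
  "('b, 'w) ring_scheme \<Rightarrow> ('l, 'x, 'b, 'u) bimod_scheme \<Rightarrow> ('b, 'y, 'v) module_scheme \<Rightarrow>
   ('x \<times> 'y \<Rightarrow>\<^sub>0 int) set" where
  "tensor_rels B P Q =
     {frag_of (x \<oplus>\<^bsub>P\<^esub> x', y) - frag_of (x, y) - frag_of (x', y) | x x' y.
        x \<in> carrier P \<and> x' \<in> carrier P \<and> y \<in> carrier Q} \<union>
     {frag_of (x, y \<oplus>\<^bsub>Q\<^esub> y') - frag_of (x, y) - frag_of (x, y') | x y y'.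
        x \<in> carrier P \<and> y \<in> carrier Q \<and> y' \<in> carrier Q} \<union>
     {frag_of (x \<triangleleft>\<^bsub>P\<^esub> b, y) - frag_of (x, b \<odot>\<^bsub>Q\<^esub> y) | x b y.
        x \<in> carrier P \<and> b \<in> carrier B \<and> y \<in> carrier Q}"

definition tensor_null ::
  "('b, 'w) ring_scheme \<Rightarrow> ('l, 'x, 'b, 'u) bimod_scheme \<Rightarrow> ('b, 'y, 'v) module_scheme \<Rightarrow>
   ('x \<times> 'y \<Rightarrow>\<^sub>0 int) set" where
  "tensor_null B P Q =
     generate (free_Abelian_group (carrier P \<times> carrier Q)) (tensor_rels B P Q)"

definition tensor_grp ::
  "('b, 'w) ring_scheme \<Rightarrow> ('l, 'x, 'b, 'u) bimod_scheme \<Rightarrow> ('b, 'y, 'v) module_scheme \<Rightarrow>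
   ('x \<times> 'y \<Rightarrow>\<^sub>0 int) set monoid" where
  "tensor_grp B P Q = free_Abelian_group (carrier P \<times> carrier Q) Mod tensor_null B P Q"

definition ten ::
  "('b, 'w) ring_scheme \<Rightarrow> ('l, 'x, 'b, 'u) bimod_scheme \<Rightarrow> ('b, 'y, 'v) module_scheme \<Rightarrow>
   'x \<Rightarrow> 'y \<Rightarrow> ('x \<times> 'y \<Rightarrow>\<^sub>0 int) set" where
  "ten B P Q x y =
     tensor_null B P Q #>\<^bsub>free_Abelian_group (carrier P \<times> carrier Q)\<^esub> frag_of (x, y)"

text \<open>The same group in additive notation; \<open>mult\<close> and \<open>one\<close> are irrelevant.\<close>

definition tensor_ab ::
  "('b, 'w) ring_scheme \<Rightarrow> ('l, 'x, 'b, 'u) bimod_scheme \<Rightarrow> ('b, 'y, 'v) module_scheme \<Rightarrow>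
   ('x \<times> 'y \<Rightarrow>\<^sub>0 int) set ring" where
  "tensor_ab B P Q = \<lparr>carrier = carrier (tensor_grp B P Q), monoid.mult = undefined, one = undefined,
     ring.zero = \<one>\<^bsub>tensor_grp B P Q\<^esub>, ring.add = monoid.mult (tensor_grp B P Q)\<rparr>"

text \<open>
  The unique homomorphism \<open>P \<otimes>_B Q \<rightarrow> Z\<close> with \<open>x \<otimes> y \<mapsto> h x y\<close>, for a biadditive
  \<open>B\<close>-balanced map \<open>h\<close>.
\<close>

definition tensor_lift ::
  "('b, 'w) ring_scheme \<Rightarrow> ('l, 'x, 'b, 'u) bimod_scheme \<Rightarrow> ('b, 'y, 'v) module_scheme \<Rightarrow>
   ('z, 't) ring_scheme \<Rightarrow> ('x \<Rightarrow> 'y \<Rightarrow> 'z) \<Rightarrow> ('x \<times> 'y \<Rightarrow>\<^sub>0 int) set \<Rightarrow> 'z" where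
  "tensor_lift B P Q Z h = (THE \<phi>.
     \<phi> \<in> extensional (carrier (tensor_ab B P Q)) \<inter> hom (add_monoid (tensor_ab B P Q)) (add_monoid Z) \<and>
     (\<forall>x \<in> carrier P. \<forall>y \<in> carrier Q. \<phi> (ten B P Q x y) = h x y))"

definition tensor_lmod ::
  "('b, 'w) ring_scheme \<Rightarrow> ('l, 'x, 'b, 'u) bimod_scheme \<Rightarrow> ('b, 'y, 'v) module_scheme \<Rightarrow>
   ('l, ('x \<times> 'y \<Rightarrow>\<^sub>0 int) set) module" where
  "tensor_lmod B P Q = ring.extend (tensor_ab B P Q)
     (module.fields (\<lambda>a. tensor_lift B P Q (tensor_ab B P Q) (\<lambda>x y. ten B P Q (a \<odot>\<^bsub>P\<^esub> x) y)))"

definition tensor_bimod ::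
  "('b, 'w) ring_scheme \<Rightarrow> ('l, 'x, 'b, 'u) bimod_scheme \<Rightarrow> ('b, 'y, 's, 'v) bimod_scheme \<Rightarrow>
   ('l, ('x \<times> 'y \<Rightarrow>\<^sub>0 int) set, 's) bimod" where
  "tensor_bimod B P Q = module.extend (tensor_lmod B P Q)
     (bimod.fields (\<lambda>t s. tensor_lift B P Q (tensor_ab B P Q) (\<lambda>x y. ten B P Q x (y \<triangleleft>\<^bsub>Q\<^esub> s)) t))"

definition tensor_map ::
  "('b, 'w) ring_scheme \<Rightarrow> ('l, 'x, 'b, 'u) bimod_scheme \<Rightarrow> ('b, 'y, 'v) module_scheme \<Rightarrow>
   ('l', 'x', 'b, 'u') bimod_scheme \<Rightarrow> ('b, 'y', 'v') module_scheme \<Rightarrow>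
   ('x \<Rightarrow> 'x') \<Rightarrow> ('y \<Rightarrow> 'y') \<Rightarrow> ('x \<times> 'y \<Rightarrow>\<^sub>0 int) set \<Rightarrow> ('x' \<times> 'y' \<Rightarrow>\<^sub>0 int) set" where
  "tensor_map B P Q P' Q' f g =
     tensor_lift B P Q (tensor_ab B P' Q') (\<lambda>x y. ten B P' Q' (f x) (g y))"

text \<open>The associativity isomorphism \<open>(P \<otimes>_B Q) \<otimes>_C Z \<rightarrow> P \<otimes>_B (Q \<otimes>_C Z)\<close>.\<close>

definition tensor_assoc ::
  "('b, 'w) ring_scheme \<Rightarrow> ('c, 'w') ring_scheme \<Rightarrow> ('l, 'x, 'b, 'u) bimod_scheme \<Rightarrow>
   ('b, 'y, 'c, 'v) bimod_scheme \<Rightarrow> ('c, 'z, 't) module_scheme \<Rightarrow>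
   (('x \<times> 'y \<Rightarrow>\<^sub>0 int) set \<times> 'z \<Rightarrow>\<^sub>0 int) set \<Rightarrow>
   ('x \<times> ('y \<times> 'z \<Rightarrow>\<^sub>0 int) set \<Rightarrow>\<^sub>0 int) set" where
  "tensor_assoc B C P Q Z = (let QZ = tensor_lmod C Q Z in
     tensor_lift C (tensor_bimod B P Q) Z (tensor_ab B P QZ)
       (\<lambda>t z. tensor_lift B P Q (tensor_ab B P QZ) (\<lambda>x y. ten B P QZ x (ten C Q Z y z)) t))"


section \<open>Gradings\<close>

definition graded_group ::
  "('g, 'w) monoid_scheme \<Rightarrow> ('m, 'x) ring_scheme \<Rightarrow> ('g \<Rightarrow> 'm set) \<Rightarrow> bool" where
  "graded_group G M Mc \<longleftrightarrow>
     abelian_group M \<and> (\<forall>g \<in> carrier G. subgroup (Mc g) (add_monoid M)) \<and>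
     (\<forall>x \<in> carrier M. \<exists>!d. d \<in> (\<Pi>\<^sub>E g \<in> carrier G. Mc g) \<and> x = (\<Oplus>\<^bsub>M\<^esub>g \<in> carrier G. d g))"

definition component ::
  "('g, 'w) monoid_scheme \<Rightarrow> ('m, 'x) ring_scheme \<Rightarrow> ('g \<Rightarrow> 'm set) \<Rightarrow> 'm \<Rightarrow> 'g \<Rightarrow> 'm" where
  "component G M Mc x =
     (THE d. d \<in> (\<Pi>\<^sub>E g \<in> carrier G. Mc g) \<and> x = (\<Oplus>\<^bsub>M\<^esub>g \<in> carrier G. d g))"

definition graded_algebra ::
  "('o, 'w) ring_scheme \<Rightarrow> ('g, 'v) monoid_scheme \<Rightarrow> ('o, 'a, 'x) module_scheme \<Rightarrow>
   ('g \<Rightarrow> 'a set) \<Rightarrow> bool" where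
  "graded_algebra \<O> G A Ac \<longleftrightarrow>
     assoc_algebra \<O> A \<and> graded_group G A Ac \<and>
     (\<forall>g \<in> carrier G. \<forall>r \<in> carrier \<O>. \<forall>a \<in> Ac g. r \<odot>\<^bsub>A\<^esub> a \<in> Ac g) \<and>
     (\<forall>g \<in> carrier G. \<forall>h \<in> carrier G. \<forall>a \<in> Ac g. \<forall>b \<in> Ac h. a \<otimes>\<^bsub>A\<^esub> b \<in> Ac (g \<otimes>\<^bsub>G\<^esub> h))"

definition crossed_product ::
  "('o, 'w) ring_scheme \<Rightarrow> ('g, 'v) monoid_scheme \<Rightarrow> ('o, 'a, 'x) module_scheme \<Rightarrow>
   ('g \<Rightarrow> 'a set) \<Rightarrow> bool" where
  "crossed_product \<O> G A Ac \<longleftrightarrow>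
     graded_algebra \<O> G A Ac \<and> (\<forall>g \<in> carrier G. Ac g \<inter> Units A \<noteq> {})"

definition identity_component ::
  "('g, 'v) monoid_scheme \<Rightarrow> ('o, 'a) module \<Rightarrow> ('g \<Rightarrow> 'a set) \<Rightarrow> ('o, 'a) module" where
  "identity_component G A Ac = A\<lparr>carrier := Ac \<one>\<^bsub>G\<^esub>\<rparr>"

definition graded_bimodule ::
  "('o, 'w) ring_scheme \<Rightarrow> ('g, 'v) monoid_scheme \<Rightarrow>
   ('o, 'a, 'x) module_scheme \<Rightarrow> ('g \<Rightarrow> 'a set) \<Rightarrow> ('o, 'b, 'y) module_scheme \<Rightarrow> ('g \<Rightarrow> 'b set) \<Rightarrow>
   ('a, 'm, 'b, 'z) bimod_scheme \<Rightarrow> ('g \<Rightarrow> 'm set) \<Rightarrow> bool" where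
  "graded_bimodule \<O> G A Ac A' Ac' M Mc \<longleftrightarrow>
     algebra_bimodule \<O> A A' M \<and> graded_group G M Mc \<and>
     (\<forall>g \<in> carrier G. \<forall>h \<in> carrier G. \<forall>x \<in> Mc h.
        (\<forall>a \<in> Ac g. a \<odot>\<^bsub>M\<^esub> x \<in> Mc (g \<otimes>\<^bsub>G\<^esub> h)) \<and>
        (\<forall>a' \<in> Ac' g. x \<triangleleft>\<^bsub>M\<^esub> a' \<in> Mc (h \<otimes>\<^bsub>G\<^esub> g)))"

definition graded_bimodule_iso ::
  "('g, 'v) monoid_scheme \<Rightarrow> ('a, 'w) ring_scheme \<Rightarrow> ('b, 'w') ring_scheme \<Rightarrow>
   ('a, 'm, 'b, 'x) bimod_scheme \<Rightarrow> ('g \<Rightarrow> 'm set) \<Rightarrow>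
   ('a, 'n, 'b, 'y) bimod_scheme \<Rightarrow> ('g \<Rightarrow> 'n set) \<Rightarrow> ('m \<Rightarrow> 'n) set" where
  "graded_bimodule_iso G A A' M Mc N Nc =
     {\<phi> \<in> hom (add_monoid M) (add_monoid N). bij_betw \<phi> (carrier M) (carrier N) \<and>
        (\<forall>a \<in> carrier A. \<forall>x \<in> carrier M. \<phi> (a \<odot>\<^bsub>M\<^esub> x) = a \<odot>\<^bsub>N\<^esub> \<phi> x) \<and>
        (\<forall>a' \<in> carrier A'. \<forall>x \<in> carrier M. \<phi> (x \<triangleleft>\<^bsub>M\<^esub> a') = \<phi> x \<triangleleft>\<^bsub>N\<^esub> a') \<and>
        (\<forall>g \<in> carrier G. \<phi> ` Mc g \<subseteq> Nc g)}"

text \<open>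
  A left linear map of degree \<open>g\<close> shifts degrees by \<open>g\<close> on the right.
\<close>

definition dual_grading ::
  "('g, 'v) monoid_scheme \<Rightarrow> ('o, 'a, 'x) module_scheme \<Rightarrow> ('g \<Rightarrow> 'a set) \<Rightarrow>
   ('a, 'm, 'b, 'z) bimod_scheme \<Rightarrow> ('g \<Rightarrow> 'm set) \<Rightarrow> 'g \<Rightarrow> ('m \<Rightarrow> 'a) set" where
  "dual_grading G A Ac M Mc g =
     {f \<in> carrier (dual A M). \<forall>h \<in> carrier G. f ` Mc h \<subseteq> Ac (h \<otimes>\<^bsub>G\<^esub> g)}"

definition tensor_grading ::
  "('g, 'v) monoid_scheme \<Rightarrow> ('b, 'w) ring_scheme \<Rightarrow>
   ('l, 'x, 'b, 'u) bimod_scheme \<Rightarrow> ('g \<Rightarrow> 'x set) \<Rightarrow>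
   ('b, 'y, 't) module_scheme \<Rightarrow> ('g \<Rightarrow> 'y set) \<Rightarrow> 'g \<Rightarrow> ('x \<times> 'y \<Rightarrow>\<^sub>0 int) set set" where
  "tensor_grading G B P Pc Q Qc g = generate (add_monoid (tensor_ab B P Q))
     {ten B P Q x y | x y h k.
        h \<in> carrier G \<and> k \<in> carrier G \<and> h \<otimes>\<^bsub>G\<^esub> k = g \<and> x \<in> Pc h \<and> y \<in> Qc k}"

text \<open>The components \<open>A_g \<otimes>_B M\<close> of \<open>A \<otimes>_B M\<close>.\<close>

definition induced_grading ::
  "('b, 'w) ring_scheme \<Rightarrow> ('o, 'b, 'x) module_scheme \<Rightarrow> ('g \<Rightarrow> 'b set) \<Rightarrow>
   ('b, 'm, 'z) module_scheme \<Rightarrow> 'g \<Rightarrow> ('b \<times> 'm \<Rightarrow>\<^sub>0 int) set set" where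
  "induced_grading B A Ac M g = generate (add_monoid (tensor_ab B (regular A) M))
     {ten B (regular A) M a m | a m. a \<in> Ac g \<and> m \<in> carrier M}"

definition graded_Morita_equivalence ::
  "('o, 'w) ring_scheme \<Rightarrow> ('g, 'v) monoid_scheme \<Rightarrow>
   ('o, 'a, 'x) module_scheme \<Rightarrow> ('g \<Rightarrow> 'a set) \<Rightarrow> ('o, 'b, 'y) module_scheme \<Rightarrow> ('g \<Rightarrow> 'b set) \<Rightarrow>
   ('a, 'm, 'b, 'z) bimod_scheme \<Rightarrow> ('g \<Rightarrow> 'm set) \<Rightarrow> bool" where
  "graded_Morita_equivalence \<O> G A Ac A' Ac' M Mc \<longleftrightarrow>
     graded_bimodule \<O> G A Ac A' Ac' M Mc \<and>
     graded_bimodule_iso G A A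
       (tensor_bimod A' M (dual A M)) (tensor_grading G A' M Mc (dual A M) (dual_grading G A Ac M Mc))
       (regular A) Ac \<noteq> {} \<and>
     graded_bimodule_iso G A' A'
       (tensor_bimod A (dual A M) M) (tensor_grading G A (dual A M) (dual_grading G A Ac M Mc) M Mc)
       (regular A') Ac' \<noteq> {}"


section \<open>The identity components of the bimodule and of its dual\<close>

text \<open>
  \<open>M\<close> is identified with the identity component of \<open>A \<otimes>_B M\<close> by \<open>m \<mapsto> 1 \<otimes> m\<close>, and
  \<open>Hom_B(M, B)\<close> with the identity component of \<open>Hom_A(A \<otimes>_B M, A)\<close> by sending \<open>f\<close> to
  \<open>a \<otimes> m \<mapsto> a f(m)\<close>.
\<close>

definition id_embed ::
  "('b, 'w) ring_scheme \<Rightarrow> ('o, 'b, 'x) module_scheme \<Rightarrow> ('b, 'm, 'z) module_scheme \<Rightarrow>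
   'm \<Rightarrow> ('b \<times> 'm \<Rightarrow>\<^sub>0 int) set" where
  "id_embed B A M m = ten B (regular A) M \<one>\<^bsub>A\<^esub> m"

definition id_embed_dual ::
  "('b, 'w) ring_scheme \<Rightarrow> ('o, 'b, 'x) module_scheme \<Rightarrow> ('b, 'm, 'z) module_scheme \<Rightarrow>
   ('m \<Rightarrow> 'b) \<Rightarrow> ('b \<times> 'm \<Rightarrow>\<^sub>0 int) set \<Rightarrow> 'b" where
  "id_embed_dual B A M f = tensor_lift B (regular A) M A (\<lambda>a m. a \<otimes>\<^bsub>A\<^esub> f m)"


section \<open>The maps of the diagram\<close>

definition theta ::
  "('b, 'w) ring_scheme \<Rightarrow> ('o, 'b, 'x) module_scheme \<Rightarrow> ('b, 'u, 'z) module_scheme \<Rightarrow>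
   'b \<Rightarrow> ('b \<times> 'u \<Rightarrow>\<^sub>0 int) set \<Rightarrow> ('b \<times> 'u \<Rightarrow>\<^sub>0 int) set" where
  "theta B A U c = tensor_lift B (regular A) U (tensor_ab B (regular A) U)
     (\<lambda>a u. ten B (regular A) U (a \<otimes>\<^bsub>A\<^esub> c) u)"

text \<open>
  In the next definitions \<open>Ms\<close> is the dual of \<open>M\<close>, \<open>Mts\<close> the dual of the induced bimodule and
  \<open>\<iota>\<close> the embedding of \<open>Ms\<close> into \<open>Mts\<close>. On an element \<open>a' \<otimes> f\<close> with \<open>a'\<close> homogeneous
  of degree \<open>g\<close>, all summands of \<open>beta\<close> but the one for \<open>g\<close> vanish.
\<close>

definition beta ::
  "('g, 'v) monoid_scheme \<Rightarrow> ('b, 'w) ring_scheme \<Rightarrow> ('o, 'b, 'x) module_scheme \<Rightarrow>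
   ('c, 'w') ring_scheme \<Rightarrow> ('o, 'c, 'x') module_scheme \<Rightarrow> ('g \<Rightarrow> 'c set) \<Rightarrow> ('g \<Rightarrow> 'b) \<Rightarrow>
   ('c, 'f, 'b, 'y) bimod_scheme \<Rightarrow> ('c, 'h, 'b, 'z) bimod_scheme \<Rightarrow> ('f \<Rightarrow> 'h) \<Rightarrow>
   ('c \<times> 'f \<Rightarrow>\<^sub>0 int) set \<Rightarrow> ('f \<times> 'b \<Rightarrow>\<^sub>0 int) set" where
  "beta G B A B' A' Ac' u Ms Mts \<iota> =
     tensor_lift B' (regular A') Ms (tensor_ab B Ms (regular A))
       (\<lambda>a' f. \<Oplus>\<^bsub>tensor_ab B Ms (regular A)\<^esub>g \<in> carrier G.
          ten B Ms (regular A)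
            (inv_into (carrier Ms) \<iota>
               ((component G A' Ac' a' g \<odot>\<^bsub>Mts\<^esub> \<iota> f) \<triangleleft>\<^bsub>Mts\<^esub> inv\<^bsub>A\<^esub> (u g)))
            (u g))"

text \<open>
  \<open>beta \<otimes> id\<close> as a map \<open>A' \<otimes> (Ms \<otimes> U) \<rightarrow> Ms \<otimes> (A \<otimes> U)\<close>.
\<close>

definition beta_U ::
  "('b, 'w) ring_scheme \<Rightarrow> ('o, 'b, 'x) module_scheme \<Rightarrow>
   ('c, 'w') ring_scheme \<Rightarrow> ('o, 'c, 'x') module_scheme \<Rightarrow>
   ('c, 'f, 'b, 'y) bimod_scheme \<Rightarrow> ('b, 'u, 'z) module_scheme \<Rightarrow>
   (('c \<times> 'f \<Rightarrow>\<^sub>0 int) set \<Rightarrow> ('f \<times> 'b \<Rightarrow>\<^sub>0 int) set) \<Rightarrow>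
   ('c \<times> ('f \<times> 'u \<Rightarrow>\<^sub>0 int) set \<Rightarrow>\<^sub>0 int) set \<Rightarrow> ('f \<times> ('b \<times> 'u \<Rightarrow>\<^sub>0 int) set \<Rightarrow>\<^sub>0 int) set" where
  "beta_U B A B' A' Ms U \<beta> =
     tensor_assoc B B Ms (regular A) U \<circ>
     tensor_map B (tensor_bimod B' (regular A') Ms) U (tensor_bimod B Ms (regular A)) U \<beta> (\<lambda>x. x) \<circ>
     inv_into (carrier (tensor_ab B (tensor_bimod B' (regular A') Ms) U))
       (tensor_assoc B' B (regular A') Ms U)"

definition phi1 ::
  "('b, 'w) ring_scheme \<Rightarrow> ('o, 'b, 'x) module_scheme \<Rightarrow>
   ('c, 'w') ring_scheme \<Rightarrow> ('o, 'c, 'x') module_scheme \<Rightarrow>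
   ('c, 'f, 'b, 'y) bimod_scheme \<Rightarrow> ('b, 'u, 'z) module_scheme \<Rightarrow>
   (('c \<times> 'f \<Rightarrow>\<^sub>0 int) set \<Rightarrow> ('f \<times> 'b \<Rightarrow>\<^sub>0 int) set) \<Rightarrow>
   (('b \<times> 'u \<Rightarrow>\<^sub>0 int) set \<Rightarrow> ('b \<times> 'u \<Rightarrow>\<^sub>0 int) set) \<Rightarrow>
   ('c \<times> ('f \<times> 'u \<Rightarrow>\<^sub>0 int) set \<Rightarrow>\<^sub>0 int) set \<Rightarrow> ('c \<times> ('f \<times> 'u \<Rightarrow>\<^sub>0 int) set \<Rightarrow>\<^sub>0 int) set" where
  "phi1 B A B' A' Ms U \<beta> f =
     (let U' = tensor_lmod B Ms U; AU = tensor_lmod B (regular A) U;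
          D = carrier (tensor_lmod B' (regular A') U'); \<gamma> = beta_U B A B' A' Ms U \<beta>
      in restrict (inv_into D \<gamma> \<circ> tensor_map B Ms AU Ms AU (\<lambda>x. x) f \<circ> \<gamma>) D)"

text \<open>
  Here \<open>Mt\<close> is the induced bimodule, and \<open>ms\<close>, \<open>m\<close> are the families \<open>m_j^*\<close>, \<open>m_j\<close> viewed in
  \<open>Mts\<close> and \<open>Mt\<close>.
\<close>

definition phi2 ::
  "('a, 'w) ring_scheme \<Rightarrow> ('a, 'm, 'c, 'y) bimod_scheme \<Rightarrow> ('c, 'f, 'a, 'z) bimod_scheme \<Rightarrow>
   (('f \<times> 'm \<Rightarrow>\<^sub>0 int) set \<Rightarrow> 'c) \<Rightarrow> 'j set \<Rightarrow> ('j \<Rightarrow> 'f) \<Rightarrow> ('j \<Rightarrow> 'm) \<Rightarrow> 'a \<Rightarrow> 'c" where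
  "phi2 A Mt Mts \<phi> J ms m c =
     \<phi> (\<Oplus>\<^bsub>tensor_ab A Mts Mt\<^esub>j \<in> J. ten A Mts Mt (ms j \<triangleleft>\<^bsub>Mts\<^esub> c) (m j))"

end

theory Submission
  imports Defs
begin

text \<open>
  Write \<open>p\<close> and \<open>q\<close> for the pairings given by \<open>\<phi>\<close> and \<open>\<psi>\<close>. Taking components of degree \<open>1\<close> in the
  surjectivity of \<open>\<psi>\<close> yields \<open>n_i \<in> M\<close>, \<open>n_i^* \<in> M^*\<close> with \<open>\<Sum> q(n_i, n_i^*) = 1\<close>, dual to the given relation
  \<open>\<Sum> p(m_j^*, m_j) = 1\<close>. For an \<open>A\<close>-module \<open>X\<close> the map \<open>\<tau>(t, x) = \<Sum> m_j^* \<otimes> q(m_j, t) x\<close> identifies the tensor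
  product of the dual of the induced bimodule with \<open>X\<close> over \<open>A\<close> with \<open>M^* \<otimes>_B X\<close>. In these terms
  \<open>\<beta> \<otimes> id\<close> becomes \<open>a' \<otimes> f \<otimes> x \<mapsto> \<tau>(a' f, 1 \<otimes> x)\<close>, with inverse
  \<open>f \<otimes> a \<otimes> x \<mapsto> \<Sum> p(f a, n_i) \<otimes> n_i^* \<otimes> x\<close>. The maps \<open>id \<otimes> F\<close> are exactly the additive maps that commute
  with \<open>A'\<close>: given such a map \<open>H\<close>, the preimage is \<open>F x = \<Sum> ev(n_i)(H (n_i^* \<otimes> x))\<close>, where
  \<open>ev(n)(f \<otimes> x) = q(n, f) x\<close>. Finally, the image of \<open>c\<close> in the centralizer is the unique \<open>c'\<close> with \<open>c' f = f c\<close> for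
  all \<open>f \<in> M^*\<close>, so multiplicativity, the inverse and the commutativity of the diagram follow by
  computing with elements of \<open>M^*\<close>.
\<close>

section \<open>Additive maps\<close>

text \<open>The tensor products are quotients of free groups, so elements have no normal form, and a
  map out of one must be known to be balanced before it can be evaluated on simple tensors. The
  tensor product of \<open>Mts\<close> with \<open>A \<otimes> U\<close> over \<open>A\<close> is
  never formed; the pairing \<open>\<tau>\<close> stands for its simple tensors. The two families do
  opposite work: the \<open>m j\<close> rewrite elements of \<open>Mts\<close> with coefficients
  from \<open>A\<close> on the right, the \<open>n i\<close> with coefficients from
  \<open>A'\<close> on the left. Both must lie in degree one. Then \<open>q (m j) (e f)\<close> lies
  in \<open>B\<close> and \<open>p (e f) (n i)\<close> in \<open>B'\<close>, and these are the
  coefficients that may cross a tensor sign over \<open>B\<close> or \<open>B'\<close> and that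
  commute with centralizing elements. Once the families and these two conditions are established,
  gradings matter only for the terms of \<open>beta\<close>: multiplying a component of degree g by
  the inverse of the unit of degree g returns an element of \<open>Mts\<close> to the image of
  \<open>Ms\<close>. Moving the inverse through \<open>\<tau>\<close> cancels the unit, so the
  result does not depend on the choice of units.\<close>

definition add_hom :: "('a, 'x) ring_scheme \<Rightarrow> ('b, 'y) ring_scheme \<Rightarrow> ('a \<Rightarrow> 'b) set" where
  "add_hom M N = hom (add_monoid M) (add_monoid N)"

lemma add_homI:
  assumes "\<And>x. x \<in> carrier M \<Longrightarrow> f x \<in> carrier N"
    and "\<And>x y. x \<in> carrier M \<Longrightarrow> y \<in> carrier M \<Longrightarrow> f (x \<oplus>\<^bsub>M\<^esub> y) = f x \<oplus>\<^bsub>N\<^esub> f y"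
  shows "f \<in> add_hom M N"
  using assms by (auto simp: add_hom_def hom_def)

lemma add_hom_closed: "f \<in> add_hom M N \<Longrightarrow> x \<in> carrier M \<Longrightarrow> f x \<in> carrier N"
  by (auto simp: add_hom_def hom_def)

lemma add_hom_add:
  "f \<in> add_hom M N \<Longrightarrow> x \<in> carrier M \<Longrightarrow> y \<in> carrier M \<Longrightarrow> f (x \<oplus>\<^bsub>M\<^esub> y) = f x \<oplus>\<^bsub>N\<^esub> f y"
  by (auto simp: add_hom_def hom_def)

lemma add_hom_comp:
  "f \<in> add_hom M N \<Longrightarrow> g \<in> add_hom N Z \<Longrightarrow> (\<lambda>x. g (f x)) \<in> add_hom M Z"
  by (auto simp: add_hom_def hom_def Pi_iff)

lemma add_hom_id: "(\<lambda>x. x) \<in> add_hom M M"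
  by (auto simp: add_hom_def hom_def)

lemma add_hom_group_hom:
  assumes "f \<in> add_hom M N" "abelian_group M" "abelian_group N"
  shows "group_hom (add_monoid M) (add_monoid N) f"
  using assms by (simp add: add_hom_def group_hom_def group_hom_axioms_def abelian_group.a_group)

lemma add_hom_zero:
  assumes "f \<in> add_hom M N" "abelian_group M" "abelian_group N"
  shows "f \<zero>\<^bsub>M\<^esub> = \<zero>\<^bsub>N\<^esub>"
  using group_hom.hom_one[OF add_hom_group_hom[OF assms]] by simp

lemma add_hom_minus:
  assumes "f \<in> add_hom M N" "abelian_group M" "abelian_group N" "x \<in> carrier M"
  shows "f (\<ominus>\<^bsub>M\<^esub> x) = \<ominus>\<^bsub>N\<^esub> f x"
  using group_hom.hom_inv[OF add_hom_group_hom[OF assms(1-3)]] assms(4) by (simp add: a_inv_def)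

text \<open>Infinite index sets are included: both sums are then zero by the convention of
  \<open>finsum\<close>, and an additive map preserves zero.\<close>

lemma add_hom_finsum:
  assumes f: "f \<in> add_hom M N" and M: "abelian_group M" and N: "abelian_group N"
    and a: "\<And>i. i \<in> I \<Longrightarrow> a i \<in> carrier M"
  shows "f (\<Oplus>\<^bsub>M\<^esub>i\<in>I. a i) = (\<Oplus>\<^bsub>N\<^esub>i\<in>I. f (a i))"
proof -
  interpret M: abelian_group M by (rule M)
  interpret N: abelian_group N by (rule N)
  show ?thesis using a
  proof (induction I rule: infinite_finite_induct)
    case (insert i I)
    then have "a \<in> I \<rightarrow> carrier M" "(\<lambda>i. f (a i)) \<in> I \<rightarrow> carrier N"
      using add_hom_closed[OF f] by auto
    then show ?case using insert add_hom_closed[OF f]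
      by (simp add: M.finsum_insert N.finsum_insert add_hom_add[OF f])
  qed (auto simp: add_hom_zero[OF f M N])
qed

text \<open>Regular bimodules and the several records built on one tensor product share their
  additive fields but differ in others, so the group axioms are transported along these
  fields.\<close>

lemma abelian_group_cong:
  assumes "abelian_group M" "carrier N = carrier M" "ring.add N = ring.add M" "ring.zero N = ring.zero M"
  shows "abelian_group N"
  using abelian_groupE[OF assms(1)] by (intro abelian_groupI) (auto simp: assms(2-4))

section \<open>Tensor products\<close>

definition balanced where
  "balanced B P Q Z h \<longleftrightarrow>
     (\<forall>x \<in> carrier P. \<forall>y \<in> carrier Q. h x y \<in> carrier Z) \<and>
     (\<forall>x \<in> carrier P. \<forall>x' \<in> carrier P. \<forall>y \<in> carrier Q. h (x \<oplus>\<^bsub>P\<^esub> x') y = h x y \<oplus>\<^bsub>Z\<^esub> h x' y) \<and>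
     (\<forall>x \<in> carrier P. \<forall>y \<in> carrier Q. \<forall>y' \<in> carrier Q. h x (y \<oplus>\<^bsub>Q\<^esub> y') = h x y \<oplus>\<^bsub>Z\<^esub> h x y') \<and>
     (\<forall>x \<in> carrier P. \<forall>b \<in> carrier B. \<forall>y \<in> carrier Q. h (x \<triangleleft>\<^bsub>P\<^esub> b) y = h x (b \<odot>\<^bsub>Q\<^esub> y))"

lemma balancedI:
  assumes "\<And>x y. x \<in> carrier P \<Longrightarrow> y \<in> carrier Q \<Longrightarrow> h x y \<in> carrier Z"
    and "\<And>x x' y. x \<in> carrier P \<Longrightarrow> x' \<in> carrier P \<Longrightarrow> y \<in> carrier Q \<Longrightarrow>
          h (x \<oplus>\<^bsub>P\<^esub> x') y = h x y \<oplus>\<^bsub>Z\<^esub> h x' y"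
    and "\<And>x y y'. x \<in> carrier P \<Longrightarrow> y \<in> carrier Q \<Longrightarrow> y' \<in> carrier Q \<Longrightarrow>
          h x (y \<oplus>\<^bsub>Q\<^esub> y') = h x y \<oplus>\<^bsub>Z\<^esub> h x y'"
    and "\<And>x b y. x \<in> carrier P \<Longrightarrow> b \<in> carrier B \<Longrightarrow> y \<in> carrier Q \<Longrightarrow>
          h (x \<triangleleft>\<^bsub>P\<^esub> b) y = h x (b \<odot>\<^bsub>Q\<^esub> y)"
  shows "balanced B P Q Z h"
  using assms unfolding balanced_def by blast

lemma balancedD:
  assumes "balanced B P Q Z h"
  shows "\<And>x y. x \<in> carrier P \<Longrightarrow> y \<in> carrier Q \<Longrightarrow> h x y \<in> carrier Z"
    and "\<And>x x' y. x \<in> carrier P \<Longrightarrow> x' \<in> carrier P \<Longrightarrow> y \<in> carrier Q \<Longrightarrow>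
          h (x \<oplus>\<^bsub>P\<^esub> x') y = h x y \<oplus>\<^bsub>Z\<^esub> h x' y"
    and "\<And>x y y'. x \<in> carrier P \<Longrightarrow> y \<in> carrier Q \<Longrightarrow> y' \<in> carrier Q \<Longrightarrow>
          h x (y \<oplus>\<^bsub>Q\<^esub> y') = h x y \<oplus>\<^bsub>Z\<^esub> h x y'"
    and "\<And>x b y. x \<in> carrier P \<Longrightarrow> b \<in> carrier B \<Longrightarrow> y \<in> carrier Q \<Longrightarrow>
          h (x \<triangleleft>\<^bsub>P\<^esub> b) y = h x (b \<odot>\<^bsub>Q\<^esub> y)"
  using assms unfolding balanced_def by blast+

lemma balanced_comp:
  assumes "balanced B P Q Z h" "f \<in> add_hom Z Z'"
  shows "balanced B P Q Z' (\<lambda>x y. f (h x y))"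
  by (rule balancedI) (simp_all add: balancedD[OF assms(1)] add_hom_closed[OF assms(2)] add_hom_add[OF assms(2)])

text \<open>Closure of the two actions is all that the group and its universal property rest on;
  module axioms enter with the actions on the product itself.\<close>

locale tensor_pair = P: abelian_group P + Q: abelian_group Q
  for B :: "('b, 'w) ring_scheme" and P :: "('l, 'x, 'b, 'u) bimod_scheme"
    and Q :: "('b, 'y, 'v) module_scheme" +
  assumes ract: "x \<in> carrier P \<Longrightarrow> b \<in> carrier B \<Longrightarrow> x \<triangleleft>\<^bsub>P\<^esub> b \<in> carrier P"
    and lact: "b \<in> carrier B \<Longrightarrow> y \<in> carrier Q \<Longrightarrow> b \<odot>\<^bsub>Q\<^esub> y \<in> carrier Q"
begin

abbreviation (input) "F \<equiv> free_Abelian_group (carrier P \<times> carrier Q)"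
abbreviation (input) "N \<equiv> tensor_null B P Q"
abbreviation (input) "T \<equiv> tensor_ab B P Q"

lemma frag_in: "x \<in> carrier P \<Longrightarrow> y \<in> carrier Q \<Longrightarrow> frag_of (x, y) \<in> carrier F"
  by (simp only: frag_of_in_free_Abelian_group) blast

lemma frag_add: "c \<in> carrier F \<Longrightarrow> d \<in> carrier F \<Longrightarrow> c + d \<in> carrier F"
  using group.is_monoid[OF group_free_Abelian_group, THEN monoid.m_closed]
  by (simp only: mult_free_Abelian_group)

lemma frag_minus: "c \<in> carrier F \<Longrightarrow> - c \<in> carrier F"
  by (simp only: carrier_free_Abelian_group_iff keys_minus)

lemma frag_diff: "c \<in> carrier F \<Longrightarrow> d \<in> carrier F \<Longrightarrow> c - d \<in> carrier F"
  using frag_add[OF _ frag_minus] by (simp only: diff_conv_add_uminus)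

lemma rels_subset: "tensor_rels B P Q \<subseteq> carrier F"
  unfolding tensor_rels_def Un_subset_iff
  by (intro conjI subsetI; elim CollectE exE conjE;
      simp only: frag_diff frag_in ract lact P.a_closed Q.a_closed)

lemma N_subgroup: "subgroup N F"
  unfolding tensor_null_def by (rule group.generate_is_subgroup[OF group_free_Abelian_group rels_subset])

lemma N_normal: "normal N F"
  using N_subgroup abelian_free_Abelian_group comm_group.normal_iff_subgroup by blast

lemma add_monoid_T: "add_monoid T = F Mod N"
  by (simp add: tensor_ab_def tensor_grp_def FactGroup_def)

lemma T_abelian: "abelian_group T"
  using comm_group.abelian_FactGroup[OF abelian_free_Abelian_group N_subgroup]
  by (intro comm_group_abelian_groupI) (simp only: add_monoid_T)

sublocale T: abelian_group T by (rule T_abelian)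

lemma carrier_T: "carrier T = (\<lambda>c. N #>\<^bsub>F\<^esub> c) ` carrier F"
  by (simp add: tensor_ab_def tensor_grp_def carrier_FactGroup)

lemma coset_add:
  assumes "c \<in> carrier F" "d \<in> carrier F"
  shows "(N #>\<^bsub>F\<^esub> c) \<oplus>\<^bsub>T\<^esub> (N #>\<^bsub>F\<^esub> d) = N #>\<^bsub>F\<^esub> (c + d)"
  using normal.rcos_sum[OF N_normal assms] by (simp add: tensor_ab_def tensor_grp_def)

lemma coset_in: "c \<in> carrier F \<Longrightarrow> N #>\<^bsub>F\<^esub> c \<in> carrier T"
  by (simp add: carrier_T)

lemma coset_rel: "r \<in> tensor_rels B P Q \<Longrightarrow> N #>\<^bsub>F\<^esub> r = \<zero>\<^bsub>T\<^esub>"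
proof -
  assume "r \<in> tensor_rels B P Q"
  then have "r \<in> N" unfolding tensor_null_def by (rule generate.incl)
  then show ?thesis
    using subgroup.rcos_const[OF N_subgroup group_free_Abelian_group]
    by (simp add: tensor_ab_def tensor_grp_def)
qed

lemma coset_zero: "N #>\<^bsub>F\<^esub> 0 = \<zero>\<^bsub>T\<^esub>"
  using subgroup.rcos_const[OF N_subgroup group_free_Abelian_group subgroup.one_closed[OF N_subgroup]]
  by (simp add: tensor_ab_def tensor_grp_def)

lemma coset_eqI:
  assumes c: "c \<in> carrier F" and r: "r \<in> tensor_rels B P Q" and "d = r + c"
  shows "N #>\<^bsub>F\<^esub> d = N #>\<^bsub>F\<^esub> c"
proof -
  have "N #>\<^bsub>F\<^esub> d = (N #>\<^bsub>F\<^esub> r) \<oplus>\<^bsub>T\<^esub> (N #>\<^bsub>F\<^esub> c)"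
    using coset_add[OF subsetD[OF rels_subset r] c] assms(3) by (simp only:)
  also have "\<dots> = N #>\<^bsub>F\<^esub> c" using T.l_zero[OF coset_in[OF c]] by (simp only: coset_rel[OF r])
  finally show ?thesis .
qed

lemma ten_closed: "x \<in> carrier P \<Longrightarrow> y \<in> carrier Q \<Longrightarrow> ten B P Q x y \<in> carrier T"
  unfolding ten_def by (rule coset_in) (rule frag_in)

lemma ten_add_l:
  assumes "x \<in> carrier P" "x' \<in> carrier P" "y \<in> carrier Q"
  shows "ten B P Q (x \<oplus>\<^bsub>P\<^esub> x') y = ten B P Q x y \<oplus>\<^bsub>T\<^esub> ten B P Q x' y"
proof -
  let ?r = "frag_of (x \<oplus>\<^bsub>P\<^esub> x', y) - frag_of (x, y) - frag_of (x', y)"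
  have "?r \<in> tensor_rels B P Q" using assms unfolding tensor_rels_def by blast
  from coset_eqI[OF _ this, of "frag_of (x, y) + frag_of (x', y)" "frag_of (x \<oplus>\<^bsub>P\<^esub> x', y)"] assms
  show ?thesis unfolding ten_def by (simp only: coset_add frag_in frag_add) simp
qed

lemma ten_add_r:
  assumes "x \<in> carrier P" "y \<in> carrier Q" "y' \<in> carrier Q"
  shows "ten B P Q x (y \<oplus>\<^bsub>Q\<^esub> y') = ten B P Q x y \<oplus>\<^bsub>T\<^esub> ten B P Q x y'"
proof -
  let ?r = "frag_of (x, y \<oplus>\<^bsub>Q\<^esub> y') - frag_of (x, y) - frag_of (x, y')"
  have "?r \<in> tensor_rels B P Q" using assms unfolding tensor_rels_def by blast
  from coset_eqI[OF _ this, of "frag_of (x, y) + frag_of (x, y')" "frag_of (x, y \<oplus>\<^bsub>Q\<^esub> y')"] assms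
  show ?thesis unfolding ten_def by (simp only: coset_add frag_in frag_add) simp
qed

lemma ten_balanced:
  assumes "x \<in> carrier P" "b \<in> carrier B" "y \<in> carrier Q"
  shows "ten B P Q (x \<triangleleft>\<^bsub>P\<^esub> b) y = ten B P Q x (b \<odot>\<^bsub>Q\<^esub> y)"
proof -
  let ?r = "frag_of (x \<triangleleft>\<^bsub>P\<^esub> b, y) - frag_of (x, b \<odot>\<^bsub>Q\<^esub> y)"
  have "?r \<in> tensor_rels B P Q" using assms unfolding tensor_rels_def by blast
  from coset_eqI[OF _ this, of "frag_of (x, b \<odot>\<^bsub>Q\<^esub> y)" "frag_of (x \<triangleleft>\<^bsub>P\<^esub> b, y)"] assms
  show ?thesis unfolding ten_def by (simp only: coset_add frag_in frag_add lact) simp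
qed

lemma balanced_ten: "balanced B P Q T (ten B P Q)"
  by (rule balancedI) (simp_all add: ten_closed ten_add_l ten_add_r ten_balanced)

lemma ten_hom_l: "y \<in> carrier Q \<Longrightarrow> (\<lambda>x. ten B P Q x y) \<in> add_hom P T"
  by (rule add_homI) (simp_all add: ten_closed ten_add_l)

lemma ten_hom_r: "x \<in> carrier P \<Longrightarrow> (\<lambda>y. ten B P Q x y) \<in> add_hom Q T"
  by (rule add_homI) (simp_all add: ten_closed ten_add_r)

lemma ten_minus_l:
  assumes "x \<in> carrier P" "y \<in> carrier Q"
  shows "ten B P Q (\<ominus>\<^bsub>P\<^esub> x) y = \<ominus>\<^bsub>T\<^esub> ten B P Q x y"
  by (rule add_hom_minus[OF ten_hom_l P.abelian_group_axioms T_abelian]) (use assms in simp_all)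

lemma ten_zero_l: "y \<in> carrier Q \<Longrightarrow> ten B P Q \<zero>\<^bsub>P\<^esub> y = \<zero>\<^bsub>T\<^esub>"
  by (rule add_hom_zero[OF ten_hom_l P.abelian_group_axioms T_abelian])

lemma coset_minus:
  assumes "c \<in> carrier F"
  shows "N #>\<^bsub>F\<^esub> (- c) = \<ominus>\<^bsub>T\<^esub> (N #>\<^bsub>F\<^esub> c)"
proof -
  have m: "- c \<in> carrier F" using assms by (rule frag_minus)
  have "(N #>\<^bsub>F\<^esub> (- c)) \<oplus>\<^bsub>T\<^esub> (N #>\<^bsub>F\<^esub> c) = \<zero>\<^bsub>T\<^esub>"
    using coset_add[OF m assms] by (simp only: coset_zero ab_left_minus)
  then show ?thesis using T.minus_equality coset_in[OF m] coset_in[OF assms] by metis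
qed

text \<open>A negated generator is again a simple tensor, with the sign moved into the left factor,
  and zero is a simple tensor too. Hence sums suffice, although the free group also has
  negatives.\<close>

lemma induct [consumes 1, case_names ten add]:
  assumes t: "t \<in> carrier T"
    and ten: "\<And>x y. x \<in> carrier P \<Longrightarrow> y \<in> carrier Q \<Longrightarrow> Pr (ten B P Q x y)"
    and add: "\<And>s t. s \<in> carrier T \<Longrightarrow> t \<in> carrier T \<Longrightarrow> Pr s \<Longrightarrow> Pr t \<Longrightarrow> Pr (s \<oplus>\<^bsub>T\<^esub> t)"
  shows "Pr t"
proof -
  obtain c where c: "c \<in> carrier F" "t = N #>\<^bsub>F\<^esub> c" using t by (auto simp: carrier_T)
  have z: "Pr \<zero>\<^bsub>T\<^esub>" using ten[OF P.zero_closed Q.zero_closed] ten_zero_l by simp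
  from c(1) have "Poly_Mapping.keys c \<subseteq> carrier P \<times> carrier Q" by simp
  \<comment> \<open>The induction rule for free abelian groups runs through differences. Claiming
    the property for \<open>c\<close> and \<open>- c\<close> together turns the difference case into
    two sums.\<close>
  then have "Pr (N #>\<^bsub>F\<^esub> c) \<and> Pr (N #>\<^bsub>F\<^esub> (- c))"
  proof (induction c rule: free_Abelian_group_induct[consumes 1, case_names zero diff gen])
    case zero then show ?case using z coset_zero by simp
  next
    case (diff x y)
    then have m: "x \<in> carrier F" "y \<in> carrier F" by (simp_all only: carrier_free_Abelian_group_iff)
    note m = m m[THEN frag_minus]
    have "N #>\<^bsub>F\<^esub> (x - y) = (N #>\<^bsub>F\<^esub> x) \<oplus>\<^bsub>T\<^esub> (N #>\<^bsub>F\<^esub> (- y))"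
      using coset_add[OF m(1) m(4)] by (simp only: diff_conv_add_uminus)
    moreover have "N #>\<^bsub>F\<^esub> (- (x - y)) = (N #>\<^bsub>F\<^esub> y) \<oplus>\<^bsub>T\<^esub> (N #>\<^bsub>F\<^esub> (- x))"
      using coset_add[OF m(2) m(3)] by (simp only: minus_diff_eq) (simp only: diff_conv_add_uminus)
    ultimately show ?case using add diff m coset_in by metis
  next
    case (gen a)
    then obtain x y where a: "a = (x, y)" "x \<in> carrier P" "y \<in> carrier Q" by auto
    have "N #>\<^bsub>F\<^esub> (- frag_of a) = ten B P Q (\<ominus>\<^bsub>P\<^esub> x) y"
      using coset_minus[OF frag_in[OF a(2,3)]] ten_minus_l a by (simp add: ten_def)
    then show ?case using ten a P.a_inv_closed by (simp add: ten_def)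
  qed
  then show ?thesis using c by simp
qed

text \<open>Simple tensors generate the group. Most identities below are put in the form of two
  additive maps of one tensor variable so that this applies.\<close>

lemma hom_eqI:
  assumes "f \<in> add_hom T Z" "g \<in> add_hom T Z" "t \<in> carrier T"
    and "\<And>x y. x \<in> carrier P \<Longrightarrow> y \<in> carrier Q \<Longrightarrow> f (ten B P Q x y) = g (ten B P Q x y)"
  shows "f t = g t"
  using assms(3) by (induction t rule: induct)
    (simp_all add: assms(4) add_hom_add[OF assms(1)] add_hom_add[OF assms(2)])

text \<open>\<open>tensor_lift\<close> is a definite description, so existence and uniqueness are
  both due. Freeness yields a homomorphism, which kills the defining relations because
  \<open>h\<close> is balanced and therefore factors through the quotient. Generation by simple
  tensors together with extensionality gives uniqueness.\<close>

lemma lift: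
  assumes Z: "abelian_group Z" and h: "balanced B P Q Z h"
  shows lift_hom: "tensor_lift B P Q Z h \<in> add_hom T Z"
    and lift_ext: "tensor_lift B P Q Z h \<in> extensional (carrier T)"
    and lift_ten: "\<And>x y. x \<in> carrier P \<Longrightarrow> y \<in> carrier Q \<Longrightarrow> tensor_lift B P Q Z h (ten B P Q x y) = h x y"
proof -
  interpret Z: abelian_group Z by (rule Z)
  note hD = balancedD[OF h]
  have "(\<lambda>(x, y). h x y) ` (carrier P \<times> carrier Q) \<subseteq> carrier (add_monoid Z)"
    using hD(1) by auto
  from comm_group.free_Abelian_group_universal[OF Z.a_comm_group this]
  obtain H where H: "H \<in> hom F (add_monoid Z)"
    and Hf: "\<And>x. x \<in> carrier P \<times> carrier Q \<Longrightarrow> H (frag_of x) = (\<lambda>(x, y). h x y) x" by blast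
  interpret H: group_hom F "add_monoid Z" H
    using H by (simp add: group_hom_def group_hom_axioms_def Z.a_group)
  have Hfr: "H (frag_of (x, y)) = h x y" if "x \<in> carrier P" "y \<in> carrier Q" for x y
    using Hf[of "(x, y)"] that by simp
  have Hd: "H (c - d) = H c \<ominus>\<^bsub>Z\<^esub> H d" "c - d \<in> carrier F" if "c \<in> carrier F" "d \<in> carrier F" for c d
  proof -
    have d: "- d \<in> carrier F" using that(2) by (rule frag_minus)
    show "H (c - d) = H c \<ominus>\<^bsub>Z\<^esub> H d"
      using H.hom_mult[OF that(1) d] H.hom_inv[OF that(2)] that(2)
      by (simp add: a_minus_def a_inv_def diff_conv_add_uminus del: add_uminus_conv_diff)
    show "c - d \<in> carrier F" using that by (rule frag_diff)
  qed
  have H0: "H (c - d) = \<zero>\<^bsub>Z\<^esub>" if "c \<in> carrier F" "d \<in> carrier F" "H c = H d" for c d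
    using Hd(1)[OF that(1,2)] that(3) H.hom_closed[OF that(2)] by (simp add: a_minus_def Z.r_neg)
  have r: "r \<in> kernel F (add_monoid Z) H" if "r = c - d" "c \<in> carrier F" "d \<in> carrier F" "H c = H d" for r c d
    using H0[OF that(2-4)] Hd(2)[OF that(2,3)] unfolding that(1) kernel_def by simp
  have Ha: "H (c + d) = H c \<oplus>\<^bsub>Z\<^esub> H d" if "c \<in> carrier F" "d \<in> carrier F" for c d
    using H.hom_mult[OF that] by (simp only: mult_free_Abelian_group monoid.simps)
  have "tensor_rels B P Q \<subseteq> kernel F (add_monoid Z) H"
  proof
    fix e assume "e \<in> tensor_rels B P Q"
    then consider
        (1) x x' y where "e = frag_of (x \<oplus>\<^bsub>P\<^esub> x', y) - frag_of (x, y) - frag_of (x', y)"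
          "x \<in> carrier P" "x' \<in> carrier P" "y \<in> carrier Q"
      | (2) x y y' where "e = frag_of (x, y \<oplus>\<^bsub>Q\<^esub> y') - frag_of (x, y) - frag_of (x, y')"
          "x \<in> carrier P" "y \<in> carrier Q" "y' \<in> carrier Q"
      | (3) x b y where "e = frag_of (x \<triangleleft>\<^bsub>P\<^esub> b, y) - frag_of (x, b \<odot>\<^bsub>Q\<^esub> y)"
          "x \<in> carrier P" "b \<in> carrier B" "y \<in> carrier Q"
      unfolding tensor_rels_def by blast
    then show "e \<in> kernel F (add_monoid Z) H"
    proof cases
      case 1
      then show ?thesis
        by (intro r[of e "frag_of (x \<oplus>\<^bsub>P\<^esub> x', y)" "frag_of (x, y) + frag_of (x', y)"])
          (simp_all only: frag_in frag_add P.a_closed Ha Hfr hD diff_diff_eq)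
    next
      case 2
      then show ?thesis
        by (intro r[of e "frag_of (x, y \<oplus>\<^bsub>Q\<^esub> y')" "frag_of (x, y) + frag_of (x, y')"])
          (simp_all only: frag_in frag_add Q.a_closed Ha Hfr hD diff_diff_eq)
    next
      case 3
      then show ?thesis
        by (intro r[of e "frag_of (x \<triangleleft>\<^bsub>P\<^esub> b, y)" "frag_of (x, b \<odot>\<^bsub>Q\<^esub> y)"])
          (simp_all only: frag_in ract lact Hfr hD)
    qed
  qed
  then have "N \<subseteq> kernel F (add_monoid Z) H"
    unfolding tensor_null_def
    using group.generate_subgroup_incl[OF group_free_Abelian_group _ H.subgroup_kernel] by blast
  from H.FactGroup_universal_kernel[OF N_normal this]
  obtain g where g: "g \<in> hom (F Mod N) (add_monoid Z)" "\<And>c. c \<in> carrier F \<Longrightarrow> g (N #>\<^bsub>F\<^esub> c) = H c"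
    by blast
  \<comment> \<open>The restriction supplies the extensionality that the description
    demands.\<close>
  define \<phi> where "\<phi> = restrict g (carrier T)"
  have gT: "g \<in> add_hom T Z" using g(1) by (simp only: add_hom_def add_monoid_T)
  have \<phi>_hom: "\<phi> \<in> add_hom T Z"
    by (rule add_homI) (simp_all add: \<phi>_def add_hom_closed[OF gT] add_hom_add[OF gT] T.a_closed)
  have \<phi>_ten: "\<phi> (ten B P Q x y) = h x y" if "x \<in> carrier P" "y \<in> carrier Q" for x y
    using ten_closed[OF that] g(2)[OF frag_in[OF that]] Hfr[OF that] by (simp add: \<phi>_def ten_def)
  have \<phi>_ext: "\<phi> \<in> extensional (carrier T)" by (simp add: \<phi>_def)
  have eq: "tensor_lift B P Q Z h = \<phi>"
    unfolding tensor_lift_def add_hom_def[symmetric]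
  proof (rule the_equality)
    fix f assume "f \<in> extensional (carrier T) \<inter> add_hom T Z \<and>
      (\<forall>x \<in> carrier P. \<forall>y \<in> carrier Q. f (ten B P Q x y) = h x y)"
    then have f: "f \<in> extensional (carrier T)" "f \<in> add_hom T Z"
      "\<And>x y. x \<in> carrier P \<Longrightarrow> y \<in> carrier Q \<Longrightarrow> f (ten B P Q x y) = \<phi> (ten B P Q x y)"
      by (simp_all add: \<phi>_ten)
    show "f = \<phi>"
      by (rule extensionalityI[OF f(1) \<phi>_ext]) (rule hom_eqI[OF f(2) \<phi>_hom _ f(3)])
  qed (simp add: \<phi>_ext \<phi>_hom \<phi>_ten)
  show "tensor_lift B P Q Z h \<in> add_hom T Z" "tensor_lift B P Q Z h \<in> extensional (carrier T)"
    unfolding eq by (rule \<phi>_hom) (rule \<phi>_ext)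
  show "\<And>x y. x \<in> carrier P \<Longrightarrow> y \<in> carrier Q \<Longrightarrow> tensor_lift B P Q Z h (ten B P Q x y) = h x y"
    unfolding eq by (rule \<phi>_ten)
qed

end

lemma add_hom_plus:
  assumes "f \<in> add_hom M N" "g \<in> add_hom M N" "abelian_group N"
  shows "(\<lambda>x. f x \<oplus>\<^bsub>N\<^esub> g x) \<in> add_hom M N"
proof -
  interpret N: abelian_group N by (rule assms(3))
  show ?thesis
    by (rule add_homI)
      (simp_all add: add_hom_closed[OF assms(1)] add_hom_closed[OF assms(2)]
        add_hom_add[OF assms(1)] add_hom_add[OF assms(2)] N.a_closed N.a_ac)
qed

lemma add_hom_sum:
  assumes "\<And>i. i \<in> I \<Longrightarrow> f i \<in> add_hom M N" "abelian_group N"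
  shows "(\<lambda>x. \<Oplus>\<^bsub>N\<^esub>i\<in>I. f i x) \<in> add_hom M N"
proof -
  interpret N: abelian_group N by (rule assms(2))
  show ?thesis
  proof (rule add_homI)
    fix x y assume xy: "x \<in> carrier M" "y \<in> carrier M"
    then have "(\<Oplus>\<^bsub>N\<^esub>i\<in>I. f i (x \<oplus>\<^bsub>M\<^esub> y)) = (\<Oplus>\<^bsub>N\<^esub>i\<in>I. f i x \<oplus>\<^bsub>N\<^esub> f i y)"
      by (intro N.finsum_cong')
        (auto simp: add_hom_add[OF assms(1)] add_hom_closed[OF assms(1)] N.a_closed)
    also have "\<dots> = (\<Oplus>\<^bsub>N\<^esub>i\<in>I. f i x) \<oplus>\<^bsub>N\<^esub> (\<Oplus>\<^bsub>N\<^esub>i\<in>I. f i y)"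
      using xy by (intro N.finsum_addf) (auto simp: add_hom_closed[OF assms(1)])
    finally show "(\<Oplus>\<^bsub>N\<^esub>i\<in>I. f i (x \<oplus>\<^bsub>M\<^esub> y)) = (\<Oplus>\<^bsub>N\<^esub>i\<in>I. f i x) \<oplus>\<^bsub>N\<^esub> (\<Oplus>\<^bsub>N\<^esub>i\<in>I. f i y)" .
  qed (auto intro!: N.finsum_closed simp: add_hom_closed[OF assms(1)])
qed

section \<open>Linear maps and duals\<close>

lemma regular_simps [simp]:
  "carrier (regular A) = carrier A" "ring.add (regular A) = ring.add A" "\<zero>\<^bsub>regular A\<^esub> = \<zero>\<^bsub>A\<^esub>"
  "module.smult (regular A) = monoid.mult A" "rsmult (regular A) = monoid.mult A"
  by (simp_all add: regular_def)

text \<open>Only the carrier changes, so operations and unit remain those of \<open>A\<close> and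
  the hypotheses describe unital subrings. Taking \<open>carrier A\<close> for one of them gives the
  full action on that side.\<close>

lemma regular_bimodule:
  assumes A: "ring A" and S: "ring (A\<lparr>carrier := S\<rparr>)" "S \<subseteq> carrier A"
    and S': "ring (A\<lparr>carrier := S'\<rparr>)" "S' \<subseteq> carrier A"
  shows "bimodule (A\<lparr>carrier := S\<rparr>) (A\<lparr>carrier := S'\<rparr>) (regular A)"
proof -
  interpret A: ring A by (rule A)
  have "abelian_group (regular A)"
    by (rule abelian_group_cong[OF A.is_abelian_group]) simp_all
  then show ?thesis
    using S S'
    by (intro bimodule.intro left_module.intro left_module_axioms.intro bimodule_axioms.intro)
      (auto simp: A.l_distr A.r_distr A.m_assoc subset_iff)
qed

lemma linear_mapsI:
  assumes "f \<in> extensional (carrier P)" "f \<in> add_hom P Q"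
    and "\<And>r x. r \<in> carrier R \<Longrightarrow> x \<in> carrier P \<Longrightarrow> f (r \<odot>\<^bsub>P\<^esub> x) = r \<odot>\<^bsub>Q\<^esub> f x"
  shows "f \<in> linear_maps R P Q"
  using assms unfolding linear_maps_def add_hom_def by blast

lemma linear_mapsD:
  assumes "f \<in> linear_maps R P Q"
  shows "f \<in> extensional (carrier P)" "f \<in> add_hom P Q"
    "\<And>r x. r \<in> carrier R \<Longrightarrow> x \<in> carrier P \<Longrightarrow> f (r \<odot>\<^bsub>P\<^esub> x) = r \<odot>\<^bsub>Q\<^esub> f x"
    "\<And>x. x \<in> carrier P \<Longrightarrow> f x \<in> carrier Q"
    "\<And>x y. x \<in> carrier P \<Longrightarrow> y \<in> carrier P \<Longrightarrow> f (x \<oplus>\<^bsub>P\<^esub> y) = f x \<oplus>\<^bsub>Q\<^esub> f y"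
proof -
  show h: "f \<in> add_hom P Q" using assms unfolding linear_maps_def add_hom_def by blast
  show "f \<in> extensional (carrier P)"
    "\<And>r x. r \<in> carrier R \<Longrightarrow> x \<in> carrier P \<Longrightarrow> f (r \<odot>\<^bsub>P\<^esub> x) = r \<odot>\<^bsub>Q\<^esub> f x"
    using assms unfolding linear_maps_def by blast+
  show "\<And>x. x \<in> carrier P \<Longrightarrow> f x \<in> carrier Q"
    "\<And>x y. x \<in> carrier P \<Longrightarrow> y \<in> carrier P \<Longrightarrow> f (x \<oplus>\<^bsub>P\<^esub> y) = f x \<oplus>\<^bsub>Q\<^esub> f y"
    using add_hom_closed[OF h] add_hom_add[OF h] by blast+
qed

lemma linear_maps_restrict:
  assumes "abelian_group P" and "f \<in> add_hom P Q"
    and "\<And>r x. r \<in> carrier R \<Longrightarrow> x \<in> carrier P \<Longrightarrow> r \<odot>\<^bsub>P\<^esub> x \<in> carrier P"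
    and "\<And>r x. r \<in> carrier R \<Longrightarrow> x \<in> carrier P \<Longrightarrow> f (r \<odot>\<^bsub>P\<^esub> x) = r \<odot>\<^bsub>Q\<^esub> f x"
  shows "restrict f (carrier P) \<in> linear_maps R P Q"
proof -
  interpret P: abelian_group P by (rule assms(1))
  show ?thesis
    by (intro linear_mapsI add_homI)
      (simp_all add: assms(3,4) add_hom_closed[OF assms(2)] add_hom_add[OF assms(2)] P.a_closed)
qed

lemma linear_maps_eqI:
  assumes "f \<in> linear_maps R P Q" "g \<in> linear_maps R P Q" "\<And>x. x \<in> carrier P \<Longrightarrow> f x = g x"
  shows "f = g"
  using assms linear_mapsD(1) by (intro extensionalityI[of f "carrier P" g]) blast+

lemma dual_simps [simp]:
  "carrier (dual R P) = linear_maps R P (regular R)"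
  "\<zero>\<^bsub>dual R P\<^esub> = (\<lambda>x \<in> carrier P. \<zero>\<^bsub>R\<^esub>)"
  "f \<oplus>\<^bsub>dual R P\<^esub> g = (\<lambda>x \<in> carrier P. f x \<oplus>\<^bsub>R\<^esub> g x)"
  "s \<odot>\<^bsub>dual R P\<^esub> f = (\<lambda>x \<in> carrier P. f (x \<triangleleft>\<^bsub>P\<^esub> s))"
  "f \<triangleleft>\<^bsub>dual R P\<^esub> r = (\<lambda>x \<in> carrier P. f x \<otimes>\<^bsub>R\<^esub> r)"
  by (simp_all add: dual_def)

text \<open>All operations are pointwise and restricted to \<open>carrier P\<close>, so each axiom
  reduces to an equality of values there. Acting on the argument from the right yields a left action
  on functions.\<close>

lemma dual_bimodule:
  fixes R :: "('o, 'r, 'w) module_scheme"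
  assumes "bimodule R S P"
  shows "bimodule S R (dual R P)"
proof -
  interpret P: bimodule R S P by (rule assms)
  note c = P.lact_closed P.ract_closed P.M.a_closed P.R.a_closed P.R.m_closed P.R.zero_closed
    P.lact_r_distr P.R.r_distr P.R.l_distr P.R.m_assoc P.R.r_null P.ract_l_distr P.ract_r_distr P.ract_assoc
    P.lact_ract P.ract_one P.S.a_closed P.S.m_closed
  have add: "(\<lambda>x \<in> carrier P. f x \<oplus>\<^bsub>R\<^esub> g x) \<in> linear_maps R P (regular R)"
    if "f \<in> linear_maps R P (regular R)" "g \<in> linear_maps R P (regular R)" for f g
    using linear_mapsD(2-)[OF that(1)] linear_mapsD(2-)[OF that(2)]
    by (intro linear_maps_restrict add_homI) (simp_all add: c P.R.a_ac P.M.abelian_group_axioms)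
  have zero: "(\<lambda>x \<in> carrier P. \<zero>\<^bsub>R\<^esub>) \<in> linear_maps R P (regular R)"
    by (intro linear_maps_restrict add_homI) (simp_all add: c P.M.abelian_group_axioms)
  have neg: "(\<lambda>x \<in> carrier P. \<ominus>\<^bsub>R\<^esub> f x) \<in> linear_maps R P (regular R)"
    if "f \<in> linear_maps R P (regular R)" for f
    using linear_mapsD(2-)[OF that]
    by (intro linear_maps_restrict add_homI) (simp_all add: c P.R.minus_add P.R.r_minus P.M.abelian_group_axioms)
  have l: "(\<lambda>x \<in> carrier P. f (x \<triangleleft>\<^bsub>P\<^esub> s)) \<in> linear_maps R P (regular R)"
    if "f \<in> linear_maps R P (regular R)" "s \<in> carrier S" for f s
    using linear_mapsD(2-)[OF that(1)] that(2)
    by (intro linear_maps_restrict add_homI) (simp_all add: c P.M.abelian_group_axioms)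
  have r: "(\<lambda>x \<in> carrier P. f x \<otimes>\<^bsub>R\<^esub> r) \<in> linear_maps R P (regular R)"
    if "f \<in> linear_maps R P (regular R)" "r \<in> carrier R" for f r
    using linear_mapsD(2-)[OF that(1)] that(2)
    by (intro linear_maps_restrict add_homI) (simp_all add: c P.M.abelian_group_axioms)
  have ext: "(\<lambda>x \<in> carrier P. f x) = f" if "f \<in> linear_maps R P (regular R)" for f
    using linear_mapsD(1)[OF that] by (rule extensional_restrict)
  note eq = linear_mapsD(4)[of _ R P "regular R", simplified]
  have ab: "abelian_group (dual R P)"
  proof (rule abelian_groupI)
    fix f assume f: "f \<in> carrier (dual R P)"
    show "\<exists>g \<in> carrier (dual R P). g \<oplus>\<^bsub>dual R P\<^esub> f = \<zero>\<^bsub>dual R P\<^esub>"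
      using f neg by (intro bexI[of _ "\<lambda>x \<in> carrier P. \<ominus>\<^bsub>R\<^esub> f x"])
        (auto simp: eq P.R.l_neg intro!: restrict_ext)
    show "\<zero>\<^bsub>dual R P\<^esub> \<oplus>\<^bsub>dual R P\<^esub> f = f"
      using f ext[of f] by (auto simp: eq intro!: restrict_ext cong: restrict_cong)
  qed (auto simp: add zero eq P.R.a_ac intro!: restrict_ext)
  have f_r: "f (x \<oplus>\<^bsub>P\<^esub> y) = f x \<oplus>\<^bsub>R\<^esub> f y"
    if "f \<in> linear_maps R P (regular R)" "x \<in> carrier P" "y \<in> carrier P" for f x y
    using linear_mapsD(5)[OF that] by simp
  have "left_module S (dual R P)"
    by (intro left_module.intro left_module_axioms.intro ab P.S.ring_axioms)
      (auto simp: l c f_r eq ext intro!: restrict_ext cong: restrict_cong)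
  then show ?thesis
    by (intro bimodule.intro bimodule_axioms.intro P.R.ring_axioms)
      (auto simp: l r c eq ext intro!: restrict_ext cong: restrict_cong)
qed

section \<open>Tensor products of bimodules\<close>

lemma tensor_lmod_simps [simp]:
  "carrier (tensor_lmod S P Q) = carrier (tensor_ab S P Q)"
  "ring.add (tensor_lmod S P Q) = ring.add (tensor_ab S P Q)"
  "\<zero>\<^bsub>tensor_lmod S P Q\<^esub> = \<zero>\<^bsub>tensor_ab S P Q\<^esub>"
  by (simp_all add: tensor_lmod_def ring.defs module.defs)

lemma tensor_bimod_simps [simp]:
  "carrier (tensor_bimod S P Q) = carrier (tensor_ab S P Q)"
  "ring.add (tensor_bimod S P Q) = ring.add (tensor_ab S P Q)"
  "\<zero>\<^bsub>tensor_bimod S P Q\<^esub> = \<zero>\<^bsub>tensor_ab S P Q\<^esub>"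
  "module.smult (tensor_bimod S P Q) = module.smult (tensor_lmod S P Q)"
  by (simp_all add: tensor_bimod_def tensor_lmod_def ring.defs module.defs bimod.defs)

lemma smult_tensor_lmod:
  "a \<odot>\<^bsub>tensor_lmod S P Q\<^esub> t = tensor_lift S P Q (tensor_ab S P Q) (\<lambda>x y. ten S P Q (a \<odot>\<^bsub>P\<^esub> x) y) t"
  by (simp add: tensor_lmod_def ring.defs module.defs)

lemma rsmult_tensor_bimod:
  "t \<triangleleft>\<^bsub>tensor_bimod S P Q\<^esub> s = tensor_lift S P Q (tensor_ab S P Q) (\<lambda>x y. ten S P Q x (y \<triangleleft>\<^bsub>Q\<^esub> s)) t"
  by (simp add: tensor_bimod_def tensor_lmod_def ring.defs module.defs bimod.defs)

lemma add_hom_cong: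
  assumes "carrier M' = carrier M" "ring.add M' = ring.add M" "carrier N' = carrier N" "ring.add N' = ring.add N"
  shows "add_hom M' N' = add_hom M N"
  using assms by (simp add: add_hom_def hom_def)

locale tensor_module = P: bimodule R S P + Q: left_module S Q
  for R :: "('r, 'w) ring_scheme" and S :: "('s, 'v) ring_scheme"
    and P :: "('r, 'm, 's, 'x) bimod_scheme" and Q :: "('s, 'n, 'y) module_scheme"
begin

sublocale tensor_pair S P Q
  by unfold_locales (simp_all add: P.ract_closed Q.lact_closed)

lemma smult_balanced: "a \<in> carrier R \<Longrightarrow> balanced S P Q T (\<lambda>x y. ten S P Q (a \<odot>\<^bsub>P\<^esub> x) y)"
  by (rule balancedI)
    (simp_all add: ten_closed P.lact_closed P.lact_r_distr ten_add_l ten_add_r P.lact_ract[symmetric] P.ract_closed ten_balanced)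

lemma smult_hom: "a \<in> carrier R \<Longrightarrow> (\<lambda>t. a \<odot>\<^bsub>tensor_lmod S P Q\<^esub> t) \<in> add_hom T T"
  unfolding smult_tensor_lmod by (rule lift_hom[OF T_abelian smult_balanced])

lemma smult_ten:
  "\<lbrakk>a \<in> carrier R; x \<in> carrier P; y \<in> carrier Q\<rbrakk> \<Longrightarrow>
   a \<odot>\<^bsub>tensor_lmod S P Q\<^esub> ten S P Q x y = ten S P Q (a \<odot>\<^bsub>P\<^esub> x) y"
  unfolding smult_tensor_lmod by (rule lift_ten[OF T_abelian smult_balanced])

lemma lmod_abelian: "abelian_group (tensor_lmod S P Q)"
  by (rule abelian_group_cong[OF T_abelian]) simp_all

text \<open>Each axiom for the action compares additive maps of the tensor, so it is inherited from
  the left factor through simple tensors.\<close>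

lemma lmod_left_module: "left_module R (tensor_lmod S P Q)"
proof -
  note h = smult_hom
  note s = smult_ten P.lact_closed P.R.a_closed P.R.m_closed
  show ?thesis
  proof (intro left_module.intro left_module_axioms.intro lmod_abelian P.R.ring_axioms, goal_cases)
    case (1 a t) then show ?case using add_hom_closed[OF h] by simp
  next
    case (2 a b t)
    then show ?case
      using hom_eqI[OF h add_hom_plus[OF h h T_abelian], of "a \<oplus>\<^bsub>R\<^esub> b" a b t]
      by (simp add: s P.lact_l_distr ten_add_l)
  next
    case (3 a x y) then show ?case using add_hom_add[OF h] by simp
  next
    case (4 a b t)
    then show ?case
      using hom_eqI[OF h add_hom_comp[OF h h], of "a \<otimes>\<^bsub>R\<^esub> b" b a t]
      by (simp add: s P.lact_assoc)
  next
    case (5 t)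
    then show ?case
      using hom_eqI[OF h[OF P.R.one_closed] add_hom_id, of t] by (simp add: s P.lact_one)
  qed
qed

end

locale tensor_bimodule = P: bimodule R S P + Q: bimodule S K Q
  for R :: "('r, 'w) ring_scheme" and S :: "('s, 'v) ring_scheme" and K :: "('k, 'u) ring_scheme"
    and P :: "('r, 'm, 's, 'x) bimod_scheme" and Q :: "('s, 'n, 'k, 'y) bimod_scheme"
begin

sublocale tensor_module R S P Q ..

lemma rsmult_balanced: "a \<in> carrier K \<Longrightarrow> balanced S P Q T (\<lambda>x y. ten S P Q x (y \<triangleleft>\<^bsub>Q\<^esub> a))"
  by (rule balancedI)
    (simp_all add: ten_closed Q.ract_closed Q.ract_l_distr ten_add_l ten_add_r Q.lact_ract ten_balanced)

lemma rsmult_hom: "a \<in> carrier K \<Longrightarrow> (\<lambda>t. t \<triangleleft>\<^bsub>tensor_bimod S P Q\<^esub> a) \<in> add_hom T T"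
  unfolding rsmult_tensor_bimod by (rule lift_hom[OF T_abelian rsmult_balanced])

lemma rsmult_ten:
  "\<lbrakk>a \<in> carrier K; x \<in> carrier P; y \<in> carrier Q\<rbrakk> \<Longrightarrow>
   ten S P Q x y \<triangleleft>\<^bsub>tensor_bimod S P Q\<^esub> a = ten S P Q x (y \<triangleleft>\<^bsub>Q\<^esub> a)"
  unfolding rsmult_tensor_bimod by (rule lift_ten[OF T_abelian rsmult_balanced])

lemma bimod_abelian: "abelian_group (tensor_bimod S P Q)"
  by (rule abelian_group_cong[OF T_abelian]) simp_all

lemma bimod_left_module: "left_module R (tensor_bimod S P Q)"
  using lmod_left_module bimod_abelian
  by (simp add: left_module_def left_module_axioms_def)

lemma bimod_bimodule: "bimodule R K (tensor_bimod S P Q)"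
proof -
  note h = rsmult_hom
  note hs = smult_hom
  note s = rsmult_ten smult_ten P.lact_closed Q.ract_closed Q.S.a_closed Q.S.m_closed
  show ?thesis
  proof (intro bimodule.intro bimodule_axioms.intro bimod_left_module Q.S.ring_axioms, goal_cases)
    case (1 t a) then show ?case using add_hom_closed[OF h] by simp
  next
    case (2 t a b)
    then show ?case
      using hom_eqI[OF h add_hom_plus[OF h h T_abelian], of "a \<oplus>\<^bsub>K\<^esub> b" a b t]
      by (simp add: s Q.ract_r_distr ten_add_r)
  next
    case (3 x y a) then show ?case using add_hom_add[OF h] by simp
  next
    case (4 t a b)
    then show ?case
      using hom_eqI[OF h add_hom_comp[OF h h], of "a \<otimes>\<^bsub>K\<^esub> b" a b t]
      by (simp add: s Q.ract_assoc)
  next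
    case (5 t)
    then show ?case
      using hom_eqI[OF h[OF Q.S.one_closed] add_hom_id, of t] by (simp add: s Q.ract_one)
  next
    case (6 a t b)
    then show ?case
      using hom_eqI[OF add_hom_comp[OF hs h] add_hom_comp[OF h hs], of a b b a t]
      by (simp add: s)
  qed
qed

end

section \<open>Triple tensor products and associativity\<close>

definition balanced3 where
  "balanced3 S K P Q Z W h \<longleftrightarrow>
     (\<forall>x \<in> carrier P. balanced K Q Z W (h x)) \<and>
     (\<forall>z \<in> carrier Z. balanced S P Q W (\<lambda>x y. h x y z))"

lemma balanced3D:
  assumes "balanced3 S K P Q Z W h"
  shows "\<And>x. x \<in> carrier P \<Longrightarrow> balanced K Q Z W (h x)"
    and "\<And>z. z \<in> carrier Z \<Longrightarrow> balanced S P Q W (\<lambda>x y. h x y z)"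
  using assms by (simp_all add: balanced3_def)

locale tensor_triple = P: bimodule R S P + Q: bimodule S K Q + Z: left_module K Z
  for R :: "('r, 'w) ring_scheme" and S :: "('s, 'v) ring_scheme" and K :: "('k, 'u) ring_scheme"
    and P :: "('r, 'm, 's, 'x) bimod_scheme" and Q :: "('s, 'n, 'k, 'y) bimod_scheme"
    and Z :: "('k, 'p, 'z) module_scheme"
begin

sublocale PQ: tensor_bimodule R S K P Q ..
sublocale QZ: tensor_module S K Q Z ..
sublocale PQ_Z: tensor_module R K "tensor_bimod S P Q" Z
  using PQ.bimod_bimodule by (intro tensor_module.intro Z.left_module_axioms)
sublocale P_QZ: tensor_module R S P "tensor_lmod K Q Z"
  using QZ.lmod_left_module by (intro tensor_module.intro P.bimodule_axioms)

text \<open>Balancedness in both adjacent pairs of arguments lets \<open>h\<close> descend in two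
  stages. What the second stage requires in \<open>z\<close> is an identity of additive maps in
  \<open>t\<close>, hence visible on simple tensors.\<close>

lemma lift_left:
  assumes W: "abelian_group W" and h: "balanced3 S K P Q Z W h"
  shows "balanced K (tensor_bimod S P Q) Z W (\<lambda>t z. tensor_lift S P Q W (\<lambda>x y. h x y z) t)"
proof -
  have b: "\<And>z. z \<in> carrier Z \<Longrightarrow> balanced S P Q W (\<lambda>x y. h x y z)"
    and b': "\<And>x. x \<in> carrier P \<Longrightarrow> balanced K Q Z W (h x)"
    by (rule balanced3D[OF h], assumption)+
  note l = PQ.lift_hom[OF W b] and lt = PQ.lift_ten[OF W b]
  show ?thesis
  proof (rule balancedI, goal_cases)
    case (1 x y) then show ?case using add_hom_closed[OF l] by simp
  next
    case (2 x x' y) then show ?case using add_hom_add[OF l] by simp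
  next
    case (3 t z z')
    then show ?case
      using PQ.hom_eqI[OF l add_hom_plus[OF l l W], of "z \<oplus>\<^bsub>Z\<^esub> z'" z z' t]
      by (simp add: lt Z.M.a_closed balancedD(3)[OF b'])
  next
    case (4 t k z)
    then show ?case
      using PQ.hom_eqI[OF add_hom_comp[OF PQ.rsmult_hom l] l, of k z "k \<odot>\<^bsub>Z\<^esub> z" t]
      by (simp add: lt Z.lact_closed balancedD(4)[OF b'] PQ.rsmult_ten Q.ract_closed)
  qed
qed

lemma lift_right:
  assumes W: "abelian_group W" and h: "balanced3 S K P Q Z W h"
  shows "balanced S P (tensor_lmod K Q Z) W (\<lambda>x t. tensor_lift K Q Z W (h x) t)"
proof -
  have b: "\<And>z. z \<in> carrier Z \<Longrightarrow> balanced S P Q W (\<lambda>x y. h x y z)"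
    and b': "\<And>x. x \<in> carrier P \<Longrightarrow> balanced K Q Z W (h x)"
    by (rule balanced3D[OF h], assumption)+
  note l = QZ.lift_hom[OF W b'] and lt = QZ.lift_ten[OF W b']
  show ?thesis
  proof (rule balancedI, goal_cases)
    case (1 x y) then show ?case using add_hom_closed[OF l] by simp
  next
    case (2 x x' t)
    then show ?case
      using QZ.hom_eqI[OF l add_hom_plus[OF l l W], of "x \<oplus>\<^bsub>P\<^esub> x'" x x' t]
      by (simp add: lt P.M.a_closed balancedD(2)[OF b])
  next
    case (3 t z z') then show ?case using add_hom_add[OF l] by simp
  next
    case (4 x s t)
    then show ?case
      using QZ.hom_eqI[OF l add_hom_comp[OF QZ.smult_hom l], of "x \<triangleleft>\<^bsub>P\<^esub> s" s x t]
      by (simp add: lt P.ract_closed balancedD(4)[OF b] QZ.smult_ten Q.lact_closed)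
  qed
qed

lemma lift_left_ten:
  assumes W: "abelian_group W" and h: "balanced3 S K P Q Z W h"
    and x: "x \<in> carrier P" and y: "y \<in> carrier Q" and z: "z \<in> carrier Z"
  shows "tensor_lift K (tensor_bimod S P Q) Z W (\<lambda>t z. tensor_lift S P Q W (\<lambda>x y. h x y z) t)
    (ten K (tensor_bimod S P Q) Z (ten S P Q x y) z) = h x y z"
proof -
  have t: "ten S P Q x y \<in> carrier (tensor_bimod S P Q)" using PQ.ten_closed[OF x y] by simp
  show ?thesis
    unfolding PQ_Z.lift_ten[OF W lift_left[OF W h] t z]
    by (rule PQ.lift_ten[OF W balanced3D(2)[OF h z] x y])
qed

lemma lift_right_ten:
  assumes W: "abelian_group W" and h: "balanced3 S K P Q Z W h"
    and x: "x \<in> carrier P" and y: "y \<in> carrier Q" and z: "z \<in> carrier Z"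
  shows "tensor_lift S P (tensor_lmod K Q Z) W (\<lambda>x t. tensor_lift K Q Z W (h x) t)
    (ten S P (tensor_lmod K Q Z) x (ten K Q Z y z)) = h x y z"
proof -
  have t: "ten K Q Z y z \<in> carrier (tensor_lmod K Q Z)" using QZ.ten_closed[OF y z] by simp
  show ?thesis
    unfolding P_QZ.lift_ten[OF W lift_right[OF W h] x t]
    by (rule QZ.lift_ten[OF W balanced3D(1)[OF h x] y z])
qed

lemma balanced3_right: "balanced3 S K P Q Z P_QZ.T (\<lambda>x y z. ten S P (tensor_lmod K Q Z) x (ten K Q Z y z))"
  unfolding balanced3_def
  by (intro conjI ballI balancedI)
    (simp_all add: P_QZ.ten_closed P_QZ.ten_add_l P_QZ.ten_balanced QZ.ten_closed
      QZ.ten_add_l QZ.ten_add_r QZ.ten_balanced P_QZ.ten_add_r[simplified] QZ.smult_ten)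

lemma balanced3_left:
  "balanced3 S K P Q Z PQ_Z.T (\<lambda>x y z. ten K (tensor_bimod S P Q) Z (ten S P Q x y) z)"
  unfolding balanced3_def
  by (intro conjI ballI balancedI)
    (simp_all add: PQ_Z.ten_closed PQ.ten_closed PQ_Z.ten_add_r PQ.ten_add_l PQ.ten_add_r
      PQ_Z.ten_add_l[simplified] PQ.ten_balanced PQ.rsmult_ten PQ_Z.ten_balanced[symmetric])

lemma assoc_hom: "tensor_assoc S K P Q Z \<in> add_hom PQ_Z.T P_QZ.T"
  unfolding tensor_assoc_def Let_def
  by (rule PQ_Z.lift_hom[OF P_QZ.T_abelian lift_left[OF P_QZ.T_abelian balanced3_right]])

lemma assoc_ten:
  assumes "x \<in> carrier P" "y \<in> carrier Q" "z \<in> carrier Z"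
  shows "tensor_assoc S K P Q Z (ten K (tensor_bimod S P Q) Z (ten S P Q x y) z) =
    ten S P (tensor_lmod K Q Z) x (ten K Q Z y z)"
  unfolding tensor_assoc_def Let_def
  by (rule lift_left_ten[OF P_QZ.T_abelian balanced3_right assms])

text \<open>The inner factor of a simple tensor need not be simple. For fixed \<open>x\<close> both
  sides are additive in that factor, so \<open>hom_eqI\<close> is used a second time.\<close>

lemma hom_eqI_right:
  assumes f: "f \<in> add_hom P_QZ.T W" and g: "g \<in> add_hom P_QZ.T W" and t: "t \<in> carrier P_QZ.T"
    and e: "\<And>x y z. x \<in> carrier P \<Longrightarrow> y \<in> carrier Q \<Longrightarrow> z \<in> carrier Z \<Longrightarrow>
      f (ten S P (tensor_lmod K Q Z) x (ten K Q Z y z)) = g (ten S P (tensor_lmod K Q Z) x (ten K Q Z y z))"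
  shows "f t = g t"
proof (rule P_QZ.hom_eqI[OF f g t])
  fix x q assume x: "x \<in> carrier P" and q: "q \<in> carrier (tensor_lmod K Q Z)"
  have r: "(\<lambda>q. ten S P (tensor_lmod K Q Z) x q) \<in> add_hom QZ.T P_QZ.T"
    using P_QZ.ten_hom_r[OF x] by (simp add: add_hom_cong[of "tensor_lmod K Q Z" "QZ.T"])
  from q show "f (ten S P (tensor_lmod K Q Z) x q) = g (ten S P (tensor_lmod K Q Z) x q)"
    using QZ.hom_eqI[OF add_hom_comp[OF r f] add_hom_comp[OF r g]] e x by simp
qed

lemma hom_eqI_left:
  assumes f: "f \<in> add_hom PQ_Z.T W" and g: "g \<in> add_hom PQ_Z.T W" and t: "t \<in> carrier PQ_Z.T"
    and e: "\<And>x y z. x \<in> carrier P \<Longrightarrow> y \<in> carrier Q \<Longrightarrow> z \<in> carrier Z \<Longrightarrow>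
      f (ten K (tensor_bimod S P Q) Z (ten S P Q x y) z) = g (ten K (tensor_bimod S P Q) Z (ten S P Q x y) z)"
  shows "f t = g t"
proof (rule PQ_Z.hom_eqI[OF f g t])
  fix q z assume z: "z \<in> carrier Z" and q: "q \<in> carrier (tensor_bimod S P Q)"
  have r: "(\<lambda>q. ten K (tensor_bimod S P Q) Z q z) \<in> add_hom PQ.T PQ_Z.T"
    using PQ_Z.ten_hom_l[OF z] by (simp add: add_hom_cong[of "tensor_bimod S P Q" "PQ.T"])
  from q show "f (ten K (tensor_bimod S P Q) Z q z) = g (ten K (tensor_bimod S P Q) Z q z)"
    using PQ.hom_eqI[OF add_hom_comp[OF r f] add_hom_comp[OF r g]] e z by simp
qed

text \<open>The same two-stage lifting for the other bracketing gives the inverse, since both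
  composites fix triple tensors.\<close>

lemma assoc_bij: "bij_betw (tensor_assoc S K P Q Z) (carrier PQ_Z.T) (carrier P_QZ.T)"
proof -
  note W = PQ_Z.T_abelian
  define k where "k = tensor_lift S P (tensor_lmod K Q Z) PQ_Z.T
    (\<lambda>x t. tensor_lift K Q Z PQ_Z.T (\<lambda>y z. ten K (tensor_bimod S P Q) Z (ten S P Q x y) z) t)"
  have k: "k \<in> add_hom P_QZ.T PQ_Z.T"
    unfolding k_def by (rule P_QZ.lift_hom[OF W lift_right[OF W balanced3_left]])
  have kt: "k (ten S P (tensor_lmod K Q Z) x (ten K Q Z y z)) = ten K (tensor_bimod S P Q) Z (ten S P Q x y) z"
    if "x \<in> carrier P" "y \<in> carrier Q" "z \<in> carrier Z" for x y z
    unfolding k_def by (rule lift_right_ten[OF W balanced3_left that])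
  show ?thesis
  proof (rule bij_betw_byWitness[of _ k])
    show "\<forall>t\<in>carrier PQ_Z.T. k (tensor_assoc S K P Q Z t) = t"
      by (rule ballI, rule hom_eqI_left[OF add_hom_comp[OF assoc_hom k] add_hom_id], assumption)
        (simp only: assoc_ten kt)
    show "\<forall>t\<in>carrier P_QZ.T. tensor_assoc S K P Q Z (k t) = t"
      by (rule ballI, rule hom_eqI_right[OF add_hom_comp[OF k assoc_hom] add_hom_id], assumption)
        (simp only: assoc_ten kt)
    show "tensor_assoc S K P Q Z ` carrier PQ_Z.T \<subseteq> carrier P_QZ.T"
      by (rule image_subsetI) (rule add_hom_closed[OF assoc_hom])
    show "k ` carrier P_QZ.T \<subseteq> carrier PQ_Z.T"
      by (rule image_subsetI) (rule add_hom_closed[OF k])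
  qed
qed

end

lemma (in left_module) lact_hom_r: "a \<in> carrier R \<Longrightarrow> (\<lambda>x. a \<odot>\<^bsub>M\<^esub> x) \<in> add_hom M M"
  by (rule add_homI) (simp_all add: lact_closed lact_r_distr)

lemma (in left_module) lact_hom_l: "x \<in> carrier M \<Longrightarrow> (\<lambda>a. a \<odot>\<^bsub>M\<^esub> x) \<in> add_hom R M"
  by (rule add_homI) (simp_all add: lact_closed lact_l_distr)

lemma (in bimodule) ract_hom_l: "s \<in> carrier S \<Longrightarrow> (\<lambda>x. x \<triangleleft>\<^bsub>M\<^esub> s) \<in> add_hom M M"
  by (rule add_homI) (simp_all add: ract_closed ract_l_distr)

lemma (in bimodule) ract_hom_r: "x \<in> carrier M \<Longrightarrow> (\<lambda>s. x \<triangleleft>\<^bsub>M\<^esub> s) \<in> add_hom S M"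
  by (rule add_homI) (simp_all add: ract_closed ract_r_distr)

lemma balanced_hom_l: "balanced B P Q Z h \<Longrightarrow> y \<in> carrier Q \<Longrightarrow> (\<lambda>x. h x y) \<in> add_hom P Z"
  by (rule add_homI) (simp_all add: balancedD(1,2))

lemma balanced_hom_r: "balanced B P Q Z h \<Longrightarrow> x \<in> carrier P \<Longrightarrow> (\<lambda>y. h x y) \<in> add_hom Q Z"
  by (rule add_homI) (simp_all add: balancedD(1,3))

lemma (in left_module) restrict_scalars:
  assumes "ring (R\<lparr>carrier := K\<rparr>)" "K \<subseteq> carrier R"
  shows "left_module (R\<lparr>carrier := K\<rparr>) M"
  using assms(2)
  by (intro left_module.intro left_module_axioms.intro assms(1) M.abelian_group_axioms)
    (simp_all add: subset_iff lact_closed lact_l_distr lact_r_distr lact_assoc lact_one)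

section \<open>Morita contexts\<close>

text \<open>
  Here \<open>K\<close> and \<open>K'\<close> are the carriers of \<open>B\<close> and \<open>B'\<close>, and \<open>e\<close> embeds \<open>Ms\<close>, which plays the role of
  \<open>M^*\<close>, into \<open>Mts\<close>. Besides the family \<open>m_j^*, m_j\<close> with \<open>\<Sum> p(m_j^*, m_j) = 1\<close> there is a
  family \<open>n_i, n_i^*\<close> with \<open>\<Sum> q(n_i, n_i^*) = 1\<close>.
\<close>

locale morita_context =
  Mt: bimodule A A' Mt + Mts: bimodule A' A Mts +
  Ms: bimodule "A'\<lparr>carrier := K'\<rparr>" "A\<lparr>carrier := K\<rparr>" Ms
  for A :: "('o, 'a) module" and K :: "'a set" and A' :: "('o, 'b) module" and K' :: "'b set"
    and Mt :: "('a, 'm, 'b) bimod" and Mts :: "('b, 'h, 'a) bimod" and Ms :: "('b, 'f, 'a) bimod" +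
  fixes e :: "'f \<Rightarrow> 'h" and p :: "'h \<Rightarrow> 'm \<Rightarrow> 'b" and q :: "'m \<Rightarrow> 'h \<Rightarrow> 'a"
    and J :: "'j set" and ms :: "'j \<Rightarrow> 'f" and m :: "'j \<Rightarrow> 'm"
    and I :: "'i set" and ns :: "'i \<Rightarrow> 'f" and n :: "'i \<Rightarrow> 'm"
  assumes K: "K \<subseteq> carrier A" and K': "K' \<subseteq> carrier A'"
    and e_hom: "e \<in> add_hom Ms Mts" and e_inj: "inj_on e (carrier Ms)"
    and e_l: "\<lbrakk>b \<in> K'; f \<in> carrier Ms\<rbrakk> \<Longrightarrow> e (b \<odot>\<^bsub>Ms\<^esub> f) = b \<odot>\<^bsub>Mts\<^esub> e f"
    and e_r: "\<lbrakk>a \<in> K; f \<in> carrier Ms\<rbrakk> \<Longrightarrow> e (f \<triangleleft>\<^bsub>Ms\<^esub> a) = e f \<triangleleft>\<^bsub>Mts\<^esub> a"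
    and p_bal: "balanced A Mts Mt A' p" and q_bal: "balanced A' Mt Mts A q"
    and p_l: "\<lbrakk>b \<in> carrier A'; t \<in> carrier Mts; x \<in> carrier Mt\<rbrakk> \<Longrightarrow> p (b \<odot>\<^bsub>Mts\<^esub> t) x = b \<otimes>\<^bsub>A'\<^esub> p t x"
    and p_r: "\<lbrakk>b \<in> carrier A'; t \<in> carrier Mts; x \<in> carrier Mt\<rbrakk> \<Longrightarrow> p t (x \<triangleleft>\<^bsub>Mt\<^esub> b) = p t x \<otimes>\<^bsub>A'\<^esub> b"
    and q_r: "\<lbrakk>a \<in> carrier A; t \<in> carrier Mts; x \<in> carrier Mt\<rbrakk> \<Longrightarrow> q x (t \<triangleleft>\<^bsub>Mts\<^esub> a) = q x t \<otimes>\<^bsub>A\<^esub> a"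
    and p_q: "\<lbrakk>t \<in> carrier Mts; x \<in> carrier Mt; s \<in> carrier Mts\<rbrakk> \<Longrightarrow> p t x \<odot>\<^bsub>Mts\<^esub> s = t \<triangleleft>\<^bsub>Mts\<^esub> q x s"
    and finite_J: "finite J" and ms: "j \<in> J \<Longrightarrow> ms j \<in> carrier Ms" and m: "j \<in> J \<Longrightarrow> m j \<in> carrier Mt"
    and finite_I: "finite I" and ns: "i \<in> I \<Longrightarrow> ns i \<in> carrier Ms" and n: "i \<in> I \<Longrightarrow> n i \<in> carrier Mt"
    and sum_J: "(\<Oplus>\<^bsub>A'\<^esub>j \<in> J. p (e (ms j)) (m j)) = \<one>\<^bsub>A'\<^esub>"
    and sum_I: "(\<Oplus>\<^bsub>A\<^esub>i \<in> I. q (n i) (e (ns i))) = \<one>\<^bsub>A\<^esub>"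
    and q_K: "\<lbrakk>j \<in> J; f \<in> carrier Ms\<rbrakk> \<Longrightarrow> q (m j) (e f) \<in> K"
    and p_K: "\<lbrakk>i \<in> I; f \<in> carrier Ms\<rbrakk> \<Longrightarrow> p (e f) (n i) \<in> K'"
begin

abbreviation "B \<equiv> A\<lparr>carrier := K\<rparr>"
abbreviation "B' \<equiv> A'\<lparr>carrier := K'\<rparr>"

lemma K_in: "b \<in> K \<Longrightarrow> b \<in> carrier A" using K by (rule subsetD)
lemma K'_in: "b \<in> K' \<Longrightarrow> b \<in> carrier A'" using K' by (rule subsetD)
lemma e_in: "f \<in> carrier Ms \<Longrightarrow> e f \<in> carrier Mts" by (rule add_hom_closed[OF e_hom])
lemmas p_in = balancedD(1)[OF p_bal] and q_in = balancedD(1)[OF q_bal]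
lemmas Ms_l = Ms.lact_closed[simplified] and Ms_r = Ms.ract_closed[simplified]

lemmas cl = K_in K'_in e_in p_in q_in ms m ns n q_K p_K Ms_l Ms_r
  Mt.lact_closed Mts.lact_closed Mt.ract_closed Mts.ract_closed

text \<open>A dual basis argument: \<open>t\<close> is multiplied by the unit in the form
  \<open>sum_J\<close>, and \<open>p_q\<close> turns each summand into an element of the image of
  \<open>e\<close> with a coefficient from \<open>A\<close>.\<close>

lemma Mts_expand:
  assumes t: "t \<in> carrier Mts"
  shows "(\<Oplus>\<^bsub>Mts\<^esub>j \<in> J. e (ms j) \<triangleleft>\<^bsub>Mts\<^esub> q (m j) t) = t"
proof -
  have "(\<Oplus>\<^bsub>Mts\<^esub>j \<in> J. e (ms j) \<triangleleft>\<^bsub>Mts\<^esub> q (m j) t) = (\<Oplus>\<^bsub>Mts\<^esub>j \<in> J. p (e (ms j)) (m j) \<odot>\<^bsub>Mts\<^esub> t)"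
    using t by (intro Mts.M.finsum_cong') (simp_all add: p_q cl)
  also have "\<dots> = (\<Oplus>\<^bsub>A'\<^esub>j \<in> J. p (e (ms j)) (m j)) \<odot>\<^bsub>Mts\<^esub> t"
    by (rule add_hom_finsum[OF Mts.lact_hom_l[OF t] Mt.S.abelian_group_axioms Mts.M.abelian_group_axioms, symmetric])
      (simp add: cl)
  finally show ?thesis using t by (simp add: sum_J Mts.lact_one)
qed

text \<open>The mirror image with \<open>sum_I\<close>; here \<open>p_q\<close> is read backwards
  and the coefficients come from \<open>A'\<close> on the left.\<close>

lemma Mts_expand':
  assumes t: "t \<in> carrier Mts"
  shows "(\<Oplus>\<^bsub>Mts\<^esub>i \<in> I. p t (n i) \<odot>\<^bsub>Mts\<^esub> e (ns i)) = t"
proof -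
  have "(\<Oplus>\<^bsub>Mts\<^esub>i \<in> I. p t (n i) \<odot>\<^bsub>Mts\<^esub> e (ns i)) = (\<Oplus>\<^bsub>Mts\<^esub>i \<in> I. t \<triangleleft>\<^bsub>Mts\<^esub> q (n i) (e (ns i)))"
    using t by (intro Mts.M.finsum_cong') (simp_all add: p_q cl)
  also have "\<dots> = t \<triangleleft>\<^bsub>Mts\<^esub> (\<Oplus>\<^bsub>A\<^esub>i \<in> I. q (n i) (e (ns i)))"
    by (rule add_hom_finsum[OF Mts.ract_hom_r[OF t] Mt.R.abelian_group_axioms Mts.M.abelian_group_axioms, symmetric])
      (simp add: cl)
  finally show ?thesis using t by (simp add: sum_I Mts.ract_one)
qed

text \<open>For \<open>t = e f\<close> the coefficients lie in \<open>K\<close> by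
  \<open>q_K\<close>. The expansion in \<open>Mts\<close> is then the image of one in
  \<open>Ms\<close>, and injectivity of \<open>e\<close> brings it back.\<close>

lemma Ms_expand:
  assumes f: "f \<in> carrier Ms"
  shows "(\<Oplus>\<^bsub>Ms\<^esub>j \<in> J. ms j \<triangleleft>\<^bsub>Ms\<^esub> q (m j) (e f)) = f"
proof (rule inj_onD[OF e_inj])
  have "e (\<Oplus>\<^bsub>Ms\<^esub>j \<in> J. ms j \<triangleleft>\<^bsub>Ms\<^esub> q (m j) (e f)) = (\<Oplus>\<^bsub>Mts\<^esub>j \<in> J. e (ms j \<triangleleft>\<^bsub>Ms\<^esub> q (m j) (e f)))"
    by (rule add_hom_finsum[OF e_hom Ms.M.abelian_group_axioms Mts.M.abelian_group_axioms])
      (simp add: f cl)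
  also have "\<dots> = (\<Oplus>\<^bsub>Mts\<^esub>j \<in> J. e (ms j) \<triangleleft>\<^bsub>Mts\<^esub> q (m j) (e f))"
    by (intro Mts.M.finsum_cong') (simp_all add: f e_r cl)
  finally show "e (\<Oplus>\<^bsub>Ms\<^esub>j \<in> J. ms j \<triangleleft>\<^bsub>Ms\<^esub> q (m j) (e f)) = e f"
    by (simp add: Mts_expand f cl)
  show "(\<Oplus>\<^bsub>Ms\<^esub>j \<in> J. ms j \<triangleleft>\<^bsub>Ms\<^esub> q (m j) (e f)) \<in> carrier Ms"
    by (rule Ms.M.finsum_closed) (simp add: f cl)
qed (rule f)

lemma Ms_expand':
  assumes f: "f \<in> carrier Ms"
  shows "(\<Oplus>\<^bsub>Ms\<^esub>i \<in> I. p (e f) (n i) \<odot>\<^bsub>Ms\<^esub> ns i) = f"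
proof (rule inj_onD[OF e_inj])
  have "e (\<Oplus>\<^bsub>Ms\<^esub>i \<in> I. p (e f) (n i) \<odot>\<^bsub>Ms\<^esub> ns i) = (\<Oplus>\<^bsub>Mts\<^esub>i \<in> I. e (p (e f) (n i) \<odot>\<^bsub>Ms\<^esub> ns i))"
    by (rule add_hom_finsum[OF e_hom Ms.M.abelian_group_axioms Mts.M.abelian_group_axioms])
      (simp add: f cl)
  also have "\<dots> = (\<Oplus>\<^bsub>Mts\<^esub>i \<in> I. p (e f) (n i) \<odot>\<^bsub>Mts\<^esub> e (ns i))"
    by (intro Mts.M.finsum_cong') (simp_all add: f e_l cl)
  finally show "e (\<Oplus>\<^bsub>Ms\<^esub>i \<in> I. p (e f) (n i) \<odot>\<^bsub>Ms\<^esub> ns i) = e f"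
    by (simp add: Mts_expand' f cl)
  show "(\<Oplus>\<^bsub>Ms\<^esub>i \<in> I. p (e f) (n i) \<odot>\<^bsub>Ms\<^esub> ns i) \<in> carrier Ms"
    by (rule Ms.M.finsum_closed) (simp add: f cl)
qed (rule f)

end

section \<open>Pairing the dual with an arbitrary left module\<close>

locale morita_module = morita_context A K A' K' Mt Mts Ms e p q J ms m I ns n + V: left_module A V
  for A K A' K' Mt Mts Ms e p q J ms m I ns n V
begin

sublocale MsX: tensor_module "A'\<lparr>carrier := K'\<rparr>" "A\<lparr>carrier := K\<rparr>" Ms V
  by (intro tensor_module.intro Ms.bimodule_axioms V.restrict_scalars Ms.S.ring_axioms K)

text \<open>
  With \<open>\<tau>\<close> as universal pairing, \<open>Ms \<otimes>_B V\<close> is a model of \<open>Mts \<otimes>_A V\<close>; hence \<open>A'\<close> acts on it,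
  by the maps \<open>L\<close> below.
\<close>

definition \<tau> where
  "\<tau> t x = (\<Oplus>\<^bsub>MsX.T\<^esub>j \<in> J. ten B Ms V (ms j) (q (m j) t \<odot>\<^bsub>V\<^esub> x))"

lemma \<tau>_hom_l:
  assumes "x \<in> carrier V" shows "(\<lambda>t. \<tau> t x) \<in> add_hom Mts MsX.T"
  unfolding \<tau>_def
  by (intro add_hom_sum MsX.T_abelian)
    (rule add_hom_comp[OF add_hom_comp[OF balanced_hom_r[OF q_bal] V.lact_hom_l] MsX.ten_hom_r];
      simp add: cl assms)

lemma \<tau>_hom_r:
  assumes "t \<in> carrier Mts" shows "(\<lambda>x. \<tau> t x) \<in> add_hom V MsX.T"
  unfolding \<tau>_def
  by (intro add_hom_sum MsX.T_abelian)
    (rule add_hom_comp[OF V.lact_hom_r MsX.ten_hom_r]; simp add: cl assms)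

text \<open>\<open>q\<close> is right linear in its second argument, so a factor from
  \<open>A\<close> passes out of \<open>t\<close>, through \<open>q\<close>, onto
  \<open>x\<close>.\<close>

lemma \<tau>_balanced: "balanced A Mts V MsX.T \<tau>"
proof (rule balancedI)
  fix t a x assume "t \<in> carrier Mts" "a \<in> carrier A" "x \<in> carrier V"
  then show "\<tau> (t \<triangleleft>\<^bsub>Mts\<^esub> a) x = \<tau> t (a \<odot>\<^bsub>V\<^esub> x)"
    unfolding \<tau>_def
    by (intro MsX.T.finsum_cong') (simp_all add: q_r cl V.lact_assoc MsX.ten_closed V.lact_closed)
qed (simp_all add: add_hom_closed[OF \<tau>_hom_l] add_hom_add[OF \<tau>_hom_l] add_hom_add[OF \<tau>_hom_r])

lemmas \<tau>_in = balancedD(1)[OF \<tau>_balanced] and \<tau>_mult = balancedD(4)[OF \<tau>_balanced]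

text \<open>The coefficients \<open>q (m j) (e f)\<close> lie in \<open>K\<close>, so they may cross
  the tensor over \<open>B\<close>, and \<open>Ms_expand\<close> collapses the sum. Thus
  \<open>\<tau>\<close> extends the simple tensors from \<open>Ms\<close> to all of
  \<open>Mts\<close>.\<close>

lemma \<tau>_e:
  assumes f: "f \<in> carrier Ms" and x: "x \<in> carrier V"
  shows "\<tau> (e f) x = ten B Ms V f x"
proof -
  have "\<tau> (e f) x = (\<Oplus>\<^bsub>MsX.T\<^esub>j \<in> J. ten B Ms V (ms j \<triangleleft>\<^bsub>Ms\<^esub> q (m j) (e f)) x)"
    unfolding \<tau>_def using f x
    by (intro MsX.T.finsum_cong') (simp_all add: MsX.ten_balanced MsX.ten_closed cl V.lact_closed)
  also have "\<dots> = ten B Ms V (\<Oplus>\<^bsub>Ms\<^esub>j \<in> J. ms j \<triangleleft>\<^bsub>Ms\<^esub> q (m j) (e f)) x"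
    by (rule add_hom_finsum[OF MsX.ten_hom_l[OF x] Ms.M.abelian_group_axioms MsX.T_abelian, symmetric])
      (simp add: f cl)
  finally show ?thesis by (simp add: Ms_expand f)
qed

definition L where
  "L a = tensor_lift B Ms V MsX.T (\<lambda>f x. \<tau> (a \<odot>\<^bsub>Mts\<^esub> e f) x)"

lemma L_balanced:
  assumes a: "a \<in> carrier A'" shows "balanced B Ms V MsX.T (\<lambda>f x. \<tau> (a \<odot>\<^bsub>Mts\<^esub> e f) x)"
proof (rule balancedI)
  fix f b x assume "f \<in> carrier Ms" "b \<in> carrier B" "x \<in> carrier V"
  then show "\<tau> (a \<odot>\<^bsub>Mts\<^esub> e (f \<triangleleft>\<^bsub>Ms\<^esub> b)) x = \<tau> (a \<odot>\<^bsub>Mts\<^esub> e f) (b \<odot>\<^bsub>V\<^esub> x)"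
    by (simp add: a e_r cl Mts.lact_ract[symmetric] \<tau>_mult)
qed (simp_all add: a \<tau>_in cl add_hom_add[OF \<tau>_hom_l] add_hom_add[OF \<tau>_hom_r] add_hom_add[OF e_hom] Mts.lact_r_distr)

lemma L_hom: "a \<in> carrier A' \<Longrightarrow> L a \<in> add_hom MsX.T MsX.T"
  unfolding L_def by (rule MsX.lift_hom[OF MsX.T_abelian L_balanced])

lemma L_ten:
  "\<lbrakk>a \<in> carrier A'; f \<in> carrier Ms; x \<in> carrier V\<rbrakk> \<Longrightarrow> L a (ten B Ms V f x) = \<tau> (a \<odot>\<^bsub>Mts\<^esub> e f) x"
  unfolding L_def by (rule MsX.lift_ten[OF MsX.T_abelian L_balanced])

text \<open>\<open>L a\<close> is prescribed only on tensors with elements of \<open>Ms\<close>.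
  Moving each coefficient \<open>q (m j) t\<close> back into the first argument of
  \<open>\<tau>\<close> reassembles \<open>t\<close> by \<open>Mts_expand\<close>, which extends the
  formula to \<open>Mts\<close>.\<close>

lemma L_\<tau>:
  assumes a: "a \<in> carrier A'" and t: "t \<in> carrier Mts" and x: "x \<in> carrier V"
  shows "L a (\<tau> t x) = \<tau> (a \<odot>\<^bsub>Mts\<^esub> t) x"
proof -
  have "L a (\<tau> t x) = (\<Oplus>\<^bsub>MsX.T\<^esub>j \<in> J. L a (ten B Ms V (ms j) (q (m j) t \<odot>\<^bsub>V\<^esub> x)))"
    unfolding \<tau>_def
    by (rule add_hom_finsum[OF L_hom[OF a] MsX.T_abelian MsX.T_abelian])
      (simp add: a t x cl MsX.ten_closed V.lact_closed)
  also have "\<dots> = (\<Oplus>\<^bsub>MsX.T\<^esub>j \<in> J. \<tau> (a \<odot>\<^bsub>Mts\<^esub> (e (ms j) \<triangleleft>\<^bsub>Mts\<^esub> q (m j) t)) x)"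
    by (intro MsX.T.finsum_cong')
      (simp_all add: L_ten a t x cl V.lact_closed \<tau>_in \<tau>_mult[symmetric] Mts.lact_ract)
  also have "\<dots> = \<tau> (a \<odot>\<^bsub>Mts\<^esub> (\<Oplus>\<^bsub>Mts\<^esub>j \<in> J. e (ms j) \<triangleleft>\<^bsub>Mts\<^esub> q (m j) t)) x"
    by (rule add_hom_finsum[OF add_hom_comp[OF Mts.lact_hom_r[OF a] \<tau>_hom_l[OF x]]
          Mts.M.abelian_group_axioms MsX.T_abelian, symmetric])
      (simp add: a t x cl)
  finally show ?thesis by (simp add: Mts_expand t)
qed

definition ev where
  "ev y = tensor_lift B Ms V V (\<lambda>f x. q y (e f) \<odot>\<^bsub>V\<^esub> x)"

lemma ev_balanced:
  assumes y: "y \<in> carrier Mt" shows "balanced B Ms V V (\<lambda>f x. q y (e f) \<odot>\<^bsub>V\<^esub> x)"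
  by (rule balancedI)
    (simp_all add: y cl V.lact_closed e_r q_r V.lact_assoc V.lact_r_distr V.lact_l_distr
      add_hom_add[OF e_hom] balancedD(3)[OF q_bal])

lemma ev_hom: "y \<in> carrier Mt \<Longrightarrow> ev y \<in> add_hom MsX.T V"
  unfolding ev_def by (rule MsX.lift_hom[OF V.M.abelian_group_axioms ev_balanced])

lemma ev_ten:
  "\<lbrakk>y \<in> carrier Mt; f \<in> carrier Ms; x \<in> carrier V\<rbrakk> \<Longrightarrow> ev y (ten B Ms V f x) = q y (e f) \<odot>\<^bsub>V\<^esub> x"
  unfolding ev_def by (rule MsX.lift_ten[OF V.M.abelian_group_axioms ev_balanced])

text \<open>This is \<open>p_q\<close> carried over to the model: a coefficient from
  \<open>A\<close> produced by \<open>ev\<close> is traded for one from \<open>A'\<close>. In the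
  latter form it can pass through maps that commute with \<open>A'\<close>.\<close>

lemma \<tau>_ev:
  assumes t: "t \<in> carrier Mts" and y: "y \<in> carrier Mt" and s: "s \<in> carrier MsX.T"
  shows "\<tau> t (ev y s) = L (p t y) s"
  by (rule MsX.hom_eqI[OF add_hom_comp[OF ev_hom[OF y] \<tau>_hom_r[OF t]] L_hom s])
    (simp_all add: t y cl ev_ten L_ten p_q \<tau>_mult)

lemma ten_sum_I:
  assumes x: "x \<in> carrier V"
  shows "(\<Oplus>\<^bsub>V\<^esub>i \<in> I. ev (n i) (ten B Ms V (ns i) x)) = x"
proof -
  have "(\<Oplus>\<^bsub>V\<^esub>i \<in> I. ev (n i) (ten B Ms V (ns i) x)) = (\<Oplus>\<^bsub>V\<^esub>i \<in> I. q (n i) (e (ns i)) \<odot>\<^bsub>V\<^esub> x)"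
    by (intro V.M.finsum_cong') (simp_all add: ev_ten x cl V.lact_closed)
  also have "\<dots> = (\<Oplus>\<^bsub>A\<^esub>i \<in> I. q (n i) (e (ns i))) \<odot>\<^bsub>V\<^esub> x"
    by (rule add_hom_finsum[OF V.lact_hom_l[OF x] Mt.R.abelian_group_axioms V.M.abelian_group_axioms, symmetric])
      (simp add: cl)
  finally show ?thesis by (simp add: sum_I x V.lact_one)
qed

text \<open>The evaluations in \<open>ten_sum_I\<close> recover an element from its tensors with the
  \<open>ns i\<close>.\<close>

lemma faithful:
  assumes "x \<in> carrier V" "y \<in> carrier V"
    and "\<And>f. f \<in> carrier Ms \<Longrightarrow> ten B Ms V f x = ten B Ms V f y"
  shows "x = y"
proof -
  have "x = (\<Oplus>\<^bsub>V\<^esub>i \<in> I. ev (n i) (ten B Ms V (ns i) x))" using ten_sum_I[OF assms(1)] by simp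
  also have "\<dots> = (\<Oplus>\<^bsub>V\<^esub>i \<in> I. ev (n i) (ten B Ms V (ns i) y))"
    by (intro V.M.finsum_cong') (simp_all add: assms ev_ten cl V.lact_closed)
  finally show ?thesis using ten_sum_I[OF assms(2)] by simp
qed

section \<open>Induced endomorphisms, a full and faithful correspondence\<close>

abbreviation "ind \<equiv> tensor_map B Ms V Ms V (\<lambda>f. f)"

lemma ind_balanced:
  assumes F: "F \<in> linear_maps A V V" shows "balanced B Ms V MsX.T (\<lambda>f x. ten B Ms V f (F x))"
  by (rule balancedI)
    (simp_all add: linear_mapsD[OF F] MsX.ten_closed MsX.ten_add_l MsX.ten_add_r MsX.ten_balanced cl)

lemma ind_hom: "F \<in> linear_maps A V V \<Longrightarrow> ind F \<in> add_hom MsX.T MsX.T"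
  unfolding tensor_map_def by (rule MsX.lift_hom[OF MsX.T_abelian ind_balanced])

lemma ind_ten:
  "\<lbrakk>F \<in> linear_maps A V V; f \<in> carrier Ms; x \<in> carrier V\<rbrakk> \<Longrightarrow>
   ind F (ten B Ms V f x) = ten B Ms V f (F x)"
  unfolding tensor_map_def by (rule MsX.lift_ten[OF MsX.T_abelian ind_balanced])

text \<open>For general \<open>t\<close> the coefficients \<open>q (m j) t\<close> lie in
  \<open>A\<close> and not in \<open>K\<close>, so this is where linearity of \<open>F\<close> over
  all of \<open>A\<close> is felt.\<close>

lemma ind_\<tau>:
  assumes F: "F \<in> linear_maps A V V" and t: "t \<in> carrier Mts" and x: "x \<in> carrier V"
  shows "ind F (\<tau> t x) = \<tau> t (F x)"
proof -
  have "ind F (\<tau> t x) = (\<Oplus>\<^bsub>MsX.T\<^esub>j \<in> J. ind F (ten B Ms V (ms j) (q (m j) t \<odot>\<^bsub>V\<^esub> x)))"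
    unfolding \<tau>_def
    by (rule add_hom_finsum[OF ind_hom[OF F] MsX.T_abelian MsX.T_abelian])
      (simp add: t x cl MsX.ten_closed V.lact_closed)
  also have "\<dots> = \<tau> t (F x)"
    unfolding \<tau>_def
    by (intro MsX.T.finsum_cong')
      (simp_all add: ind_ten[OF F] linear_mapsD[OF F] t x cl V.lact_closed MsX.ten_closed)
  finally show ?thesis .
qed

lemma ind_L:
  assumes F: "F \<in> linear_maps A V V" and a: "a \<in> carrier A'" and s: "s \<in> carrier MsX.T"
  shows "ind F (L a s) = L a (ind F s)"
  by (rule MsX.hom_eqI[OF add_hom_comp[OF L_hom[OF a] ind_hom[OF F]] add_hom_comp[OF ind_hom[OF F] L_hom[OF a]] s])
    (simp_all add: ind_ten[OF F] linear_mapsD[OF F] L_ten a ind_\<tau>[OF F] cl)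

lemma ind_inj:
  assumes F: "F \<in> linear_maps A V V" and F': "F' \<in> linear_maps A V V"
    and eq: "\<And>s. s \<in> carrier MsX.T \<Longrightarrow> ind F s = ind F' s"
  shows "F = F'"
proof (rule linear_maps_eqI[OF F F'])
  fix x assume x: "x \<in> carrier V"
  show "F x = F' x"
    by (rule faithful)
      (simp_all add: x linear_mapsD[OF F] linear_mapsD[OF F'] ind_ten[OF F, symmetric]
        ind_ten[OF F', symmetric] eq MsX.ten_closed)
qed

lemma ind_surj:
  assumes H: "H \<in> add_hom MsX.T MsX.T"
    and HL: "\<And>a s. a \<in> carrier A' \<Longrightarrow> s \<in> carrier MsX.T \<Longrightarrow> H (L a s) = L a (H s)"
  shows "\<exists>F \<in> linear_maps A V V. \<forall>s \<in> carrier MsX.T. ind F s = H s"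
proof -
  \<comment> \<open>The formula is forced: if \<open>ind F\<close> equals \<open>H\<close>, then
    \<open>ten_sum_I\<close> applied to \<open>F x\<close> gives exactly this sum.\<close>
  define F where "F x = (\<Oplus>\<^bsub>V\<^esub>i \<in> I. ev (n i) (H (ten B Ms V (ns i) x)))" for x
  have F: "F \<in> add_hom V V"
    unfolding F_def
    by (intro add_hom_sum V.M.abelian_group_axioms)
      (rule add_hom_comp[OF add_hom_comp[OF MsX.ten_hom_r H] ev_hom]; simp add: cl)
  \<comment> \<open>\<open>\<tau>_ev\<close> replaces each evaluation by the action of
    \<open>p t (n i)\<close>, which passes through \<open>H\<close> by hypothesis;
    \<open>Mts_expand'\<close> then puts \<open>t\<close> together again.\<close>
  have \<tau>F: "\<tau> t (F x) = H (\<tau> t x)" if t: "t \<in> carrier Mts" and x: "x \<in> carrier V" for t x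
  proof -
    note c = t x cl MsX.ten_closed add_hom_closed[OF H] add_hom_closed[OF ev_hom] add_hom_closed[OF L_hom] \<tau>_in
    have "\<tau> t (F x) = (\<Oplus>\<^bsub>MsX.T\<^esub>i \<in> I. \<tau> t (ev (n i) (H (ten B Ms V (ns i) x))))"
      unfolding F_def
      by (rule add_hom_finsum[OF \<tau>_hom_r[OF t] V.M.abelian_group_axioms MsX.T_abelian]) (simp add: c)
    also have "\<dots> = (\<Oplus>\<^bsub>MsX.T\<^esub>i \<in> I. H (\<tau> (p t (n i) \<odot>\<^bsub>Mts\<^esub> e (ns i)) x))"
      by (intro MsX.T.finsum_cong') (simp_all add: c \<tau>_ev HL[symmetric] L_ten)
    also have "\<dots> = H (\<tau> (\<Oplus>\<^bsub>Mts\<^esub>i \<in> I. p t (n i) \<odot>\<^bsub>Mts\<^esub> e (ns i)) x)"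
      by (rule add_hom_finsum[OF add_hom_comp[OF \<tau>_hom_l[OF x] H] Mts.M.abelian_group_axioms MsX.T_abelian, symmetric])
        (simp add: c)
    finally show ?thesis by (simp add: Mts_expand' t)
  qed
  note Fc = add_hom_closed[OF F]
  \<comment> \<open>The formula for \<open>F\<close> does not show linearity, as \<open>H\<close> is
    merely additive. After tensoring with \<open>f\<close> the scalar \<open>a\<close> can be
    absorbed into the first argument of \<open>\<tau>\<close>, where \<open>\<tau>F\<close> holds
    for every element of \<open>Mts\<close>.\<close>
  have lin: "F (a \<odot>\<^bsub>V\<^esub> x) = a \<odot>\<^bsub>V\<^esub> F x" if "a \<in> carrier A" "x \<in> carrier V" for a x
  proof (rule faithful)
    fix f assume f: "f \<in> carrier Ms"
    show "ten B Ms V f (F (a \<odot>\<^bsub>V\<^esub> x)) = ten B Ms V f (a \<odot>\<^bsub>V\<^esub> F x)"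
      using that f by (simp add: \<tau>_e[symmetric] Fc V.lact_closed \<tau>F e_in \<tau>_mult[symmetric] Mts.ract_closed)
  qed (simp_all add: that Fc V.lact_closed)
  have R: "restrict F (carrier V) \<in> linear_maps A V V"
    by (rule linear_maps_restrict[OF V.M.abelian_group_axioms F V.lact_closed lin])
  moreover have "ind (restrict F (carrier V)) s = H s" if "s \<in> carrier MsX.T" for s
  proof (rule MsX.hom_eqI[OF ind_hom[OF R] H that])
    fix f x assume fx: "f \<in> carrier Ms" "x \<in> carrier V"
    then have "ind (restrict F (carrier V)) (ten B Ms V f x) = ten B Ms V f (F x)"
      by (simp add: ind_ten[OF R])
    also have "\<dots> = H (ten B Ms V f x)"
      using fx \<tau>F[OF e_in[OF fx(1)] fx(2)] by (simp add: \<tau>_e Fc)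
    finally show "ind (restrict F (carrier V)) (ten B Ms V f x) = H (ten B Ms V f x)" .
  qed
  ultimately show ?thesis by (intro bexI[of _ "restrict F (carrier V)"] ballI)
qed

end

section \<open>The maps of the diagram\<close>

text \<open>Commuting with \<open>K\<close> makes right multiplication by \<open>c\<close> respect
  the tensor relation over \<open>B\<close>; linearity holds because left and right multiplications
  commute.\<close>

lemma theta:
  assumes A: "ring A" and K: "ring (A\<lparr>carrier := K\<rparr>)" "K \<subseteq> carrier A"
    and U: "left_module (A\<lparr>carrier := K\<rparr>) U" and c: "c \<in> centralizer A K"
  defines "B \<equiv> A\<lparr>carrier := K\<rparr>"
  shows theta_linear: "theta B A U c \<in> linear_maps A (tensor_lmod B (regular A) U) (tensor_lmod B (regular A) U)"
    and theta_ten: "\<And>a x. a \<in> carrier A \<Longrightarrow> x \<in> carrier U \<Longrightarrow>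
      theta B A U c (ten B (regular A) U a x) = ten B (regular A) U (a \<otimes>\<^bsub>A\<^esub> c) x"
proof -
  interpret A: ring A by (rule A)
  have "bimodule A B (regular A)"
    using regular_bimodule[OF A _ _ K, of "carrier A"] A by (simp add: B_def)
  then interpret AU: tensor_module A B "regular A" U
    using U unfolding B_def by (rule tensor_module.intro)
  have cA: "c \<in> carrier A" and cK: "\<And>b. b \<in> K \<Longrightarrow> c \<otimes>\<^bsub>A\<^esub> b = b \<otimes>\<^bsub>A\<^esub> c"
    using c by (simp_all add: centralizer_def)
  note K' = subsetD[OF K(2)]
  have bal: "balanced B (regular A) U AU.T (\<lambda>a x. ten B (regular A) U (a \<otimes>\<^bsub>A\<^esub> c) x)"
  proof (rule balancedI)
    fix a b x assume h: "a \<in> carrier (regular A)" "b \<in> carrier B" "x \<in> carrier U"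
    then have b: "b \<in> K" "b \<in> carrier A" by (simp_all add: B_def K')
    have "(a \<otimes>\<^bsub>A\<^esub> b) \<otimes>\<^bsub>A\<^esub> c = (a \<otimes>\<^bsub>A\<^esub> c) \<otimes>\<^bsub>A\<^esub> b"
      using h b cA by (simp add: A.m_assoc cK)
    then show "ten B (regular A) U ((a \<triangleleft>\<^bsub>regular A\<^esub> b) \<otimes>\<^bsub>A\<^esub> c) x = ten B (regular A) U (a \<otimes>\<^bsub>A\<^esub> c) (b \<odot>\<^bsub>U\<^esub> x)"
      using AU.ten_balanced[of "a \<otimes>\<^bsub>A\<^esub> c" b x] h cA by simp
  qed (use AU.ten_add_l in \<open>simp_all add: AU.ten_closed AU.ten_add_r cA A.l_distr\<close>)
  have hom: "theta B A U c \<in> add_hom AU.T AU.T"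
    unfolding theta_def by (rule AU.lift_hom[OF AU.T_abelian bal])
  have t: "theta B A U c (ten B (regular A) U a x) = ten B (regular A) U (a \<otimes>\<^bsub>A\<^esub> c) x"
    if "a \<in> carrier A" "x \<in> carrier U" for a x
    using AU.lift_ten[OF AU.T_abelian bal] that by (simp add: theta_def)
  then show "\<And>a x. a \<in> carrier A \<Longrightarrow> x \<in> carrier U \<Longrightarrow>
    theta B A U c (ten B (regular A) U a x) = ten B (regular A) U (a \<otimes>\<^bsub>A\<^esub> c) x" .
  show "theta B A U c \<in> linear_maps A (tensor_lmod B (regular A) U) (tensor_lmod B (regular A) U)"
  proof (rule linear_mapsI)
    show "theta B A U c \<in> extensional (carrier (tensor_lmod B (regular A) U))"
      using AU.lift_ext[OF AU.T_abelian bal] by (simp add: theta_def)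
    show "theta B A U c \<in> add_hom (tensor_lmod B (regular A) U) (tensor_lmod B (regular A) U)"
      using hom by (simp add: add_hom_cong[of "tensor_lmod B (regular A) U" AU.T "tensor_lmod B (regular A) U" AU.T])
    fix a s assume a: "a \<in> carrier A" and s: "s \<in> carrier (tensor_lmod B (regular A) U)"
    show "theta B A U c (a \<odot>\<^bsub>tensor_lmod B (regular A) U\<^esub> s) = a \<odot>\<^bsub>tensor_lmod B (regular A) U\<^esub> theta B A U c s"
    proof (rule AU.hom_eqI[OF add_hom_comp[OF AU.smult_hom[OF a] hom] add_hom_comp[OF hom AU.smult_hom[OF a]]])
      show "s \<in> carrier AU.T" using s by simp
      fix x y assume "x \<in> carrier (regular A)" "y \<in> carrier U"
      then show "theta B A U c (a \<odot>\<^bsub>tensor_lmod B (regular A) U\<^esub> ten B (regular A) U x y) =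
        a \<odot>\<^bsub>tensor_lmod B (regular A) U\<^esub> theta B A U c (ten B (regular A) U x y)"
        by (simp add: t AU.smult_ten a cA A.m_assoc)
    qed
  qed
qed

section \<open>Transport of centralizers\<close>

context morita_context
begin

text \<open>By \<open>Mts_expand'\<close> the left multiples of the image of \<open>e\<close> by
  \<open>A'\<close> span \<open>Mts\<close>.\<close>

lemma Mts_hom_eqI_left:
  assumes f: "f \<in> add_hom Mts Z" and g: "g \<in> add_hom Mts Z" and Z: "abelian_group Z" and t: "t \<in> carrier Mts"
    and eq: "\<And>b x. b \<in> carrier A' \<Longrightarrow> x \<in> carrier Ms \<Longrightarrow> f (b \<odot>\<^bsub>Mts\<^esub> e x) = g (b \<odot>\<^bsub>Mts\<^esub> e x)"
  shows "f t = g t"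
proof -
  interpret Z: abelian_group Z by (rule Z)
  let ?t = "\<lambda>i. p t (n i) \<odot>\<^bsub>Mts\<^esub> e (ns i)"
  have "f (\<Oplus>\<^bsub>Mts\<^esub>i \<in> I. ?t i) = (\<Oplus>\<^bsub>Z\<^esub>i \<in> I. f (?t i))"
    by (rule add_hom_finsum[OF f Mts.M.abelian_group_axioms Z]) (simp add: t cl)
  also have "\<dots> = (\<Oplus>\<^bsub>Z\<^esub>i \<in> I. g (?t i))"
    by (intro Z.finsum_cong') (simp_all add: t cl eq add_hom_closed[OF g])
  also have "\<dots> = g (\<Oplus>\<^bsub>Mts\<^esub>i \<in> I. ?t i)"
    by (rule add_hom_finsum[OF g Mts.M.abelian_group_axioms Z, symmetric]) (simp add: t cl)
  finally show ?thesis by (simp add: Mts_expand' t)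
qed

text \<open>By \<open>Mts_expand\<close> the right multiples by \<open>A\<close> span
  \<open>Mts\<close> as well. Maps given on \<open>A' \<otimes> Ms\<close> are compared with the
  left version, maps given on \<open>Ms \<otimes> A\<close> with this one.\<close>

lemma Mts_hom_eqI_right:
  assumes f: "f \<in> add_hom Mts Z" and g: "g \<in> add_hom Mts Z" and Z: "abelian_group Z" and t: "t \<in> carrier Mts"
    and eq: "\<And>a x. a \<in> carrier A \<Longrightarrow> x \<in> carrier Ms \<Longrightarrow> f (e x \<triangleleft>\<^bsub>Mts\<^esub> a) = g (e x \<triangleleft>\<^bsub>Mts\<^esub> a)"
  shows "f t = g t"
proof -
  interpret Z: abelian_group Z by (rule Z)
  let ?t = "\<lambda>j. e (ms j) \<triangleleft>\<^bsub>Mts\<^esub> q (m j) t"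
  have "f (\<Oplus>\<^bsub>Mts\<^esub>j \<in> J. ?t j) = (\<Oplus>\<^bsub>Z\<^esub>j \<in> J. f (?t j))"
    by (rule add_hom_finsum[OF f Mts.M.abelian_group_axioms Z]) (simp add: t cl)
  also have "\<dots> = (\<Oplus>\<^bsub>Z\<^esub>j \<in> J. g (?t j))"
    by (intro Z.finsum_cong') (simp_all add: t cl eq add_hom_closed[OF g])
  also have "\<dots> = g (\<Oplus>\<^bsub>Mts\<^esub>j \<in> J. ?t j)"
    by (rule add_hom_finsum[OF g Mts.M.abelian_group_axioms Z, symmetric]) (simp add: t cl)
  finally show ?thesis by (simp add: Mts_expand t)
qed

text \<open>An element of \<open>A'\<close> is recovered from its action on the elements
  \<open>e (ms j)\<close> by pairing with the \<open>m j\<close> and applying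
  \<open>sum_J\<close>.\<close>

lemma A'_eqI:
  assumes c: "c \<in> carrier A'" and d: "d \<in> carrier A'"
    and eq: "\<And>f. f \<in> carrier Ms \<Longrightarrow> c \<odot>\<^bsub>Mts\<^esub> e f = d \<odot>\<^bsub>Mts\<^esub> e f"
  shows "c = d"
proof -
  have *: "(\<Oplus>\<^bsub>A'\<^esub>j \<in> J. p (x \<odot>\<^bsub>Mts\<^esub> e (ms j)) (m j)) = x" if x: "x \<in> carrier A'" for x
  proof -
    have "(\<Oplus>\<^bsub>A'\<^esub>j \<in> J. p (x \<odot>\<^bsub>Mts\<^esub> e (ms j)) (m j)) = (\<Oplus>\<^bsub>A'\<^esub>j \<in> J. x \<otimes>\<^bsub>A'\<^esub> p (e (ms j)) (m j))"
      by (intro Mt.S.finsum_cong') (simp_all add: x cl p_l)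
    also have "\<dots> = x \<otimes>\<^bsub>A'\<^esub> (\<Oplus>\<^bsub>A'\<^esub>j \<in> J. p (e (ms j)) (m j))"
      by (rule Mt.S.finsum_rdistr[symmetric]) (simp_all add: x cl finite_J)
    finally show ?thesis by (simp add: sum_J x)
  qed
  have "(\<Oplus>\<^bsub>A'\<^esub>j \<in> J. p (c \<odot>\<^bsub>Mts\<^esub> e (ms j)) (m j)) = (\<Oplus>\<^bsub>A'\<^esub>j \<in> J. p (d \<odot>\<^bsub>Mts\<^esub> e (ms j)) (m j))"
    by (intro Mt.S.finsum_cong') (simp_all add: eq c d cl)
  then show ?thesis by (simp only: *[OF c] *[OF d])
qed

text \<open>The counterpart on the right: \<open>sum_I\<close> recovers an element of
  \<open>A\<close> from its action on the \<open>e (ns i)\<close>.\<close>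

lemma A_eqI:
  assumes c: "c \<in> carrier A" and d: "d \<in> carrier A"
    and eq: "\<And>f. f \<in> carrier Ms \<Longrightarrow> e f \<triangleleft>\<^bsub>Mts\<^esub> c = e f \<triangleleft>\<^bsub>Mts\<^esub> d"
  shows "c = d"
proof -
  have *: "(\<Oplus>\<^bsub>A\<^esub>i \<in> I. q (n i) (e (ns i) \<triangleleft>\<^bsub>Mts\<^esub> x)) = x" if x: "x \<in> carrier A" for x
  proof -
    have "(\<Oplus>\<^bsub>A\<^esub>i \<in> I. q (n i) (e (ns i) \<triangleleft>\<^bsub>Mts\<^esub> x)) = (\<Oplus>\<^bsub>A\<^esub>i \<in> I. q (n i) (e (ns i)) \<otimes>\<^bsub>A\<^esub> x)"
      by (intro Mt.R.finsum_cong') (simp_all add: x cl q_r)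
    also have "\<dots> = (\<Oplus>\<^bsub>A\<^esub>i \<in> I. q (n i) (e (ns i))) \<otimes>\<^bsub>A\<^esub> x"
      by (rule Mt.R.finsum_ldistr[symmetric]) (simp_all add: x cl finite_I)
    finally show ?thesis by (simp add: sum_I x)
  qed
  have "(\<Oplus>\<^bsub>A\<^esub>i \<in> I. q (n i) (e (ns i) \<triangleleft>\<^bsub>Mts\<^esub> c)) = (\<Oplus>\<^bsub>A\<^esub>i \<in> I. q (n i) (e (ns i) \<triangleleft>\<^bsub>Mts\<^esub> d))"
    by (intro Mt.R.finsum_cong') (simp_all add: eq c d cl)
  then show ?thesis by (simp only: *[OF c] *[OF d])
qed

text \<open>This is \<open>phi2\<close> with the additive map already distributed over the sum,
  which frees the computation from the tensor product over \<open>A\<close>.\<close>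

definition \<phi>\<^sub>C where "\<phi>\<^sub>C c = (\<Oplus>\<^bsub>A'\<^esub>j \<in> J. p (e (ms j) \<triangleleft>\<^bsub>Mts\<^esub> c) (m j))"

lemma \<phi>\<^sub>C_in: "c \<in> carrier A \<Longrightarrow> \<phi>\<^sub>C c \<in> carrier A'"
  unfolding \<phi>\<^sub>C_def by (rule Mt.S.finsum_closed) (simp add: cl)

lemma centralizer_in: "c \<in> centralizer A K \<Longrightarrow> c \<in> carrier A"
  by (simp add: centralizer_def)

text \<open>By \<open>p_q\<close> each summand acts on \<open>e f\<close> as right multiplication of
  \<open>e (ms j)\<close> by \<open>c\<close> and then by \<open>q (m j) (e f)\<close>. That
  coefficient lies in \<open>K\<close>, so \<open>c\<close> passes it and \<open>Mts_expand\<close>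
  restores \<open>e f\<close>.\<close>

lemma \<phi>\<^sub>C_lact:
  assumes c: "c \<in> centralizer A K" and f: "f \<in> carrier Ms"
  shows "\<phi>\<^sub>C c \<odot>\<^bsub>Mts\<^esub> e f = e f \<triangleleft>\<^bsub>Mts\<^esub> c"
proof -
  have cA: "c \<in> carrier A" and cK: "\<And>b. b \<in> K \<Longrightarrow> c \<otimes>\<^bsub>A\<^esub> b = b \<otimes>\<^bsub>A\<^esub> c"
    using c by (simp_all add: centralizer_def)
  have "\<phi>\<^sub>C c \<odot>\<^bsub>Mts\<^esub> e f = (\<Oplus>\<^bsub>Mts\<^esub>j \<in> J. p (e (ms j) \<triangleleft>\<^bsub>Mts\<^esub> c) (m j) \<odot>\<^bsub>Mts\<^esub> e f)"
    unfolding \<phi>\<^sub>C_def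
    by (rule add_hom_finsum[OF Mts.lact_hom_l Mt.S.abelian_group_axioms Mts.M.abelian_group_axioms])
      (simp_all add: cA f cl)
  also have "\<dots> = (\<Oplus>\<^bsub>Mts\<^esub>j \<in> J. (e (ms j) \<triangleleft>\<^bsub>Mts\<^esub> q (m j) (e f)) \<triangleleft>\<^bsub>Mts\<^esub> c)"
    by (intro Mts.M.finsum_cong') (simp_all add: cA f cl p_q Mts.ract_assoc[symmetric] cK)
  also have "\<dots> = (\<Oplus>\<^bsub>Mts\<^esub>j \<in> J. e (ms j) \<triangleleft>\<^bsub>Mts\<^esub> q (m j) (e f)) \<triangleleft>\<^bsub>Mts\<^esub> c"
    by (rule add_hom_finsum[OF Mts.ract_hom_l[OF cA] Mts.M.abelian_group_axioms Mts.M.abelian_group_axioms, symmetric])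
      (simp add: f cl)
  finally show ?thesis by (simp add: Mts_expand f cl)
qed

lemma \<phi>\<^sub>C_unique:
  assumes "c \<in> centralizer A K" "d \<in> carrier A'"
    and "\<And>f. f \<in> carrier Ms \<Longrightarrow> d \<odot>\<^bsub>Mts\<^esub> e f = e f \<triangleleft>\<^bsub>Mts\<^esub> c"
  shows "\<phi>\<^sub>C c = d"
  by (rule A'_eqI) (simp_all add: assms \<phi>\<^sub>C_in centralizer_in \<phi>\<^sub>C_lact)

text \<open>Multiplication by \<open>b\<close> keeps \<open>Ms\<close> stable, so
  \<open>\<phi>\<^sub>C_lact\<close> also applies to \<open>b\<close> times \<open>f\<close>; the
  two sided actions commute, and \<open>A'_eqI\<close> removes \<open>f\<close>.\<close>

lemma \<phi>\<^sub>C_centralizer: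
  assumes c: "c \<in> centralizer A K" shows "\<phi>\<^sub>C c \<in> centralizer A' K'"
proof -
  have "\<phi>\<^sub>C c \<otimes>\<^bsub>A'\<^esub> b = b \<otimes>\<^bsub>A'\<^esub> \<phi>\<^sub>C c" if b: "b \<in> K'" for b
  proof (rule A'_eqI)
    fix f assume f: "f \<in> carrier Ms"
    have "(\<phi>\<^sub>C c \<otimes>\<^bsub>A'\<^esub> b) \<odot>\<^bsub>Mts\<^esub> e f = \<phi>\<^sub>C c \<odot>\<^bsub>Mts\<^esub> e (b \<odot>\<^bsub>Ms\<^esub> f)"
      using b f c by (simp add: Mts.lact_assoc \<phi>\<^sub>C_in centralizer_in cl e_l)
    also have "\<dots> = e (b \<odot>\<^bsub>Ms\<^esub> f) \<triangleleft>\<^bsub>Mts\<^esub> c"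
      using b f c by (simp add: \<phi>\<^sub>C_lact cl)
    also have "\<dots> = b \<odot>\<^bsub>Mts\<^esub> (\<phi>\<^sub>C c \<odot>\<^bsub>Mts\<^esub> e f)"
      using b f c by (simp add: \<phi>\<^sub>C_lact cl e_l Mts.lact_ract centralizer_in)
    finally show "(\<phi>\<^sub>C c \<otimes>\<^bsub>A'\<^esub> b) \<odot>\<^bsub>Mts\<^esub> e f = (b \<otimes>\<^bsub>A'\<^esub> \<phi>\<^sub>C c) \<odot>\<^bsub>Mts\<^esub> e f"
      using b f c by (simp add: Mts.lact_assoc \<phi>\<^sub>C_in centralizer_in cl)
  qed (use b c in \<open>simp_all add: \<phi>\<^sub>C_in centralizer_in cl\<close>)
  then show ?thesis using \<phi>\<^sub>C_in[OF centralizer_in[OF c]] by (simp add: centralizer_def)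
qed

lemma \<phi>\<^sub>C_inj: "inj_on \<phi>\<^sub>C (centralizer A K)"
proof (rule inj_onI)
  fix c d assume cd: "c \<in> centralizer A K" "d \<in> centralizer A K" "\<phi>\<^sub>C c = \<phi>\<^sub>C d"
  show "c = d"
    by (rule A_eqI) (use cd in \<open>simp_all add: centralizer_in \<phi>\<^sub>C_lact[symmetric]\<close>)
qed

lemma \<phi>\<^sub>C_surj:
  assumes d: "d \<in> centralizer A' K'"
  shows "\<exists>c \<in> centralizer A K. \<phi>\<^sub>C c = d"
proof -
  have dA: "d \<in> carrier A'" and dK: "\<And>b. b \<in> K' \<Longrightarrow> d \<otimes>\<^bsub>A'\<^esub> b = b \<otimes>\<^bsub>A'\<^esub> d"
    using d by (simp_all add: centralizer_def)
  \<comment> \<open>The formula of \<open>\<phi>\<^sub>C\<close> with the two families and the two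
    pairings exchanged; \<open>d\<close> acts on \<open>n i\<close> before it is paired with
    \<open>ns i\<close>.\<close>
  define c where "c = (\<Oplus>\<^bsub>A\<^esub>i \<in> I. q (n i \<triangleleft>\<^bsub>Mt\<^esub> d) (e (ns i)))"
  have cA: "c \<in> carrier A"
    unfolding c_def by (rule Mt.R.finsum_closed) (simp add: cl dA)
  have ce: "e f \<triangleleft>\<^bsub>Mts\<^esub> c = d \<odot>\<^bsub>Mts\<^esub> e f" if f: "f \<in> carrier Ms" for f
  proof -
    have "e f \<triangleleft>\<^bsub>Mts\<^esub> c = (\<Oplus>\<^bsub>Mts\<^esub>i \<in> I. e f \<triangleleft>\<^bsub>Mts\<^esub> q (n i \<triangleleft>\<^bsub>Mt\<^esub> d) (e (ns i)))"
      unfolding c_def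
      by (rule add_hom_finsum[OF Mts.ract_hom_r Mt.R.abelian_group_axioms Mts.M.abelian_group_axioms])
        (simp_all add: dA f cl)
    \<comment> \<open>Here \<open>d\<close> moves past \<open>p (e f) (n i)\<close>, which is
      possible because that coefficient lies in \<open>K'\<close>.\<close>
    also have "\<dots> = (\<Oplus>\<^bsub>Mts\<^esub>i \<in> I. d \<odot>\<^bsub>Mts\<^esub> (p (e f) (n i) \<odot>\<^bsub>Mts\<^esub> e (ns i)))"
      by (intro Mts.M.finsum_cong')
        (simp_all add: dA f cl p_q[symmetric] p_r Mts.lact_assoc[symmetric] dK)
    also have "\<dots> = d \<odot>\<^bsub>Mts\<^esub> (\<Oplus>\<^bsub>Mts\<^esub>i \<in> I. p (e f) (n i) \<odot>\<^bsub>Mts\<^esub> e (ns i))"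
      by (rule add_hom_finsum[OF Mts.lact_hom_r[OF dA] Mts.M.abelian_group_axioms Mts.M.abelian_group_axioms, symmetric])
        (simp add: f cl)
    finally show ?thesis by (simp add: Mts_expand' f cl)
  qed
  have "c \<otimes>\<^bsub>A\<^esub> b = b \<otimes>\<^bsub>A\<^esub> c" if b: "b \<in> K" for b
  proof (rule A_eqI)
    fix f assume f: "f \<in> carrier Ms"
    have "e f \<triangleleft>\<^bsub>Mts\<^esub> (b \<otimes>\<^bsub>A\<^esub> c) = e (f \<triangleleft>\<^bsub>Ms\<^esub> b) \<triangleleft>\<^bsub>Mts\<^esub> c"
      using b f cA by (simp add: Mts.ract_assoc cl e_r)
    also have "\<dots> = d \<odot>\<^bsub>Mts\<^esub> e (f \<triangleleft>\<^bsub>Ms\<^esub> b)"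
      using b f by (simp add: ce cl)
    also have "\<dots> = (e f \<triangleleft>\<^bsub>Mts\<^esub> c) \<triangleleft>\<^bsub>Mts\<^esub> b"
      using b f dA by (simp add: ce cl e_r Mts.lact_ract)
    finally show "e f \<triangleleft>\<^bsub>Mts\<^esub> (c \<otimes>\<^bsub>A\<^esub> b) = e f \<triangleleft>\<^bsub>Mts\<^esub> (b \<otimes>\<^bsub>A\<^esub> c)"
      using b f cA by (simp add: Mts.ract_assoc cl)
  qed (use b cA in \<open>simp_all add: cl\<close>)
  then have c: "c \<in> centralizer A K" using cA by (simp add: centralizer_def)
  then show ?thesis using \<phi>\<^sub>C_unique[OF c dA] ce by (intro bexI[of _ c]) simp_all
qed

end

text \<open>The action of the base ring becomes multiplication by central elements, to which
  balancedness and multiplicativity can be applied.\<close>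

lemma (in assoc_algebra) scalar:
  assumes "r \<in> carrier R"
  shows "r \<odot>\<^bsub>M\<^esub> \<one>\<^bsub>M\<^esub> \<in> carrier M"
    and "\<And>x. x \<in> carrier M \<Longrightarrow> (r \<odot>\<^bsub>M\<^esub> \<one>\<^bsub>M\<^esub>) \<otimes>\<^bsub>M\<^esub> x = r \<odot>\<^bsub>M\<^esub> x"
    and "\<And>x. x \<in> carrier M \<Longrightarrow> x \<otimes>\<^bsub>M\<^esub> (r \<odot>\<^bsub>M\<^esub> \<one>\<^bsub>M\<^esub>) = r \<odot>\<^bsub>M\<^esub> x"
  using assms by (simp_all add: smult_mult_left smult_mult_right)

text \<open>The condition \<open>scalar\<close> says that the base ring acts on \<open>Mts\<close>
  equally from both sides. Linearity of both horizontal maps over the base ring comes from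
  it.\<close>

locale morita_diagram = morita_context A K A' K' Mt Mts Ms e p q J ms m I ns n +
    U: left_module "A\<lparr>carrier := K\<rparr>" U
  for A :: "('o, 'a) module" and K A' K' Mt Mts Ms e p q J ms m I ns n and U :: "('a, 'u) module" +
  fixes \<O> :: "'o ring"
  assumes algebra: "assoc_algebra \<O> A" and algebra': "assoc_algebra \<O> A'"
    and scalar: "\<lbrakk>r \<in> carrier \<O>; t \<in> carrier Mts\<rbrakk> \<Longrightarrow>
      t \<triangleleft>\<^bsub>Mts\<^esub> (r \<odot>\<^bsub>A\<^esub> \<one>\<^bsub>A\<^esub>) = (r \<odot>\<^bsub>A'\<^esub> \<one>\<^bsub>A'\<^esub>) \<odot>\<^bsub>Mts\<^esub> t"
begin

lemma regular_bimods:
  "bimodule A A (regular A)" "bimodule A B (regular A)" "bimodule B A (regular A)" "bimodule B B (regular A)"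
  using regular_bimodule[OF Mt.R.ring_axioms, of "carrier A" "carrier A"]
    regular_bimodule[OF Mt.R.ring_axioms, of "carrier A" K]
    regular_bimodule[OF Mt.R.ring_axioms, of K "carrier A"]
    regular_bimodule[OF Mt.R.ring_axioms, of K K]
    Mt.R.ring_axioms Ms.S.ring_axioms K
  by simp_all

lemma regular_bimod': "bimodule A' B' (regular A')"
  using regular_bimodule[OF Mt.S.ring_axioms, of "carrier A'" K'] Mt.S.ring_axioms Ms.R.ring_axioms K'
  by simp

text \<open>Two modules are paired with \<open>Mts\<close>: with \<open>A\<close> itself one
  describes \<open>beta\<close>, with \<open>A \<otimes> U\<close> the map \<open>beta_U\<close>.
  The instances \<open>l\<close> and \<open>r\<close> below are the triple products at the two ends
  of \<open>beta_U\<close>.\<close>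

sublocale RA: morita_module A K A' K' Mt Mts Ms e p q J ms m I ns n "regular A"
  using regular_bimods(1) by (intro morita_module.intro morita_context_axioms) (simp add: bimodule_def)

sublocale AU: tensor_module A "A\<lparr>carrier := K\<rparr>" "regular A" U
  by (intro tensor_module.intro regular_bimods U.left_module_axioms)

sublocale XU: morita_module A K A' K' Mt Mts Ms e p q J ms m I ns n
    "tensor_lmod (A\<lparr>carrier := K\<rparr>) (regular A) U"
  by (intro morita_module.intro morita_context_axioms AU.lmod_left_module)

sublocale l: tensor_triple "A'\<lparr>carrier := K'\<rparr>" "A\<lparr>carrier := K\<rparr>" "A\<lparr>carrier := K\<rparr>" Ms "regular A" U
  by (intro tensor_triple.intro Ms.bimodule_axioms regular_bimods U.left_module_axioms)

sublocale r: tensor_triple A' "A'\<lparr>carrier := K'\<rparr>" "A\<lparr>carrier := K\<rparr>" "regular A'" Ms U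
  by (intro tensor_triple.intro Ms.bimodule_axioms regular_bimod' U.left_module_axioms)

abbreviation "N \<equiv> tensor_lmod B (regular A) U"
abbreviation "U' \<equiv> tensor_lmod B Ms U"
abbreviation "N' \<equiv> tensor_lmod B' (regular A') U'"
abbreviation "tA \<equiv> ten B (regular A) U"
abbreviation "tM \<equiv> ten B Ms N"
abbreviation "t' \<equiv> ten B' (regular A') U'"
abbreviation "tU \<equiv> ten B Ms U"

lemma one_in: "\<one>\<^bsub>A\<^esub> \<in> carrier A" by (rule Mt.R.one_closed)

lemma tA_in: "a \<in> carrier A \<Longrightarrow> u \<in> carrier U \<Longrightarrow> tA a u \<in> carrier AU.T"
  using AU.ten_closed by simp

lemma smult_tA: "\<lbrakk>a \<in> carrier A; b \<in> carrier A; u \<in> carrier U\<rbrakk> \<Longrightarrow> a \<odot>\<^bsub>N\<^esub> tA b u = tA (a \<otimes>\<^bsub>A\<^esub> b) u"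
  using AU.smult_ten by simp

text \<open>Elements of the form \<open>1 \<otimes> u\<close> generate \<open>A \<otimes> U\<close>,
  so the second argument of \<open>\<tau>\<close> can be normalized to this form. The value then
  behaves like a tensor of \<open>t\<close> and \<open>u\<close> over \<open>B\<close>.\<close>

lemma \<tau>_mult_one:
  assumes "t \<in> carrier Mts" "a \<in> carrier A" "u \<in> carrier U"
  shows "XU.\<tau> (t \<triangleleft>\<^bsub>Mts\<^esub> a) (tA \<one>\<^bsub>A\<^esub> u) = XU.\<tau> t (tA a u)"
  using assms by (simp add: XU.\<tau>_mult tA_in smult_tA)

lemma \<tau>_e_mult:
  assumes "f \<in> carrier Ms" "a \<in> carrier A" "u \<in> carrier U"
  shows "XU.\<tau> (e f \<triangleleft>\<^bsub>Mts\<^esub> a) (tA \<one>\<^bsub>A\<^esub> u) = tM f (tA a u)"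
  using assms by (simp add: \<tau>_mult_one XU.\<tau>_e tA_in cl)

text \<open>The inverse of the multiplication map \<open>A' \<otimes> Ms \<rightarrow> Mts\<close>.\<close>

definition rho where
  "rho t = (\<Oplus>\<^bsub>r.PQ.T\<^esub>i \<in> I. ten B' (regular A') Ms (p t (n i)) (ns i))"

lemma rho_hom: "rho \<in> add_hom Mts r.PQ.T"
proof -
  have "(\<lambda>t. \<Oplus>\<^bsub>r.PQ.T\<^esub>i \<in> I. ten B' (regular A') Ms (p t (n i)) (ns i)) \<in> add_hom Mts r.PQ.T"
  proof (intro add_hom_sum r.PQ.T_abelian)
    fix i assume i: "i \<in> I"
    have "(\<lambda>t. p t (n i)) \<in> add_hom Mts (regular A')"
      using balanced_hom_l[OF p_bal n[OF i]] by (simp add: add_hom_cong[of Mts Mts "regular A'" A'])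
    from add_hom_comp[OF this r.PQ.ten_hom_l[OF ns[OF i]]]
    show "(\<lambda>t. ten B' (regular A') Ms (p t (n i)) (ns i)) \<in> add_hom Mts r.PQ.T" .
  qed
  then show ?thesis by (simp add: rho_def[abs_def])
qed

text \<open>The coefficients \<open>p (e f) (n i)\<close> lie in \<open>K'\<close>, so they cross
  the tensor over \<open>B'\<close> and \<open>Ms_expand'\<close> collapses the sum.\<close>

lemma rho_e:
  assumes a: "a \<in> carrier A'" and f: "f \<in> carrier Ms"
  shows "rho (a \<odot>\<^bsub>Mts\<^esub> e f) = ten B' (regular A') Ms a f"
proof -
  have "rho (a \<odot>\<^bsub>Mts\<^esub> e f) = (\<Oplus>\<^bsub>r.PQ.T\<^esub>i \<in> I. ten B' (regular A') Ms a (p (e f) (n i) \<odot>\<^bsub>Ms\<^esub> ns i))"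
    unfolding rho_def using r.PQ.ten_balanced[of a _ "ns _"]
    by (intro r.PQ.T.finsum_cong') (simp_all add: a f cl p_l r.PQ.ten_closed)
  also have "\<dots> = ten B' (regular A') Ms a (\<Oplus>\<^bsub>Ms\<^esub>i \<in> I. p (e f) (n i) \<odot>\<^bsub>Ms\<^esub> ns i)"
    using a by (intro add_hom_finsum[OF r.PQ.ten_hom_r Ms.M.abelian_group_axioms r.PQ.T_abelian, symmetric])
      (simp_all add: f cl)
  finally show ?thesis by (simp add: Ms_expand' f)
qed

lemma rho_in: "t \<in> carrier Mts \<Longrightarrow> rho t \<in> carrier r.PQ.T"
  by (rule add_hom_closed[OF rho_hom])

lemma rho_mult:
  assumes t: "t \<in> carrier Mts" and b: "b \<in> K"
  shows "rho (t \<triangleleft>\<^bsub>Mts\<^esub> b) = rho t \<triangleleft>\<^bsub>tensor_bimod B' (regular A') Ms\<^esub> b"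
proof (rule Mts_hom_eqI_left[OF add_hom_comp[OF Mts.ract_hom_l rho_hom] add_hom_comp[OF rho_hom r.PQ.rsmult_hom]
      r.PQ.T_abelian t])
  fix c f assume "c \<in> carrier A'" "f \<in> carrier Ms"
  then show "rho (c \<odot>\<^bsub>Mts\<^esub> e f \<triangleleft>\<^bsub>Mts\<^esub> b) = rho (c \<odot>\<^bsub>Mts\<^esub> e f) \<triangleleft>\<^bsub>tensor_bimod B' (regular A') Ms\<^esub> b"
    using b by (simp add: Mts.lact_ract cl e_r[symmetric] rho_e r.PQ.rsmult_ten)
qed (simp_all add: b cl)

text \<open>The tensor of \<open>t\<close> and \<open>u\<close> over \<open>B\<close>, seen inside
  \<open>A' \<otimes> (Ms \<otimes> U)\<close>. Its counterpart in
  \<open>Ms \<otimes> (A \<otimes> U)\<close> is \<open>XU.\<tau>\<close> with second argument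
  \<open>1 \<otimes> u\<close>; \<open>\<gamma>\<close> and \<open>delta\<close> match the
  two.\<close>

definition assoc_rho where
  "assoc_rho t u = tensor_assoc B' B (regular A') Ms U (ten B (tensor_bimod B' (regular A') Ms) U (rho t) u)"

lemma assoc_rho_hom_l: "u \<in> carrier U \<Longrightarrow> (\<lambda>t. assoc_rho t u) \<in> add_hom Mts r.P_QZ.T"
  and assoc_rho_hom_r: "t \<in> carrier Mts \<Longrightarrow> (\<lambda>u. assoc_rho t u) \<in> add_hom U r.P_QZ.T"
proof -
  have h: "rho \<in> add_hom Mts (tensor_bimod B' (regular A') Ms)"
    using rho_hom by (simp add: add_hom_cong[of Mts Mts "tensor_bimod B' (regular A') Ms" r.PQ.T])
  show "(\<lambda>t. assoc_rho t u) \<in> add_hom Mts r.P_QZ.T" if "u \<in> carrier U"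
    unfolding assoc_rho_def
    by (rule add_hom_comp[OF add_hom_comp[OF h r.PQ_Z.ten_hom_l[OF that]] r.assoc_hom])
  show "(\<lambda>u. assoc_rho t u) \<in> add_hom U r.P_QZ.T" if "t \<in> carrier Mts"
    unfolding assoc_rho_def
    by (rule add_hom_comp[OF r.PQ_Z.ten_hom_r r.assoc_hom]) (simp add: rho_in that)
qed

lemma assoc_rho_e: "\<lbrakk>a \<in> carrier A'; f \<in> carrier Ms; u \<in> carrier U\<rbrakk> \<Longrightarrow> assoc_rho (a \<odot>\<^bsub>Mts\<^esub> e f) u = t' a (tU f u)"
  unfolding assoc_rho_def using r.assoc_ten[of a f u] by (simp add: rho_e)

lemma assoc_rho_mult:
  assumes "t \<in> carrier Mts" "b \<in> K" "u \<in> carrier U"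
  shows "assoc_rho (t \<triangleleft>\<^bsub>Mts\<^esub> b) u = assoc_rho t (b \<odot>\<^bsub>U\<^esub> u)"
  using assms r.PQ_Z.ten_balanced[of "rho t" b u] by (simp add: assoc_rho_def rho_mult rho_in)

lemma assoc_rho_balanced3:
  "balanced3 B B Ms (regular A) U r.P_QZ.T (\<lambda>f a u. assoc_rho (e f \<triangleleft>\<^bsub>Mts\<^esub> a) u)"
  unfolding balanced3_def
  by (intro conjI ballI balancedI)
    (simp_all add: cl add_hom_closed[OF assoc_rho_hom_l] add_hom_add[OF assoc_rho_hom_r]
      add_hom_add[OF assoc_rho_hom_l] add_hom_add[OF e_hom] Mts.ract_l_distr Mts.ract_r_distr
      Mts.ract_assoc e_r assoc_rho_mult)

definition delta where
  "delta = tensor_lift B Ms N r.P_QZ.T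
    (\<lambda>f s. tensor_lift B (regular A) U r.P_QZ.T (\<lambda>a u. assoc_rho (e f \<triangleleft>\<^bsub>Mts\<^esub> a) u) s)"

lemma delta_hom: "delta \<in> add_hom XU.MsX.T r.P_QZ.T"
  unfolding delta_def
  by (rule XU.MsX.lift_hom[OF r.P_QZ.T_abelian l.lift_right[OF r.P_QZ.T_abelian assoc_rho_balanced3]])

lemma delta_ten:
  "\<lbrakk>f \<in> carrier Ms; a \<in> carrier A; u \<in> carrier U\<rbrakk> \<Longrightarrow> delta (tM f (tA a u)) = assoc_rho (e f \<triangleleft>\<^bsub>Mts\<^esub> a) u"
  unfolding delta_def using l.lift_right_ten[OF r.P_QZ.T_abelian assoc_rho_balanced3, of f a u] by simp

text \<open>\<open>delta\<close> is computed on right multiples of \<open>e f\<close> by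
  \<open>A\<close>, whereas \<open>\<gamma>\<close> produces left multiples by \<open>A'\<close>.
  The right multiples span \<open>Mts\<close>, so the computation extends to every
  \<open>t\<close>.\<close>

lemma delta_\<tau>:
  assumes t: "t \<in> carrier Mts" and u: "u \<in> carrier U"
  shows "delta (XU.\<tau> t (tA \<one>\<^bsub>A\<^esub> u)) = assoc_rho t u"
  by (rule Mts_hom_eqI_right[OF add_hom_comp[OF XU.\<tau>_hom_l delta_hom] assoc_rho_hom_l r.P_QZ.T_abelian t])
    (simp_all add: u tA_in one_in \<tau>_e_mult delta_ten)

text \<open>
  The closed form of \<open>\<beta> \<otimes> id\<close>; in it the chosen units \<open>u_g\<close> and the gradings have disappeared.
\<close>

definition gamma_like where
  "gamma_like \<gamma> \<longleftrightarrow> \<gamma> \<in> add_hom r.P_QZ.T XU.MsX.T \<and>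
     (\<forall>a \<in> carrier A'. \<forall>f \<in> carrier Ms. \<forall>u \<in> carrier U.
        \<gamma> (t' a (tU f u)) = XU.\<tau> (a \<odot>\<^bsub>Mts\<^esub> e f) (tA \<one>\<^bsub>A\<^esub> u))"

context
  fixes \<gamma> assumes \<gamma>: "gamma_like \<gamma>"
begin

lemma \<gamma>_hom: "\<gamma> \<in> add_hom r.P_QZ.T XU.MsX.T"
  and \<gamma>_ten: "\<lbrakk>a \<in> carrier A'; f \<in> carrier Ms; u \<in> carrier U\<rbrakk> \<Longrightarrow>
    \<gamma> (t' a (tU f u)) = XU.\<tau> (a \<odot>\<^bsub>Mts\<^esub> e f) (tA \<one>\<^bsub>A\<^esub> u)"
  using \<gamma> by (simp_all add: gamma_like_def)

lemma \<gamma>_assoc_rho: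
  assumes t: "t \<in> carrier Mts" and u: "u \<in> carrier U"
  shows "\<gamma> (assoc_rho t u) = XU.\<tau> t (tA \<one>\<^bsub>A\<^esub> u)"
  by (rule Mts_hom_eqI_left[OF add_hom_comp[OF assoc_rho_hom_l \<gamma>_hom] XU.\<tau>_hom_l XU.MsX.T_abelian t])
    (simp_all add: u tA_in one_in assoc_rho_e \<gamma>_ten)

text \<open>On triple tensors one composite is evaluated by \<open>delta_\<tau>\<close> and the
  other by \<open>\<gamma>_assoc_rho\<close>, so no inverse of \<open>\<beta>\<close> has to be
  written down.\<close>

lemma \<gamma>_bij: "bij_betw \<gamma> (carrier r.P_QZ.T) (carrier XU.MsX.T)"
proof (rule bij_betw_byWitness[of _ delta])
  show "\<forall>d\<in>carrier r.P_QZ.T. delta (\<gamma> d) = d"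
    by (rule ballI, rule r.hom_eqI_right[OF add_hom_comp[OF \<gamma>_hom delta_hom] add_hom_id], assumption)
      (simp add: \<gamma>_ten delta_\<tau> assoc_rho_e cl)
  show "\<forall>s\<in>carrier XU.MsX.T. \<gamma> (delta s) = s"
    by (rule ballI, rule l.hom_eqI_right[OF add_hom_comp[OF delta_hom \<gamma>_hom] add_hom_id], assumption)
      (simp add: delta_ten \<gamma>_assoc_rho \<tau>_e_mult cl)
  show "\<gamma> ` carrier r.P_QZ.T \<subseteq> carrier XU.MsX.T"
    by (rule image_subsetI) (rule add_hom_closed[OF \<gamma>_hom])
  show "delta ` carrier XU.MsX.T \<subseteq> carrier r.P_QZ.T"
    by (rule image_subsetI) (rule add_hom_closed[OF delta_hom])
qed

text \<open>The action of \<open>A'\<close> on the induced module turns into \<open>L\<close>, so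
  conjugation by \<open>\<gamma>\<close> makes an \<open>A'\<close>-linear map acceptable to
  \<open>ind_surj\<close>.\<close>

lemma \<gamma>_smult:
  assumes a: "a \<in> carrier A'" and d: "d \<in> carrier r.P_QZ.T"
  shows "\<gamma> (a \<odot>\<^bsub>N'\<^esub> d) = XU.L a (\<gamma> d)"
proof (rule r.hom_eqI_right[OF add_hom_comp[OF r.P_QZ.smult_hom[OF a] \<gamma>_hom] add_hom_comp[OF \<gamma>_hom XU.L_hom[OF a]] d])
  fix b f u assume h: "b \<in> carrier (regular A')" "f \<in> carrier Ms" "u \<in> carrier U"
  then have "a \<odot>\<^bsub>N'\<^esub> t' b (tU f u) = t' (a \<otimes>\<^bsub>A'\<^esub> b) (tU f u)"
    using r.P_QZ.smult_ten[of a b "tU f u"] a by (simp add: r.QZ.ten_closed)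
  then show "\<gamma> (a \<odot>\<^bsub>N'\<^esub> t' b (tU f u)) = XU.L a (\<gamma> (t' b (tU f u)))"
    using h a by (simp add: \<gamma>_ten XU.L_\<tau> cl tA_in one_in Mts.lact_assoc)
qed

end

end

lemma add_hom_inv_into:
  assumes f: "f \<in> add_hom M N" and bij: "bij_betw f (carrier M) (carrier N)" and M: "abelian_group M"
  shows "inv_into (carrier M) f \<in> add_hom N M"
proof -
  interpret M: abelian_group M by (rule M)
  let ?g = "inv_into (carrier M) f"
  have g: "?g y \<in> carrier M" "f (?g y) = y" if "y \<in> carrier N" for y
    using bij that by (simp_all add: bij_betw_def inv_into_into f_inv_into_f)
  show ?thesis
  proof (rule add_homI)
    fix x y assume xy: "x \<in> carrier N" "y \<in> carrier N"
    have "f (?g x \<oplus>\<^bsub>M\<^esub> ?g y) = x \<oplus>\<^bsub>N\<^esub> y"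
      using xy by (simp add: add_hom_add[OF f] g)
    then show "?g (x \<oplus>\<^bsub>N\<^esub> y) = ?g x \<oplus>\<^bsub>M\<^esub> ?g y"
      using bij xy g M.a_closed by (metis bij_betw_inv_into_left)
  qed (rule g)
qed

lemma end_op_simps [simp]:
  "carrier (end_op A M) = linear_maps A M M"
  "f \<otimes>\<^bsub>end_op A M\<^esub> g = compose (carrier M) g f"
  "\<one>\<^bsub>end_op A M\<^esub> = (\<lambda>x \<in> carrier M. x)"
  "f \<oplus>\<^bsub>end_op A M\<^esub> g = (\<lambda>x \<in> carrier M. f x \<oplus>\<^bsub>M\<^esub> g x)"
  "r \<odot>\<^bsub>end_op A M\<^esub> f = (\<lambda>x \<in> carrier M. (r \<odot>\<^bsub>A\<^esub> \<one>\<^bsub>A\<^esub>) \<odot>\<^bsub>M\<^esub> f x)"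
  by (simp_all add: end_op_def)

context left_module
begin

lemma linear_id: "(\<lambda>x \<in> carrier M. x) \<in> linear_maps R M M"
  by (intro linear_maps_restrict add_hom_id M.abelian_group_axioms) (simp_all add: lact_closed)

lemma linear_add:
  assumes "f \<in> linear_maps R M M" "g \<in> linear_maps R M M"
  shows "(\<lambda>x \<in> carrier M. f x \<oplus>\<^bsub>M\<^esub> g x) \<in> linear_maps R M M"
  by (intro linear_maps_restrict add_hom_plus M.abelian_group_axioms)
    (simp_all add: linear_mapsD[OF assms(1)] linear_mapsD[OF assms(2)] lact_closed lact_r_distr)

lemma linear_comp:
  assumes "f \<in> linear_maps R M M" "g \<in> linear_maps R M M"
  shows "compose (carrier M) g f \<in> linear_maps R M M"
  unfolding compose_def
  by (intro linear_maps_restrict add_hom_comp[of f M M g] M.abelian_group_axioms)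
    (simp_all add: linear_mapsD[OF assms(1)] linear_mapsD[OF assms(2)] lact_closed)

lemma linear_scalar:
  assumes "f \<in> linear_maps R M M" "z \<in> carrier R" "\<And>a. a \<in> carrier R \<Longrightarrow> z \<otimes>\<^bsub>R\<^esub> a = a \<otimes>\<^bsub>R\<^esub> z"
  shows "(\<lambda>x \<in> carrier M. z \<odot>\<^bsub>M\<^esub> f x) \<in> linear_maps R M M"
  by (intro linear_maps_restrict add_hom_comp[of f M M "\<lambda>x. z \<odot>\<^bsub>M\<^esub> x"] lact_hom_r M.abelian_group_axioms)
    (simp_all add: linear_mapsD[OF assms(1)] assms(2,3) lact_closed lact_assoc[symmetric])

end

section \<open>The upper horizontal map\<close>

context morita_diagram
begin

lemma N'_left_module: "left_module A' N'"
  by (rule r.P_QZ.lmod_left_module)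

lemma scalar_central:
  assumes "r \<in> carrier \<O>"
  shows "r \<odot>\<^bsub>A\<^esub> \<one>\<^bsub>A\<^esub> \<in> carrier A"
    and "\<And>a. a \<in> carrier A \<Longrightarrow> (r \<odot>\<^bsub>A\<^esub> \<one>\<^bsub>A\<^esub>) \<otimes>\<^bsub>A\<^esub> a = a \<otimes>\<^bsub>A\<^esub> (r \<odot>\<^bsub>A\<^esub> \<one>\<^bsub>A\<^esub>)"
    and "r \<odot>\<^bsub>A'\<^esub> \<one>\<^bsub>A'\<^esub> \<in> carrier A'"
    and "\<And>a. a \<in> carrier A' \<Longrightarrow> (r \<odot>\<^bsub>A'\<^esub> \<one>\<^bsub>A'\<^esub>) \<otimes>\<^bsub>A'\<^esub> a = a \<otimes>\<^bsub>A'\<^esub> (r \<odot>\<^bsub>A'\<^esub> \<one>\<^bsub>A'\<^esub>)"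
  using assoc_algebra.scalar[OF algebra assms] assoc_algebra.scalar[OF algebra' assms] by simp_all

context
  fixes \<gamma> assumes \<gamma>: "gamma_like \<gamma>"
begin

definition Phi where
  "Phi F = restrict (inv_into (carrier N') \<gamma> \<circ> XU.ind F \<circ> \<gamma>) (carrier N')"

lemma Phi_hom:
  assumes F: "F \<in> linear_maps A N N"
  shows "(\<lambda>d. inv_into (carrier N') \<gamma> (XU.ind F (\<gamma> d))) \<in> add_hom r.P_QZ.T r.P_QZ.T"
  using add_hom_comp[OF add_hom_comp[OF \<gamma>_hom[OF \<gamma>] XU.ind_hom[OF F]]
      add_hom_inv_into[OF \<gamma>_hom[OF \<gamma>] \<gamma>_bij[OF \<gamma>] r.P_QZ.T_abelian]]
  by simp

lemma \<gamma>_in: "d \<in> carrier N' \<Longrightarrow> \<gamma> d \<in> carrier XU.MsX.T"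
  using add_hom_closed[OF \<gamma>_hom[OF \<gamma>]] by simp

lemma \<gamma>_inv: "s \<in> carrier XU.MsX.T \<Longrightarrow> \<gamma> (inv_into (carrier N') \<gamma> s) = s"
  using \<gamma>_bij[OF \<gamma>] by (simp add: bij_betw_def f_inv_into_f)

lemma \<gamma>_Phi:
  assumes F: "F \<in> linear_maps A N N" and d: "d \<in> carrier N'"
  shows "\<gamma> (Phi F d) = XU.ind F (\<gamma> d)"
  unfolding Phi_def using d \<gamma>_in[OF d] add_hom_closed[OF XU.ind_hom[OF F]] by (simp add: \<gamma>_inv[simplified])

lemma \<gamma>_inj: "d \<in> carrier N' \<Longrightarrow> d' \<in> carrier N' \<Longrightarrow> \<gamma> d = \<gamma> d' \<Longrightarrow> d = d'"
  using \<gamma>_bij[OF \<gamma>] by (simp add: bij_betw_def inj_on_def)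

lemma Phi_in:
  assumes F: "F \<in> linear_maps A N N" and d: "d \<in> carrier N'"
  shows "Phi F d \<in> carrier N'"
  unfolding Phi_def using d add_hom_closed[OF Phi_hom[OF F]] by simp

text \<open>\<open>\<gamma>\<close> is injective, so linearity may be compared after applying it;
  there the action is \<open>L\<close>, which commutes with \<open>ind F\<close>.\<close>

lemma Phi_linear:
  assumes F: "F \<in> linear_maps A N N"
  shows "Phi F \<in> linear_maps A' N' N'"
proof -
  interpret N': left_module A' N' by (rule N'_left_module)
  have h: "Phi F \<in> add_hom N' N'"
  proof (rule add_homI)
    fix x y assume "x \<in> carrier N'" "y \<in> carrier N'"
    then show "Phi F (x \<oplus>\<^bsub>N'\<^esub> y) = Phi F x \<oplus>\<^bsub>N'\<^esub> Phi F y"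
      using add_hom_add[OF Phi_hom[OF F]] by (simp add: Phi_def)
  qed (rule Phi_in[OF F])
  show ?thesis
  proof (rule linear_mapsI[OF _ h])
    fix a x assume a: "a \<in> carrier A'" and x: "x \<in> carrier N'"
    note c = N'.lact_closed Phi_in[OF F]
    show "Phi F (a \<odot>\<^bsub>N'\<^esub> x) = a \<odot>\<^bsub>N'\<^esub> Phi F x"
    proof (rule \<gamma>_inj)
      have "\<gamma> (Phi F (a \<odot>\<^bsub>N'\<^esub> x)) = XU.ind F (XU.L a (\<gamma> x))"
        using \<gamma>_Phi[OF F c(1)[OF a x]] \<gamma>_smult[OF \<gamma> a, of x] x by simp
      also have "\<dots> = XU.L a (XU.ind F (\<gamma> x))"
        by (rule XU.ind_L[OF F a \<gamma>_in[OF x]])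
      also have "\<dots> = \<gamma> (a \<odot>\<^bsub>N'\<^esub> Phi F x)"
        using \<gamma>_smult[OF \<gamma> a, of "Phi F x"] \<gamma>_Phi[OF F x] c(2)[OF x] by simp
      finally show "\<gamma> (Phi F (a \<odot>\<^bsub>N'\<^esub> x)) = \<gamma> (a \<odot>\<^bsub>N'\<^esub> Phi F x)" .
    qed (rule c(2), rule c(1)[OF a x], rule c(1)[OF a], rule c(2)[OF x])
  qed (simp add: Phi_def)
qed

text \<open>Both maps have the same values after the injective \<open>\<gamma>\<close>. Every
  algebraic identity for \<open>Phi\<close> thereby becomes one for \<open>ind\<close>, which simple
  tensors decide.\<close>

lemma Phi_eqI:
  assumes F: "F \<in> linear_maps A N N" and H: "H \<in> linear_maps A' N' N'"
    and eq: "\<And>d. d \<in> carrier N' \<Longrightarrow> \<gamma> (H d) = XU.ind F (\<gamma> d)"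
  shows "Phi F = H"
proof (rule linear_maps_eqI[OF Phi_linear[OF F] H])
  fix d assume d: "d \<in> carrier N'"
  show "Phi F d = H d"
    by (rule \<gamma>_inj[OF Phi_in[OF F d] linear_mapsD(4)[OF H d]]) (simp only: \<gamma>_Phi[OF F d] eq[OF d])
qed

lemma Phi_algebra_iso: "Phi \<in> algebra_iso \<O> (end_op A N) (end_op A' N')"
proof -
  interpret N': left_module A' N' by (rule N'_left_module)
  note ind_eqI = XU.MsX.hom_eqI[OF XU.ind_hom]
  \<comment> \<open>\<open>end_op\<close> reverses composition on both sides, so \<open>H\<close>
    and \<open>F\<close> appear in the same order before and after.\<close>
  have mult: "Phi (compose (carrier N) H F) = compose (carrier N') (Phi H) (Phi F)"
    if F: "F \<in> linear_maps A N N" and H: "H \<in> linear_maps A N N" for F H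
  proof (rule Phi_eqI[OF XU.V.linear_comp[OF F H] N'.linear_comp[OF Phi_linear[OF F] Phi_linear[OF H]]])
    fix d assume d: "d \<in> carrier N'"
    have "XU.ind (compose (carrier N) H F) s = XU.ind H (XU.ind F s)" if "s \<in> carrier XU.MsX.T" for s
    proof (rule ind_eqI[OF XU.V.linear_comp[OF F H] add_hom_comp[OF XU.ind_hom[OF F] XU.ind_hom[OF H]] that])
      fix f x assume fx: "f \<in> carrier Ms" "x \<in> carrier N"
      show "XU.ind (compose (carrier N) H F) (tM f x) = XU.ind H (XU.ind F (tM f x))"
        unfolding XU.ind_ten[OF XU.V.linear_comp[OF F H] fx] XU.ind_ten[OF F fx]
          XU.ind_ten[OF H fx(1) linear_mapsD(4)[OF F fx(2)]] compose_eq[OF fx(2)] ..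
    qed
    from this[OF \<gamma>_in[OF d]]
    show "\<gamma> (compose (carrier N') (Phi H) (Phi F) d) = XU.ind (compose (carrier N) H F) (\<gamma> d)"
      by (simp only: compose_eq[OF d] \<gamma>_Phi[OF H Phi_in[OF F d]] \<gamma>_Phi[OF F d])
  qed
  have add: "Phi (\<lambda>x \<in> carrier N. F x \<oplus>\<^bsub>N\<^esub> H x) = (\<lambda>x \<in> carrier N'. Phi F x \<oplus>\<^bsub>N'\<^esub> Phi H x)"
    if F: "F \<in> linear_maps A N N" and H: "H \<in> linear_maps A N N" for F H
  proof (rule Phi_eqI[OF XU.V.linear_add[OF F H] N'.linear_add[OF Phi_linear[OF F] Phi_linear[OF H]]])
    fix d assume d: "d \<in> carrier N'"
    have "XU.ind (\<lambda>x \<in> carrier N. F x \<oplus>\<^bsub>N\<^esub> H x) s = XU.ind F s \<oplus>\<^bsub>XU.MsX.T\<^esub> XU.ind H s"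
      if "s \<in> carrier XU.MsX.T" for s
    proof (rule ind_eqI[OF XU.V.linear_add[OF F H] add_hom_plus[OF XU.ind_hom[OF F] XU.ind_hom[OF H] XU.MsX.T_abelian] that])
      fix f x assume fx: "f \<in> carrier Ms" "x \<in> carrier N"
      show "XU.ind (\<lambda>x \<in> carrier N. F x \<oplus>\<^bsub>N\<^esub> H x) (tM f x) = XU.ind F (tM f x) \<oplus>\<^bsub>XU.MsX.T\<^esub> XU.ind H (tM f x)"
        unfolding XU.ind_ten[OF XU.V.linear_add[OF F H] fx] XU.ind_ten[OF F fx] XU.ind_ten[OF H fx] restrict_apply'[OF fx(2)]
        by (rule XU.MsX.ten_add_r[OF fx(1) linear_mapsD(4)[OF F fx(2)] linear_mapsD(4)[OF H fx(2)]])
    qed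
    from this[OF \<gamma>_in[OF d]] add_hom_add[OF \<gamma>_hom[OF \<gamma>], of "Phi F d" "Phi H d"]
    show "\<gamma> ((\<lambda>x \<in> carrier N'. Phi F x \<oplus>\<^bsub>N'\<^esub> Phi H x) d) = XU.ind (\<lambda>x \<in> carrier N. F x \<oplus>\<^bsub>N\<^esub> H x) (\<gamma> d)"
      using d Phi_in[OF F d] Phi_in[OF H d] \<gamma>_Phi[OF F d] \<gamma>_Phi[OF H d] by simp
  qed
  have one: "Phi (\<lambda>x \<in> carrier N. x) = (\<lambda>x \<in> carrier N'. x)"
  proof (rule Phi_eqI[OF XU.V.linear_id N'.linear_id])
    fix d assume d: "d \<in> carrier N'"
    have "XU.ind (\<lambda>x \<in> carrier N. x) s = s" if "s \<in> carrier XU.MsX.T" for s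
    proof (rule ind_eqI[OF XU.V.linear_id add_hom_id that])
      fix f x assume fx: "f \<in> carrier Ms" "x \<in> carrier N"
      show "XU.ind (\<lambda>x \<in> carrier N. x) (tM f x) = tM f x"
        unfolding XU.ind_ten[OF XU.V.linear_id fx] restrict_apply'[OF fx(2)] ..
    qed
    from this[OF \<gamma>_in[OF d]] d
    show "\<gamma> ((\<lambda>x \<in> carrier N'. x) d) = XU.ind (\<lambda>x \<in> carrier N. x) (\<gamma> d)" by simp
  qed
  \<comment> \<open>The scalar leaves \<open>N\<close> in three moves: across the tensor onto
    \<open>e f\<close>, from the right action to the left one by \<open>scalar\<close>, and out of
    the pairing as \<open>L\<close>.\<close>
  have scal: "Phi (\<lambda>x \<in> carrier N. (c \<odot>\<^bsub>A\<^esub> \<one>\<^bsub>A\<^esub>) \<odot>\<^bsub>N\<^esub> F x) =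
      (\<lambda>x \<in> carrier N'. (c \<odot>\<^bsub>A'\<^esub> \<one>\<^bsub>A'\<^esub>) \<odot>\<^bsub>N'\<^esub> Phi F x)"
    if F: "F \<in> linear_maps A N N" and c: "c \<in> carrier \<O>" for F c
  proof -
    let ?c = "c \<odot>\<^bsub>A\<^esub> \<one>\<^bsub>A\<^esub>" and ?c' = "c \<odot>\<^bsub>A'\<^esub> \<one>\<^bsub>A'\<^esub>"
    note z = scalar_central[OF c]
    have l: "(\<lambda>x \<in> carrier N. ?c \<odot>\<^bsub>N\<^esub> F x) \<in> linear_maps A N N"
      by (rule XU.V.linear_scalar[OF F z(1) z(2)])
    have l': "(\<lambda>x \<in> carrier N'. ?c' \<odot>\<^bsub>N'\<^esub> Phi F x) \<in> linear_maps A' N' N'"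
      by (rule N'.linear_scalar[OF Phi_linear[OF F] z(3) z(4)])
    show ?thesis
    proof (rule Phi_eqI[OF l l'])
      fix d assume d: "d \<in> carrier N'"
      have "XU.ind (\<lambda>x \<in> carrier N. ?c \<odot>\<^bsub>N\<^esub> F x) s = XU.L ?c' (XU.ind F s)"
        if "s \<in> carrier XU.MsX.T" for s
      proof (rule ind_eqI[OF l add_hom_comp[OF XU.ind_hom[OF F] XU.L_hom[OF z(3)]] that])
        fix f x assume fx: "f \<in> carrier Ms" "x \<in> carrier N"
        note Fx = linear_mapsD(4)[OF F fx(2)]
        have "XU.ind (\<lambda>x \<in> carrier N. ?c \<odot>\<^bsub>N\<^esub> F x) (tM f x) = tM f (?c \<odot>\<^bsub>N\<^esub> F x)"
          by (rule trans[OF XU.ind_ten[OF l fx]]) (simp only: restrict_apply fx(2) if_True)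
        also have "\<dots> = XU.\<tau> (e f) (?c \<odot>\<^bsub>N\<^esub> F x)"
          by (rule XU.\<tau>_e[OF fx(1) XU.V.lact_closed[OF z(1) Fx], symmetric])
        also have "\<dots> = XU.\<tau> (e f \<triangleleft>\<^bsub>Mts\<^esub> ?c) (F x)"
          by (rule XU.\<tau>_mult[OF e_in[OF fx(1)] z(1) Fx, symmetric])
        also have "\<dots> = XU.\<tau> (?c' \<odot>\<^bsub>Mts\<^esub> e f) (F x)"
          unfolding scalar[OF c e_in[OF fx(1)]] ..
        also have "\<dots> = XU.L ?c' (tM f (F x))"
          by (rule XU.L_ten[OF z(3) fx(1) Fx, symmetric])
        finally show "XU.ind (\<lambda>x \<in> carrier N. ?c \<odot>\<^bsub>N\<^esub> F x) (tM f x) = XU.L ?c' (XU.ind F (tM f x))"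
          unfolding XU.ind_ten[OF F fx] .
      qed
      from this[OF \<gamma>_in[OF d]] \<gamma>_smult[OF \<gamma> z(3), of "Phi F d"]
      show "\<gamma> ((\<lambda>x \<in> carrier N'. ?c' \<odot>\<^bsub>N'\<^esub> Phi F x) d) = XU.ind (\<lambda>x \<in> carrier N. ?c \<odot>\<^bsub>N\<^esub> F x) (\<gamma> d)"
        using d Phi_in[OF F d] \<gamma>_Phi[OF F d] by simp
    qed
  qed
  have inj: "inj_on Phi (linear_maps A N N)"
  proof (rule inj_onI)
    fix F H assume F: "F \<in> linear_maps A N N" and H: "H \<in> linear_maps A N N" and eq: "Phi F = Phi H"
    show "F = H"
    proof (rule XU.ind_inj[OF F H])
      fix s assume "s \<in> carrier XU.MsX.T"
      then obtain d where d: "d \<in> carrier N'" "s = \<gamma> d"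
        using \<gamma>_bij[OF \<gamma>] by (auto simp: bij_betw_def)
      show "XU.ind F s = XU.ind H s"
        unfolding d(2) \<gamma>_Phi[OF F d(1), symmetric] \<gamma>_Phi[OF H d(1), symmetric] eq ..
    qed
  qed
  \<comment> \<open>\<open>H\<close> is conjugated by \<open>\<gamma>\<close> to an additive map on
    \<open>Ms \<otimes> N\<close>. It commutes with \<open>L\<close> because \<open>H\<close> is
    \<open>A'\<close>-linear, so \<open>ind_surj\<close> supplies the preimage.\<close>
  have surj: "\<exists>F \<in> linear_maps A N N. Phi F = H" if H: "H \<in> linear_maps A' N' N'" for H
  proof -
    let ?g = "inv_into (carrier N') \<gamma>"
    have g: "?g \<in> add_hom XU.MsX.T r.P_QZ.T"
      using add_hom_inv_into[OF \<gamma>_hom[OF \<gamma>] \<gamma>_bij[OF \<gamma>] r.P_QZ.T_abelian] by simp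
    have g\<gamma>: "?g (\<gamma> d) = d" if "d \<in> carrier N'" for d
      using \<gamma>_bij[OF \<gamma>] that by (simp add: bij_betw_def inv_into_f_f)
    have gN: "?g s \<in> carrier N'" if "s \<in> carrier XU.MsX.T" for s
      using add_hom_closed[OF g that] by simp
    have Hh: "H \<in> add_hom r.P_QZ.T r.P_QZ.T"
      using linear_mapsD(2)[OF H] by (simp add: add_hom_cong[of N' r.P_QZ.T N' r.P_QZ.T])
    have gL: "?g (XU.L a s) = a \<odot>\<^bsub>N'\<^esub> ?g s" if "a \<in> carrier A'" "s \<in> carrier XU.MsX.T" for a s
    proof -
      have "\<gamma> (a \<odot>\<^bsub>N'\<^esub> ?g s) = XU.L a s"
        using \<gamma>_smult[OF \<gamma> that(1), of "?g s"] gN[OF that(2)] \<gamma>_inv[OF that(2)] by simp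
      then show ?thesis using g\<gamma>[OF N'.lact_closed[OF that(1) gN[OF that(2)]]] by simp
    qed
    have "\<exists>F \<in> linear_maps A N N. \<forall>s \<in> carrier XU.MsX.T. XU.ind F s = \<gamma> (H (?g s))"
    proof (rule XU.ind_surj[OF add_hom_comp[OF add_hom_comp[OF g Hh] \<gamma>_hom[OF \<gamma>]]])
      fix a s assume as: "a \<in> carrier A'" "s \<in> carrier XU.MsX.T"
      show "\<gamma> (H (?g (XU.L a s))) = XU.L a (\<gamma> (H (?g s)))"
        using \<gamma>_smult[OF \<gamma> as(1), of "H (?g s)"] linear_mapsD(4)[OF H gN[OF as(2)]]
          linear_mapsD(3)[OF H as(1) gN[OF as(2)]] gL[OF as] by simp
    qed
    then obtain F where F: "F \<in> linear_maps A N N"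
      and eq: "\<And>s. s \<in> carrier XU.MsX.T \<Longrightarrow> XU.ind F s = \<gamma> (H (?g s))" by (elim bexE) (simp only:)
    have "Phi F = H"
      by (rule Phi_eqI[OF F H]) (simp only: eq[OF \<gamma>_in] g\<gamma>)
    with F show ?thesis by (intro bexI)
  qed
  have "Phi \<in> ring_hom (end_op A N) (end_op A' N')"
    by (rule ring_hom_memI) (simp_all only: end_op_simps Phi_linear mult add one)
  moreover have "bij_betw Phi (carrier (end_op A N)) (carrier (end_op A' N'))"
    unfolding bij_betw_def end_op_simps
  proof (intro conjI inj equalityI subsetI)
    fix H assume "H \<in> Phi ` linear_maps A N N"
    then show "H \<in> linear_maps A' N' N'" by (elim imageE) (simp only: Phi_linear)
  next
    fix H assume "H \<in> linear_maps A' N' N'"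
    from surj[OF this] show "H \<in> Phi ` linear_maps A N N" by (elim bexE) (rule image_eqI, erule sym)
  qed
  ultimately show ?thesis
    unfolding algebra_iso_def mem_Collect_eq end_op_simps using scal by (intro conjI ballI)
qed

lemma Phi_theta:
  assumes c: "c \<in> centralizer A K"
  shows "Phi (theta B A U c) = theta B' A' U' (\<phi>\<^sub>C c)"
proof -
  note th = theta_linear[OF Mt.R.ring_axioms Ms.S.ring_axioms K U.left_module_axioms c]
    theta_ten[OF Mt.R.ring_axioms Ms.S.ring_axioms K U.left_module_axioms c]
  note th' = theta_linear[OF Mt.S.ring_axioms Ms.R.ring_axioms K' r.QZ.lmod_left_module \<phi>\<^sub>C_centralizer[OF c]]
    theta_ten[OF Mt.S.ring_axioms Ms.R.ring_axioms K' r.QZ.lmod_left_module \<phi>\<^sub>C_centralizer[OF c]]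
  have h': "theta B' A' U' (\<phi>\<^sub>C c) \<in> add_hom r.P_QZ.T r.P_QZ.T"
    using linear_mapsD(2)[OF th'(1)] by (simp add: add_hom_cong[of N' r.P_QZ.T N' r.P_QZ.T])
  note cA = centralizer_in[OF c]
  show ?thesis
  proof (rule Phi_eqI[OF th(1) th'(1)])
    fix d assume "d \<in> carrier N'"
    then have d: "d \<in> carrier r.P_QZ.T" by simp
    show "\<gamma> (theta B' A' U' (\<phi>\<^sub>C c) d) = XU.ind (theta B A U c) (\<gamma> d)"
    proof (rule r.hom_eqI_right[OF add_hom_comp[OF h' \<gamma>_hom[OF \<gamma>]]
          add_hom_comp[OF \<gamma>_hom[OF \<gamma>] XU.ind_hom[OF th(1)]] d])
      fix a f u assume "a \<in> carrier (regular A')" and f: "f \<in> carrier Ms" and u: "u \<in> carrier U"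
      then have a: "a \<in> carrier A'" by simp
      have t: "a \<odot>\<^bsub>Mts\<^esub> e f \<in> carrier Mts" using a f by (simp add: cl)
      have tU: "tU f u \<in> carrier U'" using r.QZ.ten_closed[OF f u] by simp
      have tA1: "tA \<one>\<^bsub>A\<^esub> u \<in> carrier N" using tA_in[OF one_in u] by simp
      have "\<gamma> (theta B' A' U' (\<phi>\<^sub>C c) (t' a (tU f u))) = XU.\<tau> ((a \<otimes>\<^bsub>A'\<^esub> \<phi>\<^sub>C c) \<odot>\<^bsub>Mts\<^esub> e f) (tA \<one>\<^bsub>A\<^esub> u)"
        unfolding th'(2)[OF a tU]
        by (rule \<gamma>_ten[OF \<gamma> _ f u]) (simp add: a \<phi>\<^sub>C_in cA)
      \<comment> \<open>The factor from \<open>A'\<close> becomes right multiplication of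
        \<open>e f\<close> by \<open>c\<close>. In the next step \<open>c\<close> crosses into
        \<open>A \<otimes> U\<close>, where it is the value of \<open>theta\<close> at
        \<open>1 \<otimes> u\<close>.\<close>
      also have "(a \<otimes>\<^bsub>A'\<^esub> \<phi>\<^sub>C c) \<odot>\<^bsub>Mts\<^esub> e f = (a \<odot>\<^bsub>Mts\<^esub> e f) \<triangleleft>\<^bsub>Mts\<^esub> c"
        using a f cA c by (simp add: Mts.lact_assoc \<phi>\<^sub>C_in cl \<phi>\<^sub>C_lact Mts.lact_ract)
      also have "XU.\<tau> ((a \<odot>\<^bsub>Mts\<^esub> e f) \<triangleleft>\<^bsub>Mts\<^esub> c) (tA \<one>\<^bsub>A\<^esub> u) = XU.\<tau> (a \<odot>\<^bsub>Mts\<^esub> e f) (tA c u)"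
        by (rule \<tau>_mult_one[OF t cA u])
      also have "tA c u = theta B A U c (tA \<one>\<^bsub>A\<^esub> u)"
        using th(2)[OF one_in u] cA by simp
      also have "XU.\<tau> (a \<odot>\<^bsub>Mts\<^esub> e f) (theta B A U c (tA \<one>\<^bsub>A\<^esub> u)) = XU.ind (theta B A U c) (\<gamma> (t' a (tU f u)))"
        unfolding \<gamma>_ten[OF \<gamma> a f u] by (rule XU.ind_\<tau>[OF th(1) t tA1, symmetric])
      finally show "\<gamma> (theta B' A' U' (\<phi>\<^sub>C c) (t' a (tU f u))) = XU.ind (theta B A U c) (\<gamma> (t' a (tU f u)))" .
    qed
  qed
qed

end

end

section \<open>The lower horizontal map and the closed form of \<open>beta\<close>\<close>

context morita_diagram
begin

lemma centralizer_closed: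
  assumes "c \<in> centralizer A K" "d \<in> centralizer A K"
  shows "c \<otimes>\<^bsub>A\<^esub> d \<in> centralizer A K" "c \<oplus>\<^bsub>A\<^esub> d \<in> centralizer A K"
proof -
  have cd: "c \<in> carrier A" "d \<in> carrier A" "\<And>b. b \<in> K \<Longrightarrow> c \<otimes>\<^bsub>A\<^esub> b = b \<otimes>\<^bsub>A\<^esub> c"
    "\<And>b. b \<in> K \<Longrightarrow> d \<otimes>\<^bsub>A\<^esub> b = b \<otimes>\<^bsub>A\<^esub> d"
    using assms by (simp_all add: centralizer_def)
  have "(c \<otimes>\<^bsub>A\<^esub> d) \<otimes>\<^bsub>A\<^esub> b = b \<otimes>\<^bsub>A\<^esub> (c \<otimes>\<^bsub>A\<^esub> d)" if "b \<in> K" for b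
  proof -
    have "(c \<otimes>\<^bsub>A\<^esub> d) \<otimes>\<^bsub>A\<^esub> b = (c \<otimes>\<^bsub>A\<^esub> b) \<otimes>\<^bsub>A\<^esub> d"
      using that cd(1,2) by (simp add: Mt.R.m_assoc K_in cd(4))
    then show ?thesis using that cd(1,2) by (simp add: Mt.R.m_assoc K_in cd(3))
  qed
  then show "c \<otimes>\<^bsub>A\<^esub> d \<in> centralizer A K" using cd(1,2) by (simp add: centralizer_def)
  show "c \<oplus>\<^bsub>A\<^esub> d \<in> centralizer A K"
    using cd by (simp add: centralizer_def Mt.R.l_distr Mt.R.r_distr K_in)
qed

text \<open>By \<open>\<phi>\<^sub>C_unique\<close> each identity is a check on \<open>e f\<close>.
  Products are not reversed: the image of \<open>d\<close> turns \<open>f\<close> into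
  \<open>f d\<close>, and the image of \<open>c\<close> then acts on \<open>f\<close> inside, which
  gives \<open>f c d\<close>.\<close>

lemma \<phi>\<^sub>C_algebra_iso:
  "\<phi>\<^sub>C \<in> algebra_iso \<O> (A\<lparr>carrier := centralizer A K\<rparr>) (A'\<lparr>carrier := centralizer A' K'\<rparr>)"
proof -
  note i = \<phi>\<^sub>C_in centralizer_in cl
  have mult: "\<phi>\<^sub>C (c \<otimes>\<^bsub>A\<^esub> d) = \<phi>\<^sub>C c \<otimes>\<^bsub>A'\<^esub> \<phi>\<^sub>C d"
    if "c \<in> centralizer A K" "d \<in> centralizer A K" for c d
    using that
    by (intro \<phi>\<^sub>C_unique centralizer_closed)
      (simp_all add: i Mts.lact_assoc \<phi>\<^sub>C_lact Mts.lact_ract[symmetric] Mts.ract_assoc)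
  have add: "\<phi>\<^sub>C (c \<oplus>\<^bsub>A\<^esub> d) = \<phi>\<^sub>C c \<oplus>\<^bsub>A'\<^esub> \<phi>\<^sub>C d"
    if "c \<in> centralizer A K" "d \<in> centralizer A K" for c d
    using that
    by (intro \<phi>\<^sub>C_unique centralizer_closed)
      (simp_all add: i Mts.lact_l_distr \<phi>\<^sub>C_lact Mts.ract_r_distr)
  have one: "\<phi>\<^sub>C \<one>\<^bsub>A\<^esub> = \<one>\<^bsub>A'\<^esub>"
    by (rule \<phi>\<^sub>C_unique) (simp_all add: centralizer_def cl Mts.lact_one Mts.ract_one)
  have scal: "\<phi>\<^sub>C (z \<odot>\<^bsub>A\<^esub> c) = z \<odot>\<^bsub>A'\<^esub> \<phi>\<^sub>C c" if z: "z \<in> carrier \<O>" and c: "c \<in> centralizer A K" for z c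
  proof -
    note s = scalar_central[OF z]
    have zc: "z \<odot>\<^bsub>A\<^esub> \<one>\<^bsub>A\<^esub> \<in> centralizer A K" using s(1,2) by (simp add: centralizer_def K_in)
    have "\<phi>\<^sub>C (z \<odot>\<^bsub>A\<^esub> \<one>\<^bsub>A\<^esub>) = z \<odot>\<^bsub>A'\<^esub> \<one>\<^bsub>A'\<^esub>"
      by (rule \<phi>\<^sub>C_unique[OF zc s(3)]) (simp add: scalar[OF z] e_in)
    moreover have "z \<odot>\<^bsub>A\<^esub> c = (z \<odot>\<^bsub>A\<^esub> \<one>\<^bsub>A\<^esub>) \<otimes>\<^bsub>A\<^esub> c"
      using assoc_algebra.scalar(2)[OF algebra z] c by (simp add: centralizer_in)
    moreover have "z \<odot>\<^bsub>A'\<^esub> \<phi>\<^sub>C c = (z \<odot>\<^bsub>A'\<^esub> \<one>\<^bsub>A'\<^esub>) \<otimes>\<^bsub>A'\<^esub> \<phi>\<^sub>C c"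
      using assoc_algebra.scalar(2)[OF algebra' z] c by (simp add: i)
    ultimately show ?thesis using mult[OF zc c] by simp
  qed
  have "\<phi>\<^sub>C \<in> ring_hom (A\<lparr>carrier := centralizer A K\<rparr>) (A'\<lparr>carrier := centralizer A' K'\<rparr>)"
    by (rule ring_hom_memI) (simp_all add: \<phi>\<^sub>C_centralizer mult add one)
  moreover have "bij_betw \<phi>\<^sub>C (centralizer A K) (centralizer A' K')"
    unfolding bij_betw_def
  proof (intro conjI \<phi>\<^sub>C_inj equalityI subsetI)
    fix d assume "d \<in> \<phi>\<^sub>C ` centralizer A K"
    then show "d \<in> centralizer A' K'" by (elim imageE) (simp only: \<phi>\<^sub>C_centralizer)
  next
    fix d assume "d \<in> centralizer A' K'"
    from \<phi>\<^sub>C_surj[OF this] show "d \<in> \<phi>\<^sub>C ` centralizer A K" by (elim bexE) (rule image_eqI, erule sym)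
  qed
  ultimately show ?thesis by (simp add: algebra_iso_def scal)
qed

text \<open>On right multiples of \<open>e f\<close> the pairing is a simple tensor whose second
  factor carries the right action. It serves to show that \<open>\<beta>\<close> is right linear
  over \<open>B\<close>.\<close>

lemma RA_\<tau>_rsmult:
  assumes t: "t \<in> carrier Mts" and x: "x \<in> carrier A" and b: "b \<in> K"
  shows "RA.\<tau> t x \<triangleleft>\<^bsub>tensor_bimod B Ms (regular A)\<^esub> b = RA.\<tau> t (x \<otimes>\<^bsub>A\<^esub> b)"
proof (rule Mts_hom_eqI_right[OF add_hom_comp[OF RA.\<tau>_hom_l l.PQ.rsmult_hom] RA.\<tau>_hom_l RA.MsX.T_abelian t])
  fix a f assume a: "a \<in> carrier A" and f: "f \<in> carrier Ms"
  note \<tau>m = RA.\<tau>_mult[OF e_in[OF f] a] and \<tau>e = RA.\<tau>_e[OF f]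
  show "RA.\<tau> (e f \<triangleleft>\<^bsub>Mts\<^esub> a) x \<triangleleft>\<^bsub>tensor_bimod B Ms (regular A)\<^esub> b = RA.\<tau> (e f \<triangleleft>\<^bsub>Mts\<^esub> a) (x \<otimes>\<^bsub>A\<^esub> b)"
    using l.PQ.rsmult_ten[of b f "a \<otimes>\<^bsub>A\<^esub> x"] a f x b by (simp add: \<tau>m \<tau>e K_in Mt.R.m_assoc)
qed (simp_all add: x b K_in)

text \<open>Multiplication identifies both \<open>A' \<otimes> Ms\<close> and
  \<open>Ms \<otimes> A\<close> with \<open>Mts\<close>; the formula describes the map between them
  that results, with \<open>\<tau>\<close> at 1 as the inverse of the second multiplication.\<close>

definition beta_like where
  "beta_like \<beta> \<longleftrightarrow> \<beta> \<in> add_hom r.PQ.T RA.MsX.T \<and>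
     (\<forall>a \<in> carrier A'. \<forall>f \<in> carrier Ms.
        \<beta> (ten B' (regular A') Ms a f) = RA.\<tau> (a \<odot>\<^bsub>Mts\<^esub> e f) \<one>\<^bsub>A\<^esub>)"

text \<open>Balancedness is hard to see in the sum over components that defines \<open>beta\<close>.
  It is inherited from the pairing once the values are known to agree with the closed form.\<close>

lemma beta_like_lift:
  assumes h: "\<And>a f. a \<in> carrier A' \<Longrightarrow> f \<in> carrier Ms \<Longrightarrow> h a f = RA.\<tau> (a \<odot>\<^bsub>Mts\<^esub> e f) \<one>\<^bsub>A\<^esub>"
  shows "beta_like (tensor_lift B' (regular A') Ms RA.MsX.T h)"
proof -
  have bal: "balanced B' (regular A') Ms RA.MsX.T h"
    using RA.\<tau>_in one_in
    by (intro balancedI)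
      (simp_all add: h cl add_hom_add[OF RA.\<tau>_hom_l] add_hom_add[OF e_hom] Mts.lact_l_distr
        Mts.lact_r_distr Mts.lact_assoc e_l)
  show ?thesis
    unfolding beta_like_def
    using r.PQ.lift_hom[OF RA.MsX.T_abelian bal] r.PQ.lift_ten[OF RA.MsX.T_abelian bal] h by simp
qed

text \<open>A simple tensor from \<open>Ms\<close> is a value of \<open>\<tau>\<close>, so the
  inverse unit moves from its first argument to the second and cancels there. Additivity of
  \<open>\<tau>\<close> then collects the terms.\<close>

lemma beta_sum:
  assumes f: "f \<in> carrier Ms" and a: "\<And>g. g \<in> S \<Longrightarrow> a g \<in> carrier A'"
    and u: "\<And>g. g \<in> S \<Longrightarrow> u g \<in> Units A"
    and im: "\<And>g. g \<in> S \<Longrightarrow> (a g \<odot>\<^bsub>Mts\<^esub> e f) \<triangleleft>\<^bsub>Mts\<^esub> inv\<^bsub>A\<^esub> (u g) \<in> e ` carrier Ms"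
  shows "(\<Oplus>\<^bsub>RA.MsX.T\<^esub>g \<in> S. ten B Ms (regular A)
      (inv_into (carrier Ms) e ((a g \<odot>\<^bsub>Mts\<^esub> e f) \<triangleleft>\<^bsub>Mts\<^esub> inv\<^bsub>A\<^esub> (u g))) (u g)) =
    RA.\<tau> ((\<Oplus>\<^bsub>A'\<^esub>g \<in> S. a g) \<odot>\<^bsub>Mts\<^esub> e f) \<one>\<^bsub>A\<^esub>" (is "?l = _")
proof -
  let ?y = "\<lambda>g. inv_into (carrier Ms) e ((a g \<odot>\<^bsub>Mts\<^esub> e f) \<triangleleft>\<^bsub>Mts\<^esub> inv\<^bsub>A\<^esub> (u g))"
  have "ten B Ms (regular A) (?y g) (u g) = RA.\<tau> (a g \<odot>\<^bsub>Mts\<^esub> e f) \<one>\<^bsub>A\<^esub>" if g: "g \<in> S" for g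
  proof -
    have y: "?y g \<in> carrier Ms" "e (?y g) = (a g \<odot>\<^bsub>Mts\<^esub> e f) \<triangleleft>\<^bsub>Mts\<^esub> inv\<^bsub>A\<^esub> (u g)"
      by (rule inv_into_into[OF im[OF g]]) (rule f_inv_into_f[OF im[OF g]])
    have uA: "u g \<in> carrier A" "inv\<^bsub>A\<^esub> (u g) \<in> carrier A" "inv\<^bsub>A\<^esub> (u g) \<otimes>\<^bsub>A\<^esub> u g = \<one>\<^bsub>A\<^esub>"
      using u[OF g] by (simp_all add: Mt.R.Units_l_inv Mt.R.Units_closed)
    have "ten B Ms (regular A) (?y g) (u g) = RA.\<tau> (e (?y g)) (u g)"
      by (rule RA.\<tau>_e[symmetric]) (simp_all add: y(1) uA)
    also have "\<dots> = RA.\<tau> (a g \<odot>\<^bsub>Mts\<^esub> e f) (inv\<^bsub>A\<^esub> (u g) \<otimes>\<^bsub>A\<^esub> u g)"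
      unfolding y(2) using RA.\<tau>_mult[of "a g \<odot>\<^bsub>Mts\<^esub> e f" "inv\<^bsub>A\<^esub> (u g)" "u g"] uA a[OF g] f
      by (simp add: cl)
    finally show ?thesis by (simp only: uA(3))
  qed
  then have "?l = (\<Oplus>\<^bsub>RA.MsX.T\<^esub>g \<in> S. RA.\<tau> (a g \<odot>\<^bsub>Mts\<^esub> e f) \<one>\<^bsub>A\<^esub>)"
    using RA.\<tau>_in[of _ "\<one>\<^bsub>A\<^esub>"] by (intro RA.MsX.T.finsum_cong') (simp_all add: a f cl)
  also have "\<dots> = RA.\<tau> ((\<Oplus>\<^bsub>A'\<^esub>g \<in> S. a g) \<odot>\<^bsub>Mts\<^esub> e f) \<one>\<^bsub>A\<^esub>"
    by (rule add_hom_finsum[OF add_hom_comp[OF Mts.lact_hom_l RA.\<tau>_hom_l]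
          Mt.S.abelian_group_axioms RA.MsX.T_abelian, symmetric])
      (simp_all add: a f cl)
  finally show ?thesis .
qed

lemma gamma_like_beta_U:
  assumes \<beta>: "beta_like \<beta>"
  shows "gamma_like (beta_U B A B' A' Ms U \<beta>)"
proof -
  have \<beta>h: "\<beta> \<in> add_hom r.PQ.T RA.MsX.T"
    and \<beta>t: "\<And>a f. a \<in> carrier A' \<Longrightarrow> f \<in> carrier Ms \<Longrightarrow>
      \<beta> (ten B' (regular A') Ms a f) = RA.\<tau> (a \<odot>\<^bsub>Mts\<^esub> e f) \<one>\<^bsub>A\<^esub>"
    using \<beta> by (simp_all add: beta_like_def)
  \<comment> \<open>Right linearity over \<open>B\<close> is what makes
    \<open>\<beta> \<otimes> id\<close> well defined.\<close>
  have \<beta>m: "\<beta> (s \<triangleleft>\<^bsub>tensor_bimod B' (regular A') Ms\<^esub> b) = \<beta> s \<triangleleft>\<^bsub>tensor_bimod B Ms (regular A)\<^esub> b"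
    if s: "s \<in> carrier r.PQ.T" and b: "b \<in> K" for s b
  proof (rule r.PQ.hom_eqI[OF add_hom_comp[OF r.PQ.rsmult_hom \<beta>h] add_hom_comp[OF \<beta>h l.PQ.rsmult_hom] s])
    fix a f assume af: "a \<in> carrier (regular A')" "f \<in> carrier Ms"
    then have t: "a \<odot>\<^bsub>Mts\<^esub> e f \<in> carrier Mts" by (simp add: cl)
    have "\<beta> (ten B' (regular A') Ms a f \<triangleleft>\<^bsub>tensor_bimod B' (regular A') Ms\<^esub> b) = RA.\<tau> ((a \<odot>\<^bsub>Mts\<^esub> e f) \<triangleleft>\<^bsub>Mts\<^esub> b) \<one>\<^bsub>A\<^esub>"
      using af b by (simp add: r.PQ.rsmult_ten \<beta>t cl e_r Mts.lact_ract)
    also have "\<dots> = RA.\<tau> (a \<odot>\<^bsub>Mts\<^esub> e f) \<one>\<^bsub>A\<^esub> \<triangleleft>\<^bsub>tensor_bimod B Ms (regular A)\<^esub> b"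
      using RA.\<tau>_mult[OF t K_in[OF b], of "\<one>\<^bsub>A\<^esub>"] b by (simp add: RA_\<tau>_rsmult[OF t one_in b] K_in)
    finally show "\<beta> (ten B' (regular A') Ms a f \<triangleleft>\<^bsub>tensor_bimod B' (regular A') Ms\<^esub> b) =
        \<beta> (ten B' (regular A') Ms a f) \<triangleleft>\<^bsub>tensor_bimod B Ms (regular A)\<^esub> b"
      using af by (simp add: \<beta>t)
  qed (simp_all add: b)
  let ?h = "\<lambda>x u. ten B (tensor_bimod B Ms (regular A)) U (\<beta> x) u"
  have \<beta>in: "\<beta> s \<in> carrier (tensor_bimod B Ms (regular A))" if "s \<in> carrier r.PQ.T" for s
    using add_hom_closed[OF \<beta>h that] by simp
  have bal: "balanced B (tensor_bimod B' (regular A') Ms) U l.PQ_Z.T ?h"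
  proof (rule balancedI, goal_cases)
    case (1 x y) then show ?case using l.PQ_Z.ten_closed \<beta>in by simp
  next
    case (2 x x' y)
    then show ?case using l.PQ_Z.ten_add_l[of "\<beta> x" "\<beta> x'" y] \<beta>in by (simp add: add_hom_add[OF \<beta>h])
  next
    case (3 x y y') then show ?case using l.PQ_Z.ten_add_r[of "\<beta> x" y y'] \<beta>in by simp
  next
    case (4 x b y) then show ?case using l.PQ_Z.ten_balanced[of "\<beta> x" b y] \<beta>in by (simp add: \<beta>m)
  qed
  define k where "k = tensor_map B (tensor_bimod B' (regular A') Ms) U (tensor_bimod B Ms (regular A)) U \<beta> (\<lambda>x. x)"
  have k: "k \<in> add_hom r.PQ_Z.T l.PQ_Z.T"
    unfolding k_def tensor_map_def by (rule r.PQ_Z.lift_hom[OF l.PQ_Z.T_abelian bal])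
  have kt: "k (ten B (tensor_bimod B' (regular A') Ms) U s u) = ?h s u" if "s \<in> carrier r.PQ.T" "u \<in> carrier U" for s u
    unfolding k_def tensor_map_def using r.PQ_Z.lift_ten[OF l.PQ_Z.T_abelian bal, of s u] that by simp
  let ?i = "inv_into (carrier r.PQ_Z.T) (tensor_assoc B' B (regular A') Ms U)"
  have i: "?i \<in> add_hom r.P_QZ.T r.PQ_Z.T"
    by (rule add_hom_inv_into[OF r.assoc_hom r.assoc_bij r.PQ_Z.T_abelian])
  have eq: "beta_U B A B' A' Ms U \<beta> = (\<lambda>d. tensor_assoc B B Ms (regular A) U (k (?i d)))"
    by (simp add: beta_U_def k_def fun_eq_iff)
  show ?thesis
    unfolding gamma_like_def eq
  proof (intro conjI ballI)
    show "(\<lambda>d. tensor_assoc B B Ms (regular A) U (k (?i d))) \<in> add_hom r.P_QZ.T XU.MsX.T"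
      by (rule add_hom_comp[OF add_hom_comp[OF i k] l.assoc_hom])
    fix a f u assume a: "a \<in> carrier A'" and f: "f \<in> carrier Ms" and u: "u \<in> carrier U"
    then have ar: "a \<in> carrier (regular A')" by simp
    have tb: "ten B' (regular A') Ms a f \<in> carrier (tensor_bimod B' (regular A') Ms)"
      using r.PQ.ten_closed[OF ar f] by simp
    have t: "a \<odot>\<^bsub>Mts\<^esub> e f \<in> carrier Mts" using a f by (simp add: cl)
    \<comment> \<open>The chosen inverse is evaluated by exhibiting a preimage under the
      associativity map; injectivity makes it the chosen one.\<close>
    have "?i (t' a (tU f u)) = ten B (tensor_bimod B' (regular A') Ms) U (ten B' (regular A') Ms a f) u"
      unfolding r.assoc_ten[OF ar f u, symmetric]
      by (rule bij_betw_inv_into_left[OF r.assoc_bij r.PQ_Z.ten_closed[OF tb u]])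
    \<comment> \<open>On right multiples of \<open>e f\<close> by \<open>a\<close> both sides are
      the triple tensor of \<open>f\<close>, \<open>a\<close> and \<open>u\<close>, and such
      multiples span \<open>Mts\<close>.\<close>
    moreover have "tensor_assoc B B Ms (regular A) U (ten B (tensor_bimod B Ms (regular A)) U (RA.\<tau> s \<one>\<^bsub>A\<^esub>) u) =
        XU.\<tau> s (tA \<one>\<^bsub>A\<^esub> u)" if s: "s \<in> carrier Mts" for s
    proof -
      have h: "(\<lambda>s. RA.\<tau> s \<one>\<^bsub>A\<^esub>) \<in> add_hom Mts (tensor_bimod B Ms (regular A))"
        using RA.\<tau>_hom_l[of "\<one>\<^bsub>A\<^esub>"] by (simp add: add_hom_cong[of Mts Mts "tensor_bimod B Ms (regular A)" RA.MsX.T])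
      show ?thesis
      proof (rule Mts_hom_eqI_right[OF add_hom_comp[OF add_hom_comp[OF h l.PQ_Z.ten_hom_l[OF u]] l.assoc_hom]
            XU.\<tau>_hom_l XU.MsX.T_abelian s])
        show "tA \<one>\<^bsub>A\<^esub> u \<in> carrier N" using tA_in[OF one_in u] by simp
        fix a f assume a: "a \<in> carrier A" and f: "f \<in> carrier Ms"
        have "RA.\<tau> (e f \<triangleleft>\<^bsub>Mts\<^esub> a) \<one>\<^bsub>A\<^esub> = ten B Ms (regular A) f a"
          using RA.\<tau>_mult[OF e_in[OF f] a, of "\<one>\<^bsub>A\<^esub>"] RA.\<tau>_e[OF f, of a] a by simp
        then show "tensor_assoc B B Ms (regular A) U
            (ten B (tensor_bimod B Ms (regular A)) U (RA.\<tau> (e f \<triangleleft>\<^bsub>Mts\<^esub> a) \<one>\<^bsub>A\<^esub>) u) =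
          XU.\<tau> (e f \<triangleleft>\<^bsub>Mts\<^esub> a) (tA \<one>\<^bsub>A\<^esub> u)"
          using l.assoc_ten[of f a u] a f u by (simp add: \<tau>_e_mult)
      qed
    qed
    ultimately show "tensor_assoc B B Ms (regular A) U (k (?i (t' a (tU f u)))) = XU.\<tau> (a \<odot>\<^bsub>Mts\<^esub> e f) (tA \<one>\<^bsub>A\<^esub> u)"
      using tb t u a f by (simp add: kt \<beta>t)
  qed
qed

end

section \<open>Gradings\<close>

text \<open>Components of induced gradings are generated subgroups, so the degree of an image is
  controlled on generators.\<close>

lemma add_hom_generate:
  assumes "x \<in> generate (add_monoid M) S" "f \<in> add_hom M N" "abelian_group M" "abelian_group N"
    and "subgroup H (add_monoid N)" "S \<subseteq> carrier M" "\<And>s. s \<in> S \<Longrightarrow> f s \<in> H"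
  shows "f x \<in> H"
proof -
  interpret H: subgroup H "add_monoid N" by (rule assms(5))
  have M: "group (add_monoid M)" by (rule abelian_group.a_group[OF assms(3)])
  have c: "y \<in> carrier M" if "y \<in> generate (add_monoid M) S" for y
    using group.generate_in_carrier[OF M _ that] assms(6) by simp
  show ?thesis using assms(1)
  proof (induction rule: generate.induct)
    case one then show ?case using add_hom_zero[OF assms(2-4)] H.one_closed by simp
  next
    case (incl h) then show ?case by (rule assms(7))
  next
    case (inv h)
    then have "f (\<ominus>\<^bsub>M\<^esub> h) = \<ominus>\<^bsub>N\<^esub> f h" using assms(6) by (intro add_hom_minus[OF assms(2-4)]) blast
    then show ?case using H.m_inv_closed[OF assms(7)[OF inv]] by (simp add: a_inv_def)
  next
    case (eng h1 h2)
    then show ?case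
      using add_hom_add[OF assms(2) c[OF eng.hyps(1)] c[OF eng.hyps(2)]] H.m_closed by simp
  qed
qed

lemma (in abelian_group) subgroup_finsum:
  assumes "subgroup H (add_monoid G)" "\<And>i. i \<in> I \<Longrightarrow> a i \<in> H"
  shows "(\<Oplus>i\<in>I. a i) \<in> H"
proof -
  interpret H: subgroup H "add_monoid G" by (rule assms(1))
  have c: "H \<subseteq> carrier G" using H.subset by simp
  show ?thesis using assms(2)
  proof (induction I rule: infinite_finite_induct)
    case (insert i I)
    then have "a \<in> I \<rightarrow> carrier G" "a i \<in> carrier G" using c by auto
    then show ?case using insert H.m_closed by (simp add: finsum_insert)
  qed (use H.one_closed in simp_all)
qed

text \<open>Serves to concatenate two finite families into one in \<open>Z_family\<close>.\<close>

lemma (in abelian_group) finsum_split_nat: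
  assumes "\<And>i. f i \<in> carrier G"
  shows "(\<Oplus>i\<in>{..<k + l::nat}. f i) = (\<Oplus>i\<in>{..<k}. f i) \<oplus> (\<Oplus>i\<in>{..<l}. f (k + i))"
proof (induction l)
  case (Suc l)
  have "(\<Oplus>i\<in>{..<k + Suc l}. f i) = f (k + l) \<oplus> (\<Oplus>i\<in>{..<k + l}. f i)"
    using assms by (simp add: lessThan_Suc finsum_insert)
  moreover have "(\<Oplus>i\<in>{..<Suc l}. f (k + i)) = f (k + l) \<oplus> (\<Oplus>i\<in>{..<l}. f (k + i))"
    using assms by (simp add: lessThan_Suc finsum_insert)
  ultimately show ?case using Suc.IH assms by (simp add: a_ac)
qed (use assms in simp)

locale graded = M: abelian_group M
  for G :: "('g, 'w) monoid_scheme" and M :: "('m, 'x) ring_scheme" and Mc :: "'g \<Rightarrow> 'm set" +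
  assumes finite_G: "finite (carrier G)" and graded: "graded_group G M Mc"
begin

lemma Mc_subgroup: "g \<in> carrier G \<Longrightarrow> subgroup (Mc g) (add_monoid M)"
  using graded by (simp add: graded_group_def)

lemma Mc_in: "g \<in> carrier G \<Longrightarrow> x \<in> Mc g \<Longrightarrow> x \<in> carrier M"
  using subgroup.subset[OF Mc_subgroup] by auto

lemma Mc_zero: "g \<in> carrier G \<Longrightarrow> \<zero>\<^bsub>M\<^esub> \<in> Mc g"
  using subgroup.one_closed[OF Mc_subgroup] by simp

lemma Mc_add: "g \<in> carrier G \<Longrightarrow> x \<in> Mc g \<Longrightarrow> y \<in> Mc g \<Longrightarrow> x \<oplus>\<^bsub>M\<^esub> y \<in> Mc g"
  using subgroup.m_closed[OF Mc_subgroup] by simp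

lemma component:
  assumes "x \<in> carrier M"
  shows "component G M Mc x \<in> (\<Pi>\<^sub>E g \<in> carrier G. Mc g)"
    and "x = (\<Oplus>\<^bsub>M\<^esub>g \<in> carrier G. component G M Mc x g)"
proof -
  have "\<exists>!d. d \<in> (\<Pi>\<^sub>E g \<in> carrier G. Mc g) \<and> x = (\<Oplus>\<^bsub>M\<^esub>g \<in> carrier G. d g)"
    using graded assms by (simp add: graded_group_def)
  from theI'[OF this]
  show "component G M Mc x \<in> (\<Pi>\<^sub>E g \<in> carrier G. Mc g)"
    "x = (\<Oplus>\<^bsub>M\<^esub>g \<in> carrier G. component G M Mc x g)"
    unfolding component_def by blast+
qed

lemma component_in: "x \<in> carrier M \<Longrightarrow> g \<in> carrier G \<Longrightarrow> component G M Mc x g \<in> Mc g"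
  using component(1) by (rule PiE_mem)

lemma component_eqI:
  assumes d: "\<And>g. g \<in> carrier G \<Longrightarrow> d g \<in> Mc g" and x: "x = (\<Oplus>\<^bsub>M\<^esub>g \<in> carrier G. d g)" and g: "g \<in> carrier G"
  shows "component G M Mc x g = d g"
proof -
  \<comment> \<open>\<open>graded_group\<close> asserts uniqueness among extensional families, so
    \<open>d\<close> is cut down to the group first.\<close>
  let ?d = "restrict d (carrier G)"
  have dM: "d \<in> carrier G \<rightarrow> carrier M" using d Mc_in by blast
  have xM: "x \<in> carrier M" unfolding x using dM by (rule M.finsum_closed)
  have "?d \<in> (\<Pi>\<^sub>E g \<in> carrier G. Mc g) \<and> x = (\<Oplus>\<^bsub>M\<^esub>g \<in> carrier G. ?d g)"
    unfolding x using d dM by (auto intro!: M.finsum_cong')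
  moreover have "\<exists>!d. d \<in> (\<Pi>\<^sub>E g \<in> carrier G. Mc g) \<and> x = (\<Oplus>\<^bsub>M\<^esub>g \<in> carrier G. d g)"
    using graded xM by (simp add: graded_group_def)
  ultimately have "component G M Mc x = ?d"
    using component[OF xM] by (metis (no_types, lifting))
  then show ?thesis using g by simp
qed

lemma component_homogeneous:
  assumes h: "h \<in> carrier G" and x: "x \<in> Mc h" and g: "g \<in> carrier G"
  shows "component G M Mc x g = (if g = h then x else \<zero>\<^bsub>M\<^esub>)"
proof (rule component_eqI[OF _ _ g])
  show "x = (\<Oplus>\<^bsub>M\<^esub>g \<in> carrier G. if g = h then x else \<zero>\<^bsub>M\<^esub>)"
    using M.finsum_singleton[OF h finite_G, of "\<lambda>_. x"] Mc_in[OF h x] by (simp add: eq_commute)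
qed (use x Mc_zero in auto)

lemma component_hom: "g \<in> carrier G \<Longrightarrow> (\<lambda>x. component G M Mc x g) \<in> add_hom M M"
proof (rule add_homI)
  fix x y assume g: "g \<in> carrier G" and xy: "x \<in> carrier M" "y \<in> carrier M"
  show "component G M Mc (x \<oplus>\<^bsub>M\<^esub> y) g = component G M Mc x g \<oplus>\<^bsub>M\<^esub> component G M Mc y g"
  proof (rule component_eqI[OF _ _ g])
    have "(\<Oplus>\<^bsub>M\<^esub>g \<in> carrier G. component G M Mc x g \<oplus>\<^bsub>M\<^esub> component G M Mc y g) =
        (\<Oplus>\<^bsub>M\<^esub>g \<in> carrier G. component G M Mc x g) \<oplus>\<^bsub>M\<^esub> (\<Oplus>\<^bsub>M\<^esub>g \<in> carrier G. component G M Mc y g)"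
      using xy component_in Mc_in by (intro M.finsum_addf) blast+
    then show "x \<oplus>\<^bsub>M\<^esub> y = (\<Oplus>\<^bsub>M\<^esub>g \<in> carrier G. component G M Mc x g \<oplus>\<^bsub>M\<^esub> component G M Mc y g)"
      using component(2)[OF xy(1)] component(2)[OF xy(2)] by simp
  qed (use xy in \<open>simp add: Mc_add component_in\<close>)
qed (rule Mc_in, assumption, rule component_in)

end

text \<open>When 1 is expanded as \<open>u\<close> times the components of its inverse, only the
  component of degree inverse to \<open>g\<close> contributes in degree one. That component is a
  right inverse of the unit \<open>u\<close>, hence equal to its inverse.\<close>

lemma graded_algebra_inv:
  assumes G: "group G" "finite (carrier G)" and A: "ring A" "graded_group G A Ac"
    and mult: "\<And>g h a b. g \<in> carrier G \<Longrightarrow> h \<in> carrier G \<Longrightarrow> a \<in> Ac g \<Longrightarrow> b \<in> Ac h \<Longrightarrow> a \<otimes>\<^bsub>A\<^esub> b \<in> Ac (g \<otimes>\<^bsub>G\<^esub> h)"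
    and one: "\<one>\<^bsub>A\<^esub> \<in> Ac \<one>\<^bsub>G\<^esub>" and g: "g \<in> carrier G" and u: "u \<in> Ac g \<inter> Units A"
  shows "inv\<^bsub>A\<^esub> u \<in> Ac (inv\<^bsub>G\<^esub> g)"
proof -
  interpret G: group G by (rule G)
  interpret A: ring A by (rule A)
  interpret gr: graded G A Ac by unfold_locales (rule G(2), rule A(2))
  let ?c = "component G A Ac (inv\<^bsub>A\<^esub> u)"
  have uA: "u \<in> carrier A" "inv\<^bsub>A\<^esub> u \<in> carrier A" "u \<otimes>\<^bsub>A\<^esub> inv\<^bsub>A\<^esub> u = \<one>\<^bsub>A\<^esub>" "inv\<^bsub>A\<^esub> u \<otimes>\<^bsub>A\<^esub> u = \<one>\<^bsub>A\<^esub>"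
    using u by (simp_all add: A.Units_closed A.Units_r_inv A.Units_l_inv)
  have c: "?c h \<in> Ac h" "?c h \<in> carrier A" if "h \<in> carrier G" for h
    using gr.component_in[OF uA(2) that] gr.Mc_in[OF that] by blast+
  \<comment> \<open>Translation by the inverse of \<open>g\<close> reindexes the sum so that the
    summand at index \<open>h\<close> has degree \<open>h\<close>, as \<open>component_eqI\<close>
    expects.\<close>
  have inj: "inj_on (\<lambda>h. inv\<^bsub>G\<^esub> g \<otimes>\<^bsub>G\<^esub> h) (carrier G)"
    using g by (intro inj_onI) simp
  have img: "(\<lambda>h. inv\<^bsub>G\<^esub> g \<otimes>\<^bsub>G\<^esub> h) ` carrier G = carrier G"
  proof (intro equalityI subsetI)
    fix k assume k: "k \<in> carrier G"
    then have "k = inv\<^bsub>G\<^esub> g \<otimes>\<^bsub>G\<^esub> (g \<otimes>\<^bsub>G\<^esub> k)" using g by (simp add: G.m_assoc[symmetric])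
    then show "k \<in> (\<lambda>h. inv\<^bsub>G\<^esub> g \<otimes>\<^bsub>G\<^esub> h) ` carrier G" using g k by blast
  qed (use g in auto)
  have "\<one>\<^bsub>A\<^esub> = u \<otimes>\<^bsub>A\<^esub> (\<Oplus>\<^bsub>A\<^esub>h \<in> carrier G. ?c h)"
    using gr.component(2)[OF uA(2)] uA(3) by simp
  also have "\<dots> = (\<Oplus>\<^bsub>A\<^esub>h \<in> carrier G. u \<otimes>\<^bsub>A\<^esub> ?c h)"
    using uA c by (intro A.finsum_rdistr G(2)) auto
  also have "\<dots> = (\<Oplus>\<^bsub>A\<^esub>h \<in> (\<lambda>h. inv\<^bsub>G\<^esub> g \<otimes>\<^bsub>G\<^esub> h) ` carrier G. u \<otimes>\<^bsub>A\<^esub> ?c h)"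
    by (simp only: img)
  also have "\<dots> = (\<Oplus>\<^bsub>A\<^esub>h \<in> carrier G. u \<otimes>\<^bsub>A\<^esub> ?c (inv\<^bsub>G\<^esub> g \<otimes>\<^bsub>G\<^esub> h))"
    using uA c g by (intro A.finsum_reindex inj) auto
  finally have s: "\<one>\<^bsub>A\<^esub> = \<dots>" .
  have "component G A Ac \<one>\<^bsub>A\<^esub> \<one>\<^bsub>G\<^esub> = u \<otimes>\<^bsub>A\<^esub> ?c (inv\<^bsub>G\<^esub> g \<otimes>\<^bsub>G\<^esub> \<one>\<^bsub>G\<^esub>)"
  proof (rule gr.component_eqI[OF _ s])
    fix h assume h: "h \<in> carrier G"
    have "u \<otimes>\<^bsub>A\<^esub> ?c (inv\<^bsub>G\<^esub> g \<otimes>\<^bsub>G\<^esub> h) \<in> Ac (g \<otimes>\<^bsub>G\<^esub> (inv\<^bsub>G\<^esub> g \<otimes>\<^bsub>G\<^esub> h))"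
      using u g h c by (intro mult) auto
    then show "u \<otimes>\<^bsub>A\<^esub> ?c (inv\<^bsub>G\<^esub> g \<otimes>\<^bsub>G\<^esub> h) \<in> Ac h"
      using g h by (simp add: G.m_assoc[symmetric])
  qed simp
  then have "u \<otimes>\<^bsub>A\<^esub> ?c (inv\<^bsub>G\<^esub> g) = \<one>\<^bsub>A\<^esub>"
    using gr.component_homogeneous[OF G.one_closed one G.one_closed] g by simp
  then have "inv\<^bsub>A\<^esub> u = ?c (inv\<^bsub>G\<^esub> g)"
    using uA c(2)[of "inv\<^bsub>G\<^esub> g"] g
    by (metis A.m_assoc A.l_one A.r_one G.inv_closed)
  then show ?thesis using c(1)[of "inv\<^bsub>G\<^esub> g"] g by simp
qed

section \<open>Graded Morita equivalences\<close>

text \<open>The derived objects are parameters constrained by equations, so that the names of the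
  final statement can be substituted for them directly.\<close>

locale graded_morita = G: group G
  for G :: "'g monoid" +
  fixes \<O> :: "'o ring"
    and A :: "('o, 'a) module" and Ac :: "'g \<Rightarrow> 'a set"
    and A' :: "('o, 'b) module" and Ac' :: "'g \<Rightarrow> 'b set"
    and u :: "'g \<Rightarrow> 'a" and M :: "('a, 'm, 'b) bimod"
    and ract :: "('a \<times> 'm \<Rightarrow>\<^sub>0 int) set \<Rightarrow> 'b \<Rightarrow> ('a \<times> 'm \<Rightarrow>\<^sub>0 int) set"
    and J :: "'j set" and mj :: "'j \<Rightarrow> 'm" and mj' :: "'j \<Rightarrow> 'm \<Rightarrow> 'a"
    and \<phi> :: "(((('a \<times> 'm \<Rightarrow>\<^sub>0 int) set \<Rightarrow> 'a) \<times> ('a \<times> 'm \<Rightarrow>\<^sub>0 int) set) \<Rightarrow>\<^sub>0 int) set \<Rightarrow> 'b"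
    and \<psi> :: "((('a \<times> 'm \<Rightarrow>\<^sub>0 int) set \<times> (('a \<times> 'm \<Rightarrow>\<^sub>0 int) set \<Rightarrow> 'a)) \<Rightarrow>\<^sub>0 int) set \<Rightarrow> 'a"
    and K K' B B' Ms Mt Mtc Mts Mtsc \<iota> e
  assumes K: "K = Ac \<one>\<^bsub>G\<^esub>" and K': "K' = Ac' \<one>\<^bsub>G\<^esub>"
    and B: "B = A\<lparr>carrier := K\<rparr>" and B': "B' = A'\<lparr>carrier := K'\<rparr>"
    and Ms: "Ms = dual B M"
    and Mt: "Mt = (tensor_bimod B (regular A) M)\<lparr>rsmult := ract\<rparr>"
    and Mtc: "Mtc = induced_grading B A Ac M"
    and Mts: "Mts = dual A Mt" and Mtsc: "Mtsc = dual_grading G A Ac Mt Mtc"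
    and \<iota>: "\<iota> = id_embed B A M" and e: "e = id_embed_dual B A M"
    and finite_G: "finite (carrier G)"
    and cp: "crossed_product \<O> G A Ac" and cp': "crossed_product \<O> G A' Ac'"
    and u: "\<And>g. g \<in> carrier G \<Longrightarrow> u g \<in> Ac g \<inter> Units A"
    and bim: "algebra_bimodule \<O> B B' M"
    and \<iota>_ract: "\<And>m b'. m \<in> carrier M \<Longrightarrow> b' \<in> carrier B' \<Longrightarrow> \<iota> m \<triangleleft>\<^bsub>Mt\<^esub> b' = \<iota> (m \<triangleleft>\<^bsub>M\<^esub> b')"
    and gme: "graded_Morita_equivalence \<O> G A Ac A' Ac' Mt Mtc"
    and \<phi>: "\<phi> \<in> graded_bimodule_iso G A' A'
           (tensor_bimod A Mts Mt) (tensor_grading G A Mts Mtsc Mt Mtc) (regular A') Ac'"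
    and \<psi>: "\<psi> \<in> graded_bimodule_iso G A A
           (tensor_bimod A' Mt Mts) (tensor_grading G A' Mt Mtc Mts Mtsc) (regular A) Ac"
    and \<phi>\<psi>: "\<And>x' x y'. x' \<in> carrier Mts \<Longrightarrow> x \<in> carrier Mt \<Longrightarrow> y' \<in> carrier Mts \<Longrightarrow>
           \<phi> (ten A Mts Mt x' x) \<odot>\<^bsub>Mts\<^esub> y' = x' \<triangleleft>\<^bsub>Mts\<^esub> \<psi> (ten A' Mt Mts x y')"
    and finite_J: "finite J"
    and mj: "\<And>j. j \<in> J \<Longrightarrow> mj j \<in> carrier M" and mj': "\<And>j. j \<in> J \<Longrightarrow> mj' j \<in> carrier Ms"
    and sum_J: "\<phi> (\<Oplus>\<^bsub>tensor_ab A Mts Mt\<^esub>j \<in> J. ten A Mts Mt (e (mj' j)) (\<iota> (mj j))) = \<one>\<^bsub>A'\<^esub>"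
begin

lemma Mt_graded_bimodule: "graded_bimodule \<O> G A Ac A' Ac' Mt Mtc"
  using gme by (simp add: graded_Morita_equivalence_def)

lemma algebra: "assoc_algebra \<O> A" and algebra': "assoc_algebra \<O> A'"
  using cp cp' by (simp_all add: crossed_product_def graded_algebra_def)

lemma ring_A: "ring A" and ring_A': "ring A'"
  using algebra algebra' by (simp_all add: assoc_algebra_def)

lemma bimodule_M: "bimodule B B' M"
  using bim by (simp add: algebra_bimodule_def)

lemma left_module_M: "left_module B M"
  using bimodule_M by (simp add: bimodule_def)

lemma ring_B: "ring B" and ring_B': "ring B'"
  using bimodule_M by (simp_all add: bimodule_def left_module_def)

lemma bimodule_Mt: "bimodule A A' Mt"
  using Mt_graded_bimodule by (simp add: graded_bimodule_def algebra_bimodule_def)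

lemma bimodule_Mts: "bimodule A' A Mts"
  unfolding Mts by (rule dual_bimodule[OF bimodule_Mt])

lemma bimodule_Ms: "bimodule B' B Ms"
  unfolding Ms by (rule dual_bimodule[OF bimodule_M])

lemma graded_A: "graded_group G A Ac" and graded_A': "graded_group G A' Ac'"
  and graded_Mt: "graded_group G Mt Mtc"
  using cp cp' Mt_graded_bimodule
  by (simp_all add: crossed_product_def graded_algebra_def graded_bimodule_def)

sublocale A: ring A by (rule ring_A)
sublocale A': ring A' by (rule ring_A')
sublocale gA: graded G A Ac by unfold_locales (rule finite_G, rule graded_A)
sublocale gA': graded G A' Ac' by unfold_locales (rule finite_G, rule graded_A')
sublocale M: bimodule B B' M by (rule bimodule_M)
sublocale Mt: bimodule A A' Mt by (rule bimodule_Mt)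
sublocale Mts: bimodule A' A Mts by (rule bimodule_Mts)
sublocale Ms: bimodule B' B Ms by (rule bimodule_Ms)
sublocale gMt: graded G Mt Mtc by unfold_locales (rule finite_G, rule graded_Mt)

lemma carrier_B [simp]: "carrier B = K" and carrier_B' [simp]: "carrier B' = K'"
  by (simp_all add: B B')

lemma K_in: "b \<in> K \<Longrightarrow> b \<in> carrier A" and K'_in: "b' \<in> K' \<Longrightarrow> b' \<in> carrier A'"
  using gA.Mc_in[OF G.one_closed] gA'.Mc_in[OF G.one_closed] by (simp_all add: K K')

lemma one_in_K: "\<one>\<^bsub>A\<^esub> \<in> K" and one_in_K': "\<one>\<^bsub>A'\<^esub> \<in> K'"
  using ring.ring_simprules(6)[OF ring_B] ring.ring_simprules(6)[OF ring_B'] by (simp_all add: B B')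

lemma Ac_mult: "\<lbrakk>g \<in> carrier G; h \<in> carrier G; a \<in> Ac g; b \<in> Ac h\<rbrakk> \<Longrightarrow> a \<otimes>\<^bsub>A\<^esub> b \<in> Ac (g \<otimes>\<^bsub>G\<^esub> h)"
  and Ac'_mult: "\<lbrakk>g \<in> carrier G; h \<in> carrier G; a' \<in> Ac' g; b' \<in> Ac' h\<rbrakk> \<Longrightarrow> a' \<otimes>\<^bsub>A'\<^esub> b' \<in> Ac' (g \<otimes>\<^bsub>G\<^esub> h)"
  using cp cp' by (simp_all add: crossed_product_def graded_algebra_def)

lemma Mtc_ract: "\<lbrakk>g \<in> carrier G; h \<in> carrier G; x \<in> Mtc g; a' \<in> Ac' h\<rbrakk> \<Longrightarrow> x \<triangleleft>\<^bsub>Mt\<^esub> a' \<in> Mtc (g \<otimes>\<^bsub>G\<^esub> h)"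
  using Mt_graded_bimodule by (simp add: graded_bimodule_def)

lemma u_inv: "g \<in> carrier G \<Longrightarrow> inv\<^bsub>A\<^esub> (u g) \<in> Ac (inv\<^bsub>G\<^esub> g)"
  using one_in_K unfolding K
  by (intro graded_algebra_inv[OF G.group_axioms finite_G ring_A graded_A] u Ac_mult)

text \<open>Inserting \<open>v w = 1\<close> shifts degrees across a tensor over \<open>A'\<close>
  without changing the tensor.\<close>

lemma homogeneous_unit':
  assumes g: "g \<in> carrier G"
  obtains v w where "v \<in> Ac' g" "w \<in> Ac' (inv\<^bsub>G\<^esub> g)" "v \<otimes>\<^bsub>A'\<^esub> w = \<one>\<^bsub>A'\<^esub>"
proof -
  obtain v where v: "v \<in> Ac' g \<inter> Units A'"
    using cp' g by (auto simp: crossed_product_def)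
  have "inv\<^bsub>A'\<^esub> v \<in> Ac' (inv\<^bsub>G\<^esub> g)"
    using one_in_K' unfolding K'
    by (intro graded_algebra_inv[OF G.group_axioms finite_G ring_A' graded_A'] v Ac'_mult g)
  with v show ?thesis by (intro that[of v "inv\<^bsub>A'\<^esub> v"]) (simp_all add: A'.Units_r_inv)
qed

sublocale AM: tensor_module A B "regular A" M
  using regular_bimodule[OF ring_A, of "carrier A" K] ring_A ring_B K_in
  by (intro tensor_module.intro left_module_M) (auto simp: B)

lemma Mt_simps [simp]:
  "carrier Mt = carrier AM.T" "ring.add Mt = ring.add AM.T" "\<zero>\<^bsub>Mt\<^esub> = \<zero>\<^bsub>AM.T\<^esub>"
  "module.smult Mt = module.smult (tensor_lmod B (regular A) M)"
  by (simp_all add: Mt)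

abbreviation "t \<equiv> ten B (regular A) M"

lemma \<iota>_t: "\<iota> m = t \<one>\<^bsub>A\<^esub> m"
  by (simp add: \<iota> id_embed_def)

lemma \<iota>_in: "m \<in> carrier M \<Longrightarrow> \<iota> m \<in> carrier Mt"
  using AM.ten_closed[of "\<one>\<^bsub>A\<^esub>" m] by (simp add: \<iota>_t)

lemma smult_t: "\<lbrakk>a \<in> carrier A; b \<in> carrier A; m \<in> carrier M\<rbrakk> \<Longrightarrow> a \<odot>\<^bsub>Mt\<^esub> t b m = t (a \<otimes>\<^bsub>A\<^esub> b) m"
  using AM.smult_ten by simp

lemma smult_\<iota>: "\<lbrakk>a \<in> carrier A; m \<in> carrier M\<rbrakk> \<Longrightarrow> a \<odot>\<^bsub>Mt\<^esub> \<iota> m = t a m"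
  using smult_t[of a "\<one>\<^bsub>A\<^esub>" m] unfolding \<iota>_t by simp

lemma Mtc_alt: "Mtc g = generate (add_monoid AM.T) {t a m | a m. a \<in> Ac g \<and> m \<in> carrier M}"
  by (simp add: Mtc induced_grading_def)

lemma \<iota>_Mtc: "m \<in> carrier M \<Longrightarrow> \<iota> m \<in> Mtc \<one>\<^bsub>G\<^esub>"
  unfolding Mtc_alt \<iota>_t using one_in_K K by (intro generate.incl) blast

lemma Mts_in: "s \<in> carrier Mts \<longleftrightarrow> s \<in> linear_maps A Mt (regular A)"
  by (simp add: Mts)

lemma Ms_in: "f \<in> carrier Ms \<longleftrightarrow> f \<in> linear_maps B M (regular B)"
  by (simp add: Ms)

lemma Mts_D:
  assumes "s \<in> carrier Mts"
  shows "s \<in> add_hom AM.T A" "\<And>x. x \<in> carrier Mt \<Longrightarrow> s x \<in> carrier A"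
    "\<And>a x. a \<in> carrier A \<Longrightarrow> x \<in> carrier Mt \<Longrightarrow> s (a \<odot>\<^bsub>Mt\<^esub> x) = a \<otimes>\<^bsub>A\<^esub> s x"
  using linear_mapsD[OF assms[unfolded Mts_in]]
  by (simp_all add: add_hom_cong[of Mt AM.T "regular A" A])

lemma Ms_D:
  assumes "f \<in> carrier Ms"
  shows "\<And>m. m \<in> carrier M \<Longrightarrow> f m \<in> K"
    "\<And>m m'. m \<in> carrier M \<Longrightarrow> m' \<in> carrier M \<Longrightarrow> f (m \<oplus>\<^bsub>M\<^esub> m') = f m \<oplus>\<^bsub>A\<^esub> f m'"
    "\<And>b m. b \<in> K \<Longrightarrow> m \<in> carrier M \<Longrightarrow> f (b \<odot>\<^bsub>M\<^esub> m) = b \<otimes>\<^bsub>A\<^esub> f m"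
  using linear_mapsD[OF assms[unfolded Ms_in]] by (simp_all add: B)

text \<open>The elements \<open>\<iota> m\<close> generate \<open>Mt\<close> over \<open>A\<close>,
  and both maps are \<open>A\<close>-linear.\<close>

lemma Mts_eqI:
  assumes s: "s \<in> carrier Mts" and s': "s' \<in> carrier Mts"
    and eq: "\<And>m. m \<in> carrier M \<Longrightarrow> s (\<iota> m) = s' (\<iota> m)"
  shows "s = s'"
proof (rule linear_maps_eqI[OF s[unfolded Mts_in] s'[unfolded Mts_in]])
  fix x assume "x \<in> carrier Mt"
  then have x: "x \<in> carrier AM.T" by simp
  show "s x = s' x"
  proof (rule AM.hom_eqI[OF Mts_D(1)[OF s] Mts_D(1)[OF s'] x])
    fix a m assume "a \<in> carrier (regular A)" and m: "m \<in> carrier M"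
    then have a: "a \<in> carrier A" by simp
    show "s (t a m) = s' (t a m)"
      unfolding smult_\<iota>[OF a m, symmetric] Mts_D(3)[OF s a \<iota>_in[OF m]] Mts_D(3)[OF s' a \<iota>_in[OF m]] eq[OF m] ..
  qed
qed

lemma e_balanced:
  assumes f: "f \<in> carrier Ms"
  shows "balanced B (regular A) M A (\<lambda>a m. a \<otimes>\<^bsub>A\<^esub> f m)"
  by (rule balancedI) (simp_all add: Ms_D[OF f] K_in A.l_distr A.r_distr A.m_assoc)

lemma e_t: "\<lbrakk>f \<in> carrier Ms; a \<in> carrier A; m \<in> carrier M\<rbrakk> \<Longrightarrow> e f (t a m) = a \<otimes>\<^bsub>A\<^esub> f m"
  using AM.lift_ten[OF A.abelian_group_axioms e_balanced] by (simp add: e id_embed_dual_def)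

lemma e_in:
  assumes f: "f \<in> carrier Ms" shows "e f \<in> carrier Mts"
  unfolding Mts_in
proof (rule linear_mapsI)
  have h: "e f \<in> add_hom AM.T A"
    using AM.lift_hom[OF A.abelian_group_axioms e_balanced[OF f]] by (simp add: e id_embed_dual_def)
  then show "e f \<in> add_hom Mt (regular A)" by (simp add: add_hom_cong[of Mt AM.T "regular A" A])
  show "e f \<in> extensional (carrier Mt)"
    using AM.lift_ext[OF A.abelian_group_axioms e_balanced[OF f]] by (simp add: e id_embed_dual_def)
  fix a x assume a: "a \<in> carrier A" and "x \<in> carrier Mt"
  then have x: "x \<in> carrier AM.T" by simp
  have ha: "(\<lambda>b. a \<otimes>\<^bsub>A\<^esub> b) \<in> add_hom A A" using a by (intro add_homI) (simp_all add: A.r_distr)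
  have "e f (a \<odot>\<^bsub>tensor_lmod B (regular A) M\<^esub> x) = a \<otimes>\<^bsub>A\<^esub> e f x"
    by (rule AM.hom_eqI[OF add_hom_comp[OF AM.smult_hom[OF a] h] add_hom_comp[OF h ha] x])
      (simp add: AM.smult_ten a e_t f Ms_D(1)[OF f] K_in A.m_assoc)
  then show "e f (a \<odot>\<^bsub>Mt\<^esub> x) = a \<odot>\<^bsub>regular A\<^esub> e f x" by simp
qed

lemma e_\<iota>: "\<lbrakk>f \<in> carrier Ms; m \<in> carrier M\<rbrakk> \<Longrightarrow> e f (\<iota> m) = f m"
  by (simp add: \<iota>_t e_t Ms_D(1) K_in)

lemma Mts_lact: "\<lbrakk>s \<in> carrier Mts; a' \<in> carrier A'; x \<in> carrier Mt\<rbrakk> \<Longrightarrow> (a' \<odot>\<^bsub>Mts\<^esub> s) x = s (x \<triangleleft>\<^bsub>Mt\<^esub> a')"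
  by (simp add: Mts)

lemma Mts_ract: "\<lbrakk>s \<in> carrier Mts; a \<in> carrier A; x \<in> carrier Mt\<rbrakk> \<Longrightarrow> (s \<triangleleft>\<^bsub>Mts\<^esub> a) x = s x \<otimes>\<^bsub>A\<^esub> a"
  by (simp add: Mts)

lemma Mts_add: "\<lbrakk>s \<in> carrier Mts; s' \<in> carrier Mts; x \<in> carrier Mt\<rbrakk> \<Longrightarrow> (s \<oplus>\<^bsub>Mts\<^esub> s') x = s x \<oplus>\<^bsub>A\<^esub> s' x"
  by (simp add: Mts)

lemma e_hom: "e \<in> add_hom Ms Mts"
proof (rule add_homI)
  fix f g assume fg: "f \<in> carrier Ms" "g \<in> carrier Ms"
  show "e (f \<oplus>\<^bsub>Ms\<^esub> g) = e f \<oplus>\<^bsub>Mts\<^esub> e g"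
  proof (rule Mts_eqI)
    fix m assume m: "m \<in> carrier M"
    have "e (f \<oplus>\<^bsub>Ms\<^esub> g) (\<iota> m) = (f \<oplus>\<^bsub>Ms\<^esub> g) m" by (rule e_\<iota>[OF Ms.M.a_closed[OF fg] m])
    also have "\<dots> = f m \<oplus>\<^bsub>A\<^esub> g m" using m by (simp add: Ms B)
    also have "\<dots> = (e f \<oplus>\<^bsub>Mts\<^esub> e g) (\<iota> m)"
      using fg m by (simp only: Mts_add e_in \<iota>_in e_\<iota>)
    finally show "e (f \<oplus>\<^bsub>Ms\<^esub> g) (\<iota> m) = (e f \<oplus>\<^bsub>Mts\<^esub> e g) (\<iota> m)" .
  qed (use fg in \<open>simp_all only: e_in Ms.M.a_closed Mts.M.a_closed\<close>)
qed (rule e_in)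

lemma e_inj: "inj_on e (carrier Ms)"
proof (rule inj_onI)
  fix f g assume f: "f \<in> carrier Ms" and g: "g \<in> carrier Ms" and eq: "e f = e g"
  show "f = g"
  proof (rule linear_maps_eqI[OF f[unfolded Ms_in] g[unfolded Ms_in]])
    fix m assume m: "m \<in> carrier M"
    show "f m = g m" using e_\<iota>[OF f m] e_\<iota>[OF g m] by (simp only: eq)
  qed
qed

text \<open>The right action on \<open>Mt\<close> is the parameter \<open>ract\<close>;
  \<open>\<iota>_ract\<close> ties it to the action of \<open>B'\<close> on \<open>M\<close>, which
  is how \<open>B'\<close> acts on \<open>Ms\<close>.\<close>

lemma e_l:
  assumes b: "b \<in> K'" and f: "f \<in> carrier Ms"
  shows "e (b \<odot>\<^bsub>Ms\<^esub> f) = b \<odot>\<^bsub>Mts\<^esub> e f"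
proof (rule Mts_eqI)
  have bf: "b \<odot>\<^bsub>Ms\<^esub> f \<in> carrier Ms" by (rule Ms.lact_closed) (simp_all add: b f)
  then show "e (b \<odot>\<^bsub>Ms\<^esub> f) \<in> carrier Mts" by (rule e_in)
  show "b \<odot>\<^bsub>Mts\<^esub> e f \<in> carrier Mts" by (rule Mts.lact_closed[OF K'_in[OF b] e_in[OF f]])
  fix m assume m: "m \<in> carrier M"
  have b': "b \<in> carrier B'" using b by simp
  have "e (b \<odot>\<^bsub>Ms\<^esub> f) (\<iota> m) = f (m \<triangleleft>\<^bsub>M\<^esub> b)"
    unfolding e_\<iota>[OF bf m] using m by (simp add: Ms)
  also have "\<dots> = e f (\<iota> m \<triangleleft>\<^bsub>Mt\<^esub> b)"
    unfolding \<iota>_ract[OF m b'] by (rule e_\<iota>[OF f M.ract_closed[OF m b'], symmetric])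
  also have "\<dots> = (b \<odot>\<^bsub>Mts\<^esub> e f) (\<iota> m)"
    by (rule Mts_lact[OF e_in[OF f] K'_in[OF b] \<iota>_in[OF m], symmetric])
  finally show "e (b \<odot>\<^bsub>Ms\<^esub> f) (\<iota> m) = (b \<odot>\<^bsub>Mts\<^esub> e f) (\<iota> m)" .
qed

lemma e_r:
  assumes b: "b \<in> K" and f: "f \<in> carrier Ms"
  shows "e (f \<triangleleft>\<^bsub>Ms\<^esub> b) = e f \<triangleleft>\<^bsub>Mts\<^esub> b"
proof (rule Mts_eqI)
  have bf: "f \<triangleleft>\<^bsub>Ms\<^esub> b \<in> carrier Ms" by (rule Ms.ract_closed) (simp_all add: b f)
  then show "e (f \<triangleleft>\<^bsub>Ms\<^esub> b) \<in> carrier Mts" by (rule e_in)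
  show "e f \<triangleleft>\<^bsub>Mts\<^esub> b \<in> carrier Mts" by (rule Mts.ract_closed[OF e_in[OF f] K_in[OF b]])
  fix m assume m: "m \<in> carrier M"
  show "e (f \<triangleleft>\<^bsub>Ms\<^esub> b) (\<iota> m) = (e f \<triangleleft>\<^bsub>Mts\<^esub> b) (\<iota> m)"
    unfolding e_\<iota>[OF bf m] Mts_ract[OF e_in[OF f] K_in[OF b] \<iota>_in[OF m]] e_\<iota>[OF f m]
    using m by (simp add: Ms B)
qed

text \<open>Composing \<open>s\<close> with \<open>\<iota>\<close> gives a \<open>B\<close>-linear
  map into \<open>K\<close>. Its extension by \<open>e\<close> agrees with \<open>s\<close> on the
  generators \<open>\<iota> m\<close>.\<close>

lemma e_image:
  assumes s: "s \<in> carrier Mts" and sK: "\<And>m. m \<in> carrier M \<Longrightarrow> s (\<iota> m) \<in> K"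
  shows "s \<in> e ` carrier Ms"
proof -
  let ?f = "\<lambda>m \<in> carrier M. s (\<iota> m)"
  have f: "?f \<in> carrier Ms"
    unfolding Ms_in
  proof (rule linear_maps_restrict)
    show "abelian_group M" by (rule M.M.abelian_group_axioms)
    have "(\<lambda>m. \<iota> m) \<in> add_hom M AM.T"
      unfolding \<iota>_t by (rule AM.ten_hom_r) simp
    note h = add_hom_comp[OF this Mts_D(1)[OF s]]
    show "(\<lambda>m. s (\<iota> m)) \<in> add_hom M (regular B)"
      using add_hom_add[OF h] by (intro add_homI) (simp_all add: sK, simp add: B)
  next
    fix b m assume b: "b \<in> carrier B" and m: "m \<in> carrier M"
    then have bK: "b \<in> K" "b \<in> carrier A" by (simp_all add: K_in)
    show "b \<odot>\<^bsub>M\<^esub> m \<in> carrier M" by (rule M.lact_closed[OF b m])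
    have "\<iota> (b \<odot>\<^bsub>M\<^esub> m) = b \<odot>\<^bsub>Mt\<^esub> \<iota> m"
      using AM.ten_balanced[of "\<one>\<^bsub>A\<^esub>" b m] b m smult_\<iota>[OF bK(2) m] bK by (simp add: \<iota>_t)
    then show "s (\<iota> (b \<odot>\<^bsub>M\<^esub> m)) = b \<odot>\<^bsub>regular B\<^esub> s (\<iota> m)"
      using Mts_D(3)[OF s bK(2) \<iota>_in[OF m]] by (simp add: B)
  qed
  have "e ?f = s"
    by (rule Mts_eqI[OF e_in[OF f] s]) (use e_\<iota>[OF f] in simp)
  with f show ?thesis by (intro image_eqI[of s e ?f]) simp_all
qed

lemma e_Mtc:
  assumes f: "f \<in> carrier Ms" and g: "g \<in> carrier G" and x: "x \<in> Mtc g"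
  shows "e f x \<in> Ac g"
proof (rule add_hom_generate[OF x[unfolded Mtc_alt] Mts_D(1)[OF e_in[OF f]] AM.T_abelian
      A.abelian_group_axioms gA.Mc_subgroup[OF g]])
  show "{t a m |a m. a \<in> Ac g \<and> m \<in> carrier M} \<subseteq> carrier AM.T"
    using AM.ten_closed gA.Mc_in[OF g] by auto
  fix s assume "s \<in> {t a m |a m. a \<in> Ac g \<and> m \<in> carrier M}"
  then obtain a m where am: "s = t a m" "a \<in> Ac g" "m \<in> carrier M" by blast
  have "e f s = a \<otimes>\<^bsub>A\<^esub> f m" unfolding am(1) by (rule e_t[OF f gA.Mc_in[OF g am(2)] am(3)])
  also have "\<dots> \<in> Ac (g \<otimes>\<^bsub>G\<^esub> \<one>\<^bsub>G\<^esub>)"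
    by (rule Ac_mult[OF g G.one_closed am(2)]) (use Ms_D(1)[OF f am(3)] K in simp)
  finally show "e f s \<in> Ac g" using g by simp
qed

lemma e_Mtsc: "f \<in> carrier Ms \<Longrightarrow> e f \<in> Mtsc \<one>\<^bsub>G\<^esub>"
  using e_in e_Mtc by (simp add: Mtsc dual_grading_def Mts[symmetric] image_subset_iff)

text \<open>The degrees multiply to the identity, so values at \<open>\<iota> m\<close> fall into
  \<open>K\<close> and \<open>e_image\<close> applies. This gives meaning to \<open>inv_into\<close>
  in \<open>beta\<close> and drives the regrouping in \<open>q_homogeneous_in_Z\<close>.\<close>

lemma e_image_degree:
  assumes f: "f \<in> carrier Ms" and g: "g \<in> carrier G" and h: "h \<in> carrier G" and gh: "g \<otimes>\<^bsub>G\<^esub> h = \<one>\<^bsub>G\<^esub>"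
    and a': "a' \<in> Ac' g" and a: "a \<in> Ac h"
  shows "(a' \<odot>\<^bsub>Mts\<^esub> e f) \<triangleleft>\<^bsub>Mts\<^esub> a \<in> e ` carrier Ms"
proof (rule e_image)
  have aA: "a \<in> carrier A" "a' \<in> carrier A'" by (rule gA.Mc_in[OF h a], rule gA'.Mc_in[OF g a'])
  have s: "a' \<odot>\<^bsub>Mts\<^esub> e f \<in> carrier Mts" by (rule Mts.lact_closed[OF aA(2) e_in[OF f]])
  then show "(a' \<odot>\<^bsub>Mts\<^esub> e f) \<triangleleft>\<^bsub>Mts\<^esub> a \<in> carrier Mts" using aA(1) by (rule Mts.ract_closed)
  fix m assume m: "m \<in> carrier M"
  have "((a' \<odot>\<^bsub>Mts\<^esub> e f) \<triangleleft>\<^bsub>Mts\<^esub> a) (\<iota> m) = e f (\<iota> m \<triangleleft>\<^bsub>Mt\<^esub> a') \<otimes>\<^bsub>A\<^esub> a"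
    unfolding Mts_ract[OF s aA(1) \<iota>_in[OF m]] Mts_lact[OF e_in[OF f] aA(2) \<iota>_in[OF m]] ..
  also have "\<iota> m \<triangleleft>\<^bsub>Mt\<^esub> a' \<in> Mtc g"
    using Mtc_ract[OF G.one_closed g \<iota>_Mtc[OF m] a'] g by simp
  from Ac_mult[OF g h e_Mtc[OF f g this] a]
  have "e f (\<iota> m \<triangleleft>\<^bsub>Mt\<^esub> a') \<otimes>\<^bsub>A\<^esub> a \<in> K" by (simp add: gh K)
  finally show "((a' \<odot>\<^bsub>Mts\<^esub> e f) \<triangleleft>\<^bsub>Mts\<^esub> a) (\<iota> m) \<in> K" .
qed

section \<open>The pairings given by the two bimodule isomorphisms\<close>

sublocale TL: tensor_bimodule A' A A' Mts Mt
  by (rule tensor_bimodule.intro) (rule bimodule_Mts, rule bimodule_Mt)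

sublocale TR: tensor_bimodule A A' A Mt Mts
  by (rule tensor_bimodule.intro) (rule bimodule_Mt, rule bimodule_Mts)

definition p where "p s x = \<phi> (ten A Mts Mt s x)"
definition q where "q x s = \<psi> (ten A' Mt Mts x s)"

lemma \<phi>_hom: "\<phi> \<in> add_hom TL.T A'" and \<psi>_hom: "\<psi> \<in> add_hom TR.T A"
proof -
  have "\<phi> \<in> add_hom (tensor_bimod A Mts Mt) (regular A')" "\<psi> \<in> add_hom (tensor_bimod A' Mt Mts) (regular A)"
    using \<phi> \<psi> unfolding graded_bimodule_iso_def add_hom_def by blast+
  then show "\<phi> \<in> add_hom TL.T A'" "\<psi> \<in> add_hom TR.T A"
    by (simp_all add: add_hom_cong[of "tensor_bimod A Mts Mt" TL.T "regular A'" A']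
        add_hom_cong[of "tensor_bimod A' Mt Mts" TR.T "regular A" A])
qed

lemma p_bal: "balanced A Mts Mt A' p"
  unfolding p_def by (rule balanced_comp[OF TL.balanced_ten \<phi>_hom])

lemma q_bal: "balanced A' Mt Mts A q"
  unfolding q_def by (rule balanced_comp[OF TR.balanced_ten \<psi>_hom])

lemma p_l: "\<lbrakk>b \<in> carrier A'; s \<in> carrier Mts; x \<in> carrier Mt\<rbrakk> \<Longrightarrow> p (b \<odot>\<^bsub>Mts\<^esub> s) x = b \<otimes>\<^bsub>A'\<^esub> p s x"
  and p_r: "\<lbrakk>b \<in> carrier A'; s \<in> carrier Mts; x \<in> carrier Mt\<rbrakk> \<Longrightarrow> p s (x \<triangleleft>\<^bsub>Mt\<^esub> b) = p s x \<otimes>\<^bsub>A'\<^esub> b"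
proof -
  have "\<forall>a\<in>carrier A'. \<forall>x\<in>carrier TL.T. \<phi> (a \<odot>\<^bsub>tensor_lmod A Mts Mt\<^esub> x) = a \<otimes>\<^bsub>A'\<^esub> \<phi> x"
    and "\<forall>a\<in>carrier A'. \<forall>x\<in>carrier TL.T. \<phi> (x \<triangleleft>\<^bsub>tensor_bimod A Mts Mt\<^esub> a) = \<phi> x \<otimes>\<^bsub>A'\<^esub> a"
    using \<phi> by (simp_all add: graded_bimodule_iso_def)
  then show "\<lbrakk>b \<in> carrier A'; s \<in> carrier Mts; x \<in> carrier Mt\<rbrakk> \<Longrightarrow> p (b \<odot>\<^bsub>Mts\<^esub> s) x = b \<otimes>\<^bsub>A'\<^esub> p s x"
    and "\<lbrakk>b \<in> carrier A'; s \<in> carrier Mts; x \<in> carrier Mt\<rbrakk> \<Longrightarrow> p s (x \<triangleleft>\<^bsub>Mt\<^esub> b) = p s x \<otimes>\<^bsub>A'\<^esub> b"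
    by (simp_all only: p_def TL.smult_ten[symmetric] TL.rsmult_ten[symmetric] TL.ten_closed)
qed

lemma q_r: "\<lbrakk>a \<in> carrier A; s \<in> carrier Mts; x \<in> carrier Mt\<rbrakk> \<Longrightarrow> q x (s \<triangleleft>\<^bsub>Mts\<^esub> a) = q x s \<otimes>\<^bsub>A\<^esub> a"
proof -
  have "\<forall>a\<in>carrier A. \<forall>x\<in>carrier TR.T. \<psi> (x \<triangleleft>\<^bsub>tensor_bimod A' Mt Mts\<^esub> a) = \<psi> x \<otimes>\<^bsub>A\<^esub> a"
    using \<psi> by (simp add: graded_bimodule_iso_def)
  then show "\<lbrakk>a \<in> carrier A; s \<in> carrier Mts; x \<in> carrier Mt\<rbrakk> \<Longrightarrow> q x (s \<triangleleft>\<^bsub>Mts\<^esub> a) = q x s \<otimes>\<^bsub>A\<^esub> a"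
    by (simp only: q_def TR.rsmult_ten[symmetric] TR.ten_closed)
qed

text \<open>\<open>e f\<close> has degree one in the dual, so its tensor with \<open>x\<close> has
  the degree of \<open>x\<close>, and \<open>\<psi>\<close> preserves degrees.\<close>

lemma q_Ac:
  assumes g: "g \<in> carrier G" and x: "x \<in> Mtc g" and f: "f \<in> carrier Ms"
  shows "q x (e f) \<in> Ac g"
proof -
  have "ten A' Mt Mts x (e f) \<in> tensor_grading G A' Mt Mtc Mts Mtsc g"
    unfolding tensor_grading_def
    using g x e_Mtsc[OF f] G.r_one[OF g] by (intro generate.incl) blast
  moreover have "\<psi> ` tensor_grading G A' Mt Mtc Mts Mtsc g \<subseteq> Ac g"
    using \<psi> g unfolding graded_bimodule_iso_def by blast
  ultimately show ?thesis unfolding q_def by blast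
qed

lemma p_Ac':
  assumes g: "g \<in> carrier G" and x: "x \<in> Mtc g" and f: "f \<in> carrier Ms"
  shows "p (e f) x \<in> Ac' g"
proof -
  have "ten A Mts Mt (e f) x \<in> tensor_grading G A Mts Mtsc Mt Mtc g"
    unfolding tensor_grading_def
    using g x e_Mtsc[OF f] G.l_one[OF g] by (intro generate.incl) blast
  moreover have "\<phi> ` tensor_grading G A Mts Mtsc Mt Mtc g \<subseteq> Ac' g"
    using \<phi> g unfolding graded_bimodule_iso_def by blast
  ultimately show ?thesis unfolding p_def by blast
qed

lemma sum_J': "(\<Oplus>\<^bsub>A'\<^esub>j \<in> J. p (e (mj' j)) (\<iota> (mj j))) = \<one>\<^bsub>A'\<^esub>"
  unfolding p_def sum_J[symmetric]
  by (rule add_hom_finsum[OF \<phi>_hom TL.T_abelian A'.abelian_group_axioms, symmetric])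
    (rule TL.ten_closed[OF e_in[OF mj'] \<iota>_in[OF mj]])

end

section \<open>Existence of the second dual family\<close>

context graded_morita
begin

text \<open>
  The family \<open>n_i, n_i^*\<close> is read off from \<open>1 \<in> Z\<close>, which holds because \<open>\<psi>\<close> is onto and because the
  component of degree \<open>1\<close> of each value of \<open>q\<close> lies in \<open>Z\<close>.
\<close>

definition Z where
  "Z = generate (add_monoid A) {q x (e f) | x f. x \<in> Mtc \<one>\<^bsub>G\<^esub> \<and> f \<in> carrier Ms}"

lemma Mtc_in: "g \<in> carrier G \<Longrightarrow> x \<in> Mtc g \<Longrightarrow> x \<in> carrier Mt"
  by (rule gMt.Mc_in)

lemma q_in: "x \<in> carrier Mt \<Longrightarrow> s \<in> carrier Mts \<Longrightarrow> q x s \<in> carrier A"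
  by (rule balancedD(1)[OF q_bal])

lemma Z_subgroup: "subgroup Z (add_monoid A)"
  unfolding Z_def
  by (rule group.generate_is_subgroup[OF A.a_group])
    (use q_in[OF Mtc_in[OF G.one_closed] e_in] in auto)

lemma Z_finsum: "(\<And>i. i \<in> I \<Longrightarrow> a i \<in> Z) \<Longrightarrow> (\<Oplus>\<^bsub>A\<^esub>i\<in>I. a i) \<in> Z"
  by (rule A.subgroup_finsum[OF Z_subgroup])

lemma Z_zero: "\<zero>\<^bsub>A\<^esub> \<in> Z" and Z_add: "a \<in> Z \<Longrightarrow> b \<in> Z \<Longrightarrow> a \<oplus>\<^bsub>A\<^esub> b \<in> Z"
  using subgroup.one_closed[OF Z_subgroup] subgroup.m_closed[OF Z_subgroup] by simp_all

text \<open>The value is homogeneous of degree \<open>g h\<close>, so its component in degree one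
  vanishes unless the degrees are inverse to each other. In that case the two arguments are
  regrouped into degree one each.\<close>

lemma q_homogeneous_in_Z:
  assumes g: "g \<in> carrier G" and h: "h \<in> carrier G" and x: "x \<in> Mtc g" and a: "a \<in> Ac h" and f: "f \<in> carrier Ms"
  shows "component G A Ac (q x (e f \<triangleleft>\<^bsub>Mts\<^esub> a)) \<one>\<^bsub>G\<^esub> \<in> Z"
proof -
  have c: "x \<in> carrier Mt" "a \<in> carrier A" by (rule Mtc_in[OF g x], rule gA.Mc_in[OF h a])
  have gh: "g \<otimes>\<^bsub>G\<^esub> h \<in> carrier G" using g h by simp
  have qA: "q x (e f \<triangleleft>\<^bsub>Mts\<^esub> a) \<in> Ac (g \<otimes>\<^bsub>G\<^esub> h)"
    unfolding q_r[OF c(2) e_in[OF f] c(1)] by (rule Ac_mult[OF g h q_Ac[OF g x f] a])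
  note comp = gA.component_homogeneous[OF gh qA G.one_closed]
  show ?thesis
  proof (cases "g \<otimes>\<^bsub>G\<^esub> h = \<one>\<^bsub>G\<^esub>")
    case False
    then show ?thesis using comp Z_zero by simp
  next
    case True
    \<comment> \<open>Inserting \<open>v w = 1\<close> moves the degree \<open>h\<close> onto
      \<open>x\<close>: then \<open>x v\<close> has degree one, while \<open>w\<close> times
      \<open>e f\<close> times \<open>a\<close> lies in the image of \<open>e\<close> by
      \<open>e_image_degree\<close>.\<close>
    obtain v w where v: "v \<in> Ac' h" and w: "w \<in> Ac' (inv\<^bsub>G\<^esub> h)" and vw: "v \<otimes>\<^bsub>A'\<^esub> w = \<one>\<^bsub>A'\<^esub>"
      using homogeneous_unit'[OF h] .
    have h': "inv\<^bsub>G\<^esub> h \<in> carrier G" using h by simp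
    have vA: "v \<in> carrier A'" "w \<in> carrier A'" by (rule gA'.Mc_in[OF h v], rule gA'.Mc_in[OF h' w])
    have we: "w \<odot>\<^bsub>Mts\<^esub> e f \<in> carrier Mts" by (rule Mts.lact_closed[OF vA(2) e_in[OF f]])
    have "(w \<odot>\<^bsub>Mts\<^esub> e f) \<triangleleft>\<^bsub>Mts\<^esub> a \<in> e ` carrier Ms"
      by (rule e_image_degree[OF f h' h _ w a]) (use h in simp)
    then obtain f' where f': "f' \<in> carrier Ms" "e f' = (w \<odot>\<^bsub>Mts\<^esub> e f) \<triangleleft>\<^bsub>Mts\<^esub> a" by (elim imageE) simp
    have "v \<odot>\<^bsub>Mts\<^esub> e f' = (v \<otimes>\<^bsub>A'\<^esub> w) \<odot>\<^bsub>Mts\<^esub> (e f \<triangleleft>\<^bsub>Mts\<^esub> a)"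
      unfolding f'(2) Mts.lact_ract[OF vA(2) e_in[OF f] c(2)]
      by (rule Mts.lact_assoc[OF vA Mts.ract_closed[OF e_in[OF f] c(2)], symmetric])
    also have "\<dots> = e f \<triangleleft>\<^bsub>Mts\<^esub> a"
      unfolding vw by (rule Mts.lact_one[OF Mts.ract_closed[OF e_in[OF f] c(2)]])
    finally have "q x (e f \<triangleleft>\<^bsub>Mts\<^esub> a) = q (x \<triangleleft>\<^bsub>Mt\<^esub> v) (e f')"
      using balancedD(4)[OF q_bal c(1) vA(1) e_in[OF f'(1)]] by simp
    moreover have "x \<triangleleft>\<^bsub>Mt\<^esub> v \<in> Mtc \<one>\<^bsub>G\<^esub>" using Mtc_ract[OF g h x v] True by simp
    ultimately have "q x (e f \<triangleleft>\<^bsub>Mts\<^esub> a) \<in> Z"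
      unfolding Z_def using f'(1) by (intro generate.incl) blast
    then show ?thesis using comp True by simp
  qed
qed

lemma q_in_Z:
  assumes x: "x \<in> carrier Mt" and s: "s \<in> carrier Mts"
  shows "component G A Ac (q x s) \<one>\<^bsub>G\<^esub> \<in> Z"
proof -
  let ?c = "\<lambda>x s. component G A Ac (q x s) \<one>\<^bsub>G\<^esub>"
  note comp = gA.component_hom[OF G.one_closed]
  have hx: "(\<lambda>x. ?c x s) \<in> add_hom Mt A" if "s \<in> carrier Mts" for s
    by (rule add_hom_comp[OF balanced_hom_l[OF q_bal that] comp])
  have hs: "(\<lambda>s. ?c x s) \<in> add_hom Mts A" if "x \<in> carrier Mt" for x
    by (rule add_hom_comp[OF balanced_hom_r[OF q_bal that] comp])
  \<comment> \<open>The first argument is split by the grading of \<open>Mt\<close>; the next claim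
    splits \<open>a\<close> by the grading of \<open>A\<close>.\<close>
  have 1: "?c x (e f \<triangleleft>\<^bsub>Mts\<^esub> a) \<in> Z"
    if x: "x \<in> carrier Mt" and f: "f \<in> carrier Ms" and h: "h \<in> carrier G" and a: "a \<in> Ac h" for x f h a
  proof -
    have s: "e f \<triangleleft>\<^bsub>Mts\<^esub> a \<in> carrier Mts" by (rule Mts.ract_closed[OF e_in[OF f] gA.Mc_in[OF h a]])
    have "?c (\<Oplus>\<^bsub>Mt\<^esub>g \<in> carrier G. component G Mt Mtc x g) (e f \<triangleleft>\<^bsub>Mts\<^esub> a) =
        (\<Oplus>\<^bsub>A\<^esub>g \<in> carrier G. ?c (component G Mt Mtc x g) (e f \<triangleleft>\<^bsub>Mts\<^esub> a))"
      by (rule add_hom_finsum[OF hx[OF s] Mt.M.abelian_group_axioms A.abelian_group_axioms])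
        (rule Mtc_in[OF _ gMt.component_in[OF x]])
    also have "\<dots> \<in> Z"
      by (rule Z_finsum) (rule q_homogeneous_in_Z[OF _ h gMt.component_in[OF x] a f])
    finally show ?thesis by (simp only: gMt.component(2)[OF x, symmetric])
  qed
  have 2: "?c x (e f \<triangleleft>\<^bsub>Mts\<^esub> a) \<in> Z"
    if x: "x \<in> carrier Mt" and f: "f \<in> carrier Ms" and a: "a \<in> carrier A" for x f a
  proof -
    have "?c x (e f \<triangleleft>\<^bsub>Mts\<^esub> (\<Oplus>\<^bsub>A\<^esub>g \<in> carrier G. component G A Ac a g)) =
        (\<Oplus>\<^bsub>A\<^esub>g \<in> carrier G. ?c x (e f \<triangleleft>\<^bsub>Mts\<^esub> component G A Ac a g))"
      by (rule add_hom_finsum[OF add_hom_comp[OF Mts.ract_hom_r[OF e_in[OF f]] hs[OF x]]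
            A.abelian_group_axioms A.abelian_group_axioms])
        (rule gA.Mc_in[OF _ gA.component_in[OF a]])
    also have "\<dots> \<in> Z"
      by (rule Z_finsum) (rule 1[OF x f _ gA.component_in[OF a]])
    finally show ?thesis by (simp only: gA.component(2)[OF a, symmetric])
  qed
  have p_in: "p s' y \<in> carrier A'" if "s' \<in> carrier Mts" "y \<in> carrier Mt" for s' y
    by (rule balancedD(1)[OF p_bal that])
  \<comment> \<open>The dual is split by the unit in the form \<open>sum_J'\<close>, not by degrees:
    with \<open>\<phi>\<psi>\<close> every \<open>s\<close> becomes a sum of right multiples of
    \<open>e (mj' j)\<close>, which is the form that claim 2 handles.\<close>
  have "s = (\<Oplus>\<^bsub>A'\<^esub>j \<in> J. p (e (mj' j)) (\<iota> (mj j))) \<odot>\<^bsub>Mts\<^esub> s"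
    unfolding sum_J' by (rule Mts.lact_one[OF s, symmetric])
  also have "\<dots> = (\<Oplus>\<^bsub>Mts\<^esub>j \<in> J. p (e (mj' j)) (\<iota> (mj j)) \<odot>\<^bsub>Mts\<^esub> s)"
    by (rule add_hom_finsum[OF Mts.lact_hom_l[OF s] A'.abelian_group_axioms Mts.M.abelian_group_axioms])
      (rule p_in[OF e_in[OF mj'] \<iota>_in[OF mj]])
  finally have "?c x s = ?c x (\<Oplus>\<^bsub>Mts\<^esub>j \<in> J. p (e (mj' j)) (\<iota> (mj j)) \<odot>\<^bsub>Mts\<^esub> s)" by (rule arg_cong)
  also have "\<dots> = (\<Oplus>\<^bsub>A\<^esub>j \<in> J. ?c x (p (e (mj' j)) (\<iota> (mj j)) \<odot>\<^bsub>Mts\<^esub> s))"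
    by (rule add_hom_finsum[OF hs[OF x] Mts.M.abelian_group_axioms A.abelian_group_axioms])
      (rule Mts.lact_closed[OF p_in[OF e_in[OF mj'] \<iota>_in[OF mj]] s])
  also have "\<dots> \<in> Z"
  proof (rule Z_finsum)
    fix j assume j: "j \<in> J"
    have "p (e (mj' j)) (\<iota> (mj j)) \<odot>\<^bsub>Mts\<^esub> s = e (mj' j) \<triangleleft>\<^bsub>Mts\<^esub> q (\<iota> (mj j)) s"
      unfolding p_def q_def by (rule \<phi>\<psi>[OF e_in[OF mj'[OF j]] \<iota>_in[OF mj[OF j]] s])
    then show "?c x (p (e (mj' j)) (\<iota> (mj j)) \<odot>\<^bsub>Mts\<^esub> s) \<in> Z"
      using 2[OF x mj'[OF j] q_in[OF \<iota>_in[OF mj[OF j]] s]] by (simp only:)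
  qed
  finally show ?thesis .
qed

lemma one_in_Z: "\<one>\<^bsub>A\<^esub> \<in> Z"
proof -
  have "bij_betw \<psi> (carrier TR.T) (carrier A)"
    using \<psi> by (simp add: graded_bimodule_iso_def)
  then have "\<one>\<^bsub>A\<^esub> \<in> \<psi> ` carrier TR.T" by (simp add: bij_betw_def)
  then obtain s where s: "s \<in> carrier TR.T" "\<psi> s = \<one>\<^bsub>A\<^esub>" by (elim imageE) simp
  \<comment> \<open>Taking the degree one component after \<open>\<psi>\<close> is additive, so
    induction over a preimage of 1 reduces to simple tensors.\<close>
  note h = add_hom_comp[OF \<psi>_hom gA.component_hom[OF G.one_closed]]
  have "component G A Ac (\<psi> s) \<one>\<^bsub>G\<^esub> \<in> Z" using s(1)
  proof (induction s rule: TR.induct)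
    case (ten x y) then show ?case using q_in_Z by (simp only: q_def)
  next
    case (add s t) then show ?case using add_hom_add[OF h] Z_add by simp
  qed
  then show ?thesis
    using gA.component_homogeneous[OF G.one_closed one_in_K[unfolded K] G.one_closed] by (simp add: s(2))
qed

text \<open>Negatives are absorbed into \<open>x\<close>, so plain sums reach all of
  \<open>Z\<close>. The families are total on the naturals and satisfy their conditions everywhere,
  which makes concatenation free of side conditions.\<close>

lemma Z_family:
  assumes "z \<in> Z"
  shows "\<exists>(k::nat) x f. (\<forall>i. x i \<in> Mtc \<one>\<^bsub>G\<^esub> \<and> f i \<in> carrier Ms) \<and> z = (\<Oplus>\<^bsub>A\<^esub>i \<in> {..<k}. q (x i) (e (f i)))"
  using assms unfolding Z_def
proof (induction rule: generate.induct)
  case one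
  \<comment> \<open>The empty sum; the zero families merely provide values at every index.\<close>
  show ?case
    using gMt.Mc_zero[OF G.one_closed] Ms.M.zero_closed
    by (intro exI[of _ 0] exI[of _ "\<lambda>_. \<zero>\<^bsub>Mt\<^esub>"] exI[of _ "\<lambda>_. \<zero>\<^bsub>Ms\<^esub>"]) simp
next
  case (incl z)
  then obtain x f where xf: "z = q x (e f)" "x \<in> Mtc \<one>\<^bsub>G\<^esub>" "f \<in> carrier Ms" by blast
  show ?case
    using xf q_in[OF Mtc_in[OF G.one_closed xf(2)] e_in[OF xf(3)]]
    by (intro exI[of _ 1] exI[of _ "\<lambda>_. x"] exI[of _ "\<lambda>_. f"]) (simp add: lessThan_Suc)
next
  case (inv z)
  then obtain x f where xf: "z = q x (e f)" "x \<in> Mtc \<one>\<^bsub>G\<^esub>" "f \<in> carrier Ms" by blast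
  have x: "x \<in> carrier Mt" by (rule Mtc_in[OF G.one_closed xf(2)])
  have m: "\<ominus>\<^bsub>Mt\<^esub> x \<in> Mtc \<one>\<^bsub>G\<^esub>"
    using subgroup.m_inv_closed[OF gMt.Mc_subgroup[OF G.one_closed] xf(2)] by (simp add: a_inv_def)
  have "q (\<ominus>\<^bsub>Mt\<^esub> x) (e f) = \<ominus>\<^bsub>A\<^esub> z"
    unfolding xf(1)
    by (rule add_hom_minus[OF balanced_hom_l[OF q_bal e_in[OF xf(3)]] Mt.M.abelian_group_axioms
          A.abelian_group_axioms x])
  then show ?case
    using m xf(3) q_in[OF Mtc_in[OF G.one_closed m] e_in[OF xf(3)]]
    by (intro exI[of _ 1] exI[of _ "\<lambda>_. \<ominus>\<^bsub>Mt\<^esub> x"] exI[of _ "\<lambda>_. f"]) (simp add: lessThan_Suc a_inv_def)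
next
  case (eng z1 z2)
  then obtain k1 :: nat and x1 f1 and k2 :: nat and x2 f2
    where 1: "\<And>i. x1 i \<in> Mtc \<one>\<^bsub>G\<^esub>" "\<And>i. f1 i \<in> carrier Ms" "z1 = (\<Oplus>\<^bsub>A\<^esub>i \<in> {..<k1}. q (x1 i) (e (f1 i)))"
      and 2: "\<And>i. x2 i \<in> Mtc \<one>\<^bsub>G\<^esub>" "\<And>i. f2 i \<in> carrier Ms" "z2 = (\<Oplus>\<^bsub>A\<^esub>i \<in> {..<k2}. q (x2 i) (e (f2 i)))"
    by blast
  \<comment> \<open>Concatenation, with the second family shifted by \<open>k1\<close>.\<close>
  let ?x = "\<lambda>i. if i < k1 then x1 i else x2 (i - k1)" and ?f = "\<lambda>i. if i < k1 then f1 i else f2 (i - k1)"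
  have c: "q (x1 i) (e (f1 i)) \<in> carrier A" "q (x2 i) (e (f2 i)) \<in> carrier A" for i
    by (rule q_in[OF Mtc_in[OF G.one_closed 1(1)] e_in[OF 1(2)]],
        rule q_in[OF Mtc_in[OF G.one_closed 2(1)] e_in[OF 2(2)]])
  then have "q (?x i) (e (?f i)) \<in> carrier A" for i by simp
  from A.finsum_split_nat[of "\<lambda>i. q (?x i) (e (?f i))", OF this, of k1 k2]
  have "(\<Oplus>\<^bsub>A\<^esub>i \<in> {..<k1 + k2}. q (?x i) (e (?f i))) =
      (\<Oplus>\<^bsub>A\<^esub>i \<in> {..<k1}. q (?x i) (e (?f i))) \<oplus>\<^bsub>A\<^esub> z2"
    by (simp add: 2(3))
  also have "(\<Oplus>\<^bsub>A\<^esub>i \<in> {..<k1}. q (?x i) (e (?f i))) = z1"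
    unfolding 1(3) using c by (intro A.finsum_cong') auto
  finally show ?case
    using 1 2 by (intro exI[of _ "k1 + k2"] exI[of _ ?x] exI[of _ ?f]) simp
qed

text \<open>Scalars are central in \<open>A\<close> and \<open>s\<close> is \<open>A\<close>-linear,
  so a scalar on the value moves to the argument. There the bimodule condition on \<open>Mt\<close>
  turns it into the right action, which is the left action on the dual.\<close>

lemma scalar:
  assumes r: "r \<in> carrier \<O>" and s: "s \<in> carrier Mts"
  shows "s \<triangleleft>\<^bsub>Mts\<^esub> (r \<odot>\<^bsub>A\<^esub> \<one>\<^bsub>A\<^esub>) = (r \<odot>\<^bsub>A'\<^esub> \<one>\<^bsub>A'\<^esub>) \<odot>\<^bsub>Mts\<^esub> s"
proof -
  note rA = assoc_algebra.scalar[OF algebra r] and rA' = assoc_algebra.scalar[OF algebra' r]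
  have bim: "(r \<odot>\<^bsub>A\<^esub> \<one>\<^bsub>A\<^esub>) \<odot>\<^bsub>Mt\<^esub> x = x \<triangleleft>\<^bsub>Mt\<^esub> (r \<odot>\<^bsub>A'\<^esub> \<one>\<^bsub>A'\<^esub>)" if "x \<in> carrier Mt" for x
    using Mt_graded_bimodule r that unfolding graded_bimodule_def algebra_bimodule_def by blast
  show ?thesis
  proof (rule linear_maps_eqI)
    show "s \<triangleleft>\<^bsub>Mts\<^esub> (r \<odot>\<^bsub>A\<^esub> \<one>\<^bsub>A\<^esub>) \<in> linear_maps A Mt (regular A)"
      using Mts.ract_closed[OF s rA(1)] by (simp only: Mts_in)
    show "(r \<odot>\<^bsub>A'\<^esub> \<one>\<^bsub>A'\<^esub>) \<odot>\<^bsub>Mts\<^esub> s \<in> linear_maps A Mt (regular A)"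
      using Mts.lact_closed[OF rA'(1) s] by (simp only: Mts_in)
    fix x assume x: "x \<in> carrier Mt"
    show "(s \<triangleleft>\<^bsub>Mts\<^esub> (r \<odot>\<^bsub>A\<^esub> \<one>\<^bsub>A\<^esub>)) x = ((r \<odot>\<^bsub>A'\<^esub> \<one>\<^bsub>A'\<^esub>) \<odot>\<^bsub>Mts\<^esub> s) x"
      unfolding Mts_ract[OF s rA(1) x] Mts_lact[OF s rA'(1) x] bim[OF x, symmetric] Mts_D(3)[OF s rA(1) x]
      by (simp only: rA(2,3) Mts_D(2)[OF s x])
  qed
qed

text \<open>Since \<open>n i\<close> and \<open>\<iota> (mj j)\<close> have degree one,
  \<open>p_Ac'\<close> and \<open>q_Ac\<close> yield the coefficient conditions \<open>p_K\<close>
  and \<open>q_K\<close>; from then on the algebra is ungraded.\<close>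

lemma morita_diagram:
  fixes U :: "('a, 'u) module"
  assumes U: "left_module B U"
  shows "\<exists>(I :: nat set) ns n. morita_diagram A K A' K' Mt Mts Ms e p q J mj' (\<lambda>j. \<iota> (mj j)) I ns n U \<O>"
proof -
  obtain k :: nat and n ns where n: "\<And>i. n i \<in> Mtc \<one>\<^bsub>G\<^esub>" and ns: "\<And>i. ns i \<in> carrier Ms"
    and sum_I: "\<one>\<^bsub>A\<^esub> = (\<Oplus>\<^bsub>A\<^esub>i \<in> {..<k}. q (n i) (e (ns i)))"
    using Z_family[OF one_in_Z] by blast
  have "morita_context A K A' K' Mt Mts Ms e p q J mj' (\<lambda>j. \<iota> (mj j)) {..<k} ns n"
  proof (intro morita_context.intro morita_context_axioms.intro)
    show "bimodule A A' Mt" "bimodule A' A Mts" by (rule bimodule_Mt, rule bimodule_Mts)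
    show "bimodule (A'\<lparr>carrier := K'\<rparr>) (A\<lparr>carrier := K\<rparr>) Ms" using bimodule_Ms by (simp only: B B')
    show "K \<subseteq> carrier A" "K' \<subseteq> carrier A'" by (rule subsetI, erule K_in) (rule subsetI, erule K'_in)
    show "q (\<iota> (mj j)) (e f) \<in> K" if "j \<in> J" "f \<in> carrier Ms" for j f
      unfolding K by (rule q_Ac[OF G.one_closed \<iota>_Mtc[OF mj[OF that(1)]] that(2)])
    show "p (e f) (n i) \<in> K'" if "f \<in> carrier Ms" for i f
      unfolding K' by (rule p_Ac'[OF G.one_closed n that])
    show "n i \<in> carrier Mt" for i by (rule Mtc_in[OF G.one_closed n])
    show "\<iota> (mj j) \<in> carrier Mt" if "j \<in> J" for j by (rule \<iota>_in[OF mj[OF that]])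
    show "p s x \<odot>\<^bsub>Mts\<^esub> s' = s \<triangleleft>\<^bsub>Mts\<^esub> q x s'" if "s \<in> carrier Mts" "x \<in> carrier Mt" "s' \<in> carrier Mts" for s x s'
      unfolding p_def q_def by (rule \<phi>\<psi>[OF that])
  qed (simp_all only: e_hom e_inj e_l e_r p_bal q_bal p_l p_r q_r finite_J mj' ns sum_J' sum_I[symmetric]
      finite_lessThan)
  then have "morita_diagram A K A' K' Mt Mts Ms e p q J mj' (\<lambda>j. \<iota> (mj j)) {..<k} ns n U \<O>"
    using U unfolding B
    by (intro morita_diagram.intro morita_diagram_axioms.intro algebra algebra' scalar)
  then show ?thesis by blast
qed

end

text \<open>\<open>\<phi>\<^sub>2\<close> is compared with \<open>\<phi>\<^sub>C\<close> on the
  carrier only. The closure conditions ensure that results of the operations stay where the two are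
  known to agree.\<close>

lemma algebra_iso_cong:
  assumes f: "f \<in> algebra_iso \<O> R S" and eq: "\<And>x. x \<in> carrier R \<Longrightarrow> g x = f x"
    and "\<And>x y. x \<in> carrier R \<Longrightarrow> y \<in> carrier R \<Longrightarrow> x \<otimes>\<^bsub>R\<^esub> y \<in> carrier R"
    and "\<And>x y. x \<in> carrier R \<Longrightarrow> y \<in> carrier R \<Longrightarrow> x \<oplus>\<^bsub>R\<^esub> y \<in> carrier R"
    and "\<one>\<^bsub>R\<^esub> \<in> carrier R"
    and "\<And>r x. r \<in> carrier \<O> \<Longrightarrow> x \<in> carrier R \<Longrightarrow> r \<odot>\<^bsub>R\<^esub> x \<in> carrier R"
  shows "g \<in> algebra_iso \<O> R S"
proof -
  have "g \<in> ring_hom R S"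
    using f by (intro ring_hom_memI) (auto simp: algebra_iso_def eq assms(3-5) ring_hom_closed
      ring_hom_mult ring_hom_add ring_hom_one)
  moreover have "bij_betw g (carrier R) (carrier S)"
    using f bij_betw_cong[of "carrier R" g f "carrier S"] by (simp add: algebra_iso_def eq)
  ultimately show ?thesis using f by (simp add: algebra_iso_def eq assms(6))
qed

section \<open>Assembly of the diagram\<close>

context graded_morita
begin

lemma diagram:
  fixes U :: "('a, 'u) module"
  assumes U: "left_module B U"
  defines "U' \<equiv> tensor_lmod B Ms U"
  defines "\<phi>\<^sub>1 \<equiv> phi1 B A B' A' Ms U (beta G B A B' A' Ac' u Ms Mts e)"
    and "\<phi>\<^sub>2 \<equiv> phi2 A Mt Mts \<phi> J (\<lambda>j. e (mj' j)) (\<lambda>j. \<iota> (mj j))"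
  shows "left_module B' U'"
    and "\<phi>\<^sub>1 \<in> algebra_iso \<O> (end_op A (tensor_lmod B (regular A) U)) (end_op A' (tensor_lmod B' (regular A') U'))"
    and "\<phi>\<^sub>2 \<in> algebra_iso \<O> (A\<lparr>carrier := centralizer A K\<rparr>) (A'\<lparr>carrier := centralizer A' K'\<rparr>)"
    and "\<And>c. c \<in> centralizer A K \<Longrightarrow> \<phi>\<^sub>1 (theta B A U c) = theta B' A' U' (\<phi>\<^sub>2 c)"
proof -
  obtain I :: "nat set" and ns n
    where "morita_diagram A K A' K' Mt Mts Ms e p q J mj' (\<lambda>j. \<iota> (mj j)) I ns n U \<O>"
    using morita_diagram[OF U] by blast
  then interpret D: morita_diagram A K A' K' Mt Mts Ms e p q J mj' "\<lambda>j. \<iota> (mj j)" I ns n U \<O> .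
  let ?\<beta> = "beta G B A B' A' Ac' u Ms Mts e"
  have "D.beta_like ?\<beta>"
    unfolding beta_def B B'
  proof (rule D.beta_like_lift)
    fix a f assume a: "a \<in> carrier A'" and f: "f \<in> carrier Ms"
    \<comment> \<open>The family is that of the components of \<open>a\<close>, whose sum is
      \<open>a\<close>. The degree of each one cancels against that of the inverse unit, so
      \<open>e_image_degree\<close> applies.\<close>
    note sum = D.beta_sum[where S = "carrier G" and a = "component G A' Ac' a" and u = u, OF f]
    show "(\<Oplus>\<^bsub>D.RA.MsX.T\<^esub>g\<in>carrier G. ten D.B Ms (regular A)
        (inv_into (carrier Ms) e ((component G A' Ac' a g \<odot>\<^bsub>Mts\<^esub> e f) \<triangleleft>\<^bsub>Mts\<^esub> inv\<^bsub>A\<^esub> (u g))) (u g)) =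
      D.RA.\<tau> (a \<odot>\<^bsub>Mts\<^esub> e f) \<one>\<^bsub>A\<^esub>"
    proof (rule trans[OF sum])
      fix g assume g: "g \<in> carrier G"
      show "component G A' Ac' a g \<in> carrier A'" by (rule gA'.Mc_in[OF g gA'.component_in[OF a g]])
      show "u g \<in> Units A" using u[OF g] by blast
      show "(component G A' Ac' a g \<odot>\<^bsub>Mts\<^esub> e f) \<triangleleft>\<^bsub>Mts\<^esub> inv\<^bsub>A\<^esub> (u g) \<in> e ` carrier Ms"
        by (rule e_image_degree[OF f g _ _ gA'.component_in[OF a g] u_inv[OF g]]) (use g in simp_all)
    qed (simp only: gA'.component(2)[OF a, symmetric])
  qed
  then have \<gamma>: "D.gamma_like (beta_U D.B A D.B' A' Ms U ?\<beta>)"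
    by (rule D.gamma_like_beta_U)
  show "left_module B' U'"
    using D.r.QZ.lmod_left_module by (simp only: U'_def B B')
  \<comment> \<open>Both sides have the same body once \<open>\<gamma>\<close> is
    \<open>beta_U\<close>, so they agree as functions on all arguments.\<close>
  have \<phi>\<^sub>1: "\<phi>\<^sub>1 = D.Phi (beta_U D.B A D.B' A' Ms U ?\<beta>)"
    by (rule ext) (simp only: \<phi>\<^sub>1_def phi1_def D.Phi_def[OF \<gamma>[unfolded B B']] Let_def B B')
  show "\<phi>\<^sub>1 \<in> algebra_iso \<O> (end_op A (tensor_lmod B (regular A) U)) (end_op A' (tensor_lmod B' (regular A') U'))"
    using D.Phi_algebra_iso[OF \<gamma>] by (simp only: \<phi>\<^sub>1 U'_def B B')
  have \<phi>\<^sub>2: "\<phi>\<^sub>2 c = D.\<phi>\<^sub>C c" if "c \<in> carrier A" for c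
    unfolding \<phi>\<^sub>2_def phi2_def D.\<phi>\<^sub>C_def p_def
    by (rule add_hom_finsum[OF \<phi>_hom TL.T_abelian A'.abelian_group_axioms])
      (rule TL.ten_closed[OF Mts.ract_closed[OF e_in[OF mj'] that] \<iota>_in[OF mj]])
  show "\<phi>\<^sub>2 \<in> algebra_iso \<O> (A\<lparr>carrier := centralizer A K\<rparr>) (A'\<lparr>carrier := centralizer A' K'\<rparr>)"
  proof (rule algebra_iso_cong[OF D.\<phi>\<^sub>C_algebra_iso])
    show "r \<odot>\<^bsub>A\<lparr>carrier := centralizer A K\<rparr>\<^esub> c \<in> carrier (A\<lparr>carrier := centralizer A K\<rparr>)"
      if r: "r \<in> carrier \<O>" and "c \<in> carrier (A\<lparr>carrier := centralizer A K\<rparr>)" for r c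
    proof -
      have c: "c \<in> centralizer A K" "c \<in> carrier A" using that(2) by (simp_all add: centralizer_def)
      note s = assoc_algebra.scalar[OF algebra r]
      have "r \<odot>\<^bsub>A\<^esub> \<one>\<^bsub>A\<^esub> \<in> centralizer A K" using s K_in by (simp add: centralizer_def)
      from D.centralizer_closed(1)[OF this c(1)] show ?thesis by (simp add: s(2)[OF c(2)])
    qed
  qed (simp_all add: D.centralizer_closed \<phi>\<^sub>2 D.centralizer_in, simp add: centralizer_def K_in)
  show "\<phi>\<^sub>1 (theta B A U c) = theta B' A' U' (\<phi>\<^sub>2 c)" if "c \<in> centralizer A K" for c
    using D.Phi_theta[OF \<gamma> that] by (simp only: \<phi>\<^sub>1 \<phi>\<^sub>2[OF D.centralizer_in[OF that]] U'_def B B')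
qed

end

theorem proposition3p4:
  fixes p :: nat
    and \<K> :: "'q ring" and \<O> :: "'o ring" and k :: "'k ring"
    and G :: "'g monoid"
    and A :: "('o, 'a) module" and Ac :: "'g \<Rightarrow> 'a set"
    and A' :: "('o, 'b) module" and Ac' :: "'g \<Rightarrow> 'b set"
    and u :: "'g \<Rightarrow> 'a"
    and M :: "('a, 'm, 'b) bimod" and U :: "('a, 'u) module"
    and ract :: "('a \<times> 'm \<Rightarrow>\<^sub>0 int) set \<Rightarrow> 'b \<Rightarrow> ('a \<times> 'm \<Rightarrow>\<^sub>0 int) set"
    and J :: "'j set" and mj :: "'j \<Rightarrow> 'm" and mj' :: "'j \<Rightarrow> 'm \<Rightarrow> 'a"
    and \<phi> :: "(((('a \<times> 'm \<Rightarrow>\<^sub>0 int) set \<Rightarrow> 'a) \<times> ('a \<times> 'm \<Rightarrow>\<^sub>0 int) set) \<Rightarrow>\<^sub>0 int) set \<Rightarrow> 'b"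
    and \<psi> :: "((('a \<times> 'm \<Rightarrow>\<^sub>0 int) set \<times> (('a \<times> 'm \<Rightarrow>\<^sub>0 int) set \<Rightarrow> 'a)) \<Rightarrow>\<^sub>0 int) set \<Rightarrow> 'a"
  defines "B \<equiv> identity_component G A Ac"
  defines "B' \<equiv> identity_component G A' Ac'"
  defines "Ms \<equiv> dual B M"
  defines "Mt \<equiv> (tensor_bimod B (regular A) M)\<lparr>rsmult := ract\<rparr>"
  defines "Mtc \<equiv> induced_grading B A Ac M"
  defines "Mts \<equiv> dual A Mt"
  defines "Mtsc \<equiv> dual_grading G A Ac Mt Mtc"
  defines "\<iota> \<equiv> id_embed B A M"
  defines "\<iota>' \<equiv> id_embed_dual B A M"
  defines "U' \<equiv> tensor_lmod B Ms U"
  defines "E \<equiv> end_op A (tensor_lmod B (regular A) U)"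
  defines "E' \<equiv> end_op A' (tensor_lmod B' (regular A') U')"
  defines "C \<equiv> A\<lparr>carrier := centralizer A (carrier B)\<rparr>"
  defines "C' \<equiv> A'\<lparr>carrier := centralizer A' (carrier B')\<rparr>"
  defines "\<theta> \<equiv> theta B A U"
  defines "\<theta>' \<equiv> theta B' A' U'"
  defines "\<phi>\<^sub>1 \<equiv> phi1 B A B' A' Ms U (beta G B A B' A' Ac' u Ms Mts \<iota>')"
  defines "\<phi>\<^sub>2 \<equiv> phi2 A Mt Mts \<phi> J (\<lambda>j. \<iota>' (mj' j)) (\<lambda>j. \<iota> (mj j))"
  assumes "p_modular_system p \<K> \<O> k"
    and "group G" and "finite (carrier G)"
    and "crossed_product \<O> G A Ac" and "crossed_product \<O> G A' Ac'"
    and "\<And>g. g \<in> carrier G \<Longrightarrow> u g \<in> Ac g \<inter> Units A"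
    and "algebra_bimodule \<O> B B' M"
    and "\<And>m b'. m \<in> carrier M \<Longrightarrow> b' \<in> carrier B' \<Longrightarrow> \<iota> m \<triangleleft>\<^bsub>Mt\<^esub> b' = \<iota> (m \<triangleleft>\<^bsub>M\<^esub> b')"
    and "graded_Morita_equivalence \<O> G A Ac A' Ac' Mt Mtc"
    and "\<phi> \<in> graded_bimodule_iso G A' A'
           (tensor_bimod A Mts Mt) (tensor_grading G A Mts Mtsc Mt Mtc) (regular A') Ac'"
    and "\<psi> \<in> graded_bimodule_iso G A A
           (tensor_bimod A' Mt Mts) (tensor_grading G A' Mt Mtc Mts Mtsc) (regular A) Ac"
    and "\<And>x x' y. x \<in> carrier Mt \<Longrightarrow> x' \<in> carrier Mts \<Longrightarrow> y \<in> carrier Mt \<Longrightarrow>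
           \<psi> (ten A' Mt Mts x x') \<odot>\<^bsub>Mt\<^esub> y = x \<triangleleft>\<^bsub>Mt\<^esub> \<phi> (ten A Mts Mt x' y)"
    and "\<And>x' x y'. x' \<in> carrier Mts \<Longrightarrow> x \<in> carrier Mt \<Longrightarrow> y' \<in> carrier Mts \<Longrightarrow>
           \<phi> (ten A Mts Mt x' x) \<odot>\<^bsub>Mts\<^esub> y' = x' \<triangleleft>\<^bsub>Mts\<^esub> \<psi> (ten A' Mt Mts x y')"
    and "finite J"
    and "\<And>j. j \<in> J \<Longrightarrow> mj j \<in> carrier M" and "\<And>j. j \<in> J \<Longrightarrow> mj' j \<in> carrier Ms"
    and "\<phi> (\<Oplus>\<^bsub>tensor_ab A Mts Mt\<^esub>j \<in> J. ten A Mts Mt (\<iota>' (mj' j)) (\<iota> (mj j))) = \<one>\<^bsub>A'\<^esub>"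
    and "left_module B U"
  shows "(\<forall>c \<in> carrier C. \<theta> c \<in> carrier E \<and>
            (\<forall>a \<in> carrier A. \<forall>x \<in> carrier U.
               \<theta> c (ten B (regular A) U a x) = ten B (regular A) U (a \<otimes>\<^bsub>A\<^esub> c) x)) \<and>
         (\<forall>c' \<in> carrier C'. \<theta>' c' \<in> carrier E' \<and>
            (\<forall>a' \<in> carrier A'. \<forall>x' \<in> carrier U'.
               \<theta>' c' (ten B' (regular A') U' a' x') = ten B' (regular A') U' (a' \<otimes>\<^bsub>A'\<^esub> c') x')) \<and>
         \<phi>\<^sub>1 \<in> algebra_iso \<O> E E' \<and>
         \<phi>\<^sub>2 \<in> algebra_iso \<O> C C' \<and>
         (\<forall>c \<in> carrier C. \<phi>\<^sub>1 (\<theta> c) = \<theta>' (\<phi>\<^sub>2 c))"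
proof -
  interpret graded_morita G \<O> A Ac A' Ac' u M ract J mj mj' \<phi> \<psi> "Ac \<one>\<^bsub>G\<^esub>" "Ac' \<one>\<^bsub>G\<^esub>"
      B B' Ms Mt Mtc Mts Mtsc \<iota> \<iota>'
    by (intro graded_morita.intro graded_morita_axioms.intro)
      (simp_all only: B_def B'_def Ms_def Mt_def Mtc_def Mts_def Mtsc_def \<iota>_def \<iota>'_def identity_component_def,
        use assms in \<open>simp_all only: B_def B'_def Ms_def Mt_def Mtc_def Mts_def Mtsc_def \<iota>_def \<iota>'_def identity_component_def\<close>)
  note U = \<open>left_module B U\<close>
  note D = diagram[OF U, folded U'_def \<phi>\<^sub>1_def \<phi>\<^sub>2_def E_def E'_def]
  have C: "carrier C = centralizer A (Ac \<one>\<^bsub>G\<^esub>)" and C': "carrier C' = centralizer A' (Ac' \<one>\<^bsub>G\<^esub>)"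
    by (simp_all add: C_def C'_def)
  have K: "Ac \<one>\<^bsub>G\<^esub> \<subseteq> carrier A" and K': "Ac' \<one>\<^bsub>G\<^esub> \<subseteq> carrier A'"
    using K_in K'_in by blast+
  note th = theta_linear[OF ring_A ring_B[unfolded B] K U[unfolded B]]
    theta_ten[OF ring_A ring_B[unfolded B] K U[unfolded B]]
  \<comment> \<open>The map on the right is the same construction for \<open>U'\<close>, which is a
    left module over \<open>B'\<close> by the first claim of \<open>diagram\<close>.\<close>
  note th' = theta_linear[OF ring_A' ring_B'[unfolded B'] K' D(1)[unfolded B']]
    theta_ten[OF ring_A' ring_B'[unfolded B'] K' D(1)[unfolded B']]
  show ?thesis
    using D(2-4) th th'
    by (simp add: C C' \<theta>_def \<theta>'_def E_def E'_def C_def C'_def B B' U'_def)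
qed

end
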